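(* Let $\theta(z),\varphi(w)$ be two nonconstant inner functions on the unit disk, let $M$ be a submodule of $H^2(\mathbb{D}^2)$, and let $M_{\theta,\varphi}=[C_{\theta,\varphi}M]$. Then $M$ is Hilbert-Schmidt if and only if $M_{\theta,\varphi}$ is Hilbert-Schmidt. Moreover, $$\frac{1-|\theta(0)|}{1+|\theta(0)|}\cdot\frac{1-|\varphi(0)|}{1+|\varphi(0)|}\cdot\|C_M\|_{H.S.}\le\|C_{M_{\theta,\varphi}}\|_{H.S.}\le\frac{1+|\theta(0)|}{1-|\theta(0)|}\cdot\frac{1+|\varphi(0)|}{1-|\varphi(0)|}\cdot\|C_M\|_{H.S.},$$ where $C_M$ and $C_{M_{\theta,\varphi}}$ are the core operators of $M$ and $M_{\theta,\varphi}$.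
   Context: $\mathbb{D}$ is the open unit disk and $H^2(\mathbb{D}^2)$ the Hardy space over the bidisk. A submodule is a closed subspace of $H^2(\mathbb{D}^2)$ invariant under multiplication by $z$ and $w$. $[X]$ denotes the submodule generated by $X$, i.e. the norm closure of the linear span of $\mathbb{C}[z,w]\cdot X$. $C_{\theta,\varphi}f(z,w)=f(\theta(z),\varphi(w))$, a bounded operator on $H^2(\mathbb{D}^2)$. An inner function is a bounded analytic function on $\mathbb{D}$ whose boundary values have modulus 1 a.e. For a submodule $M$ with reproducing kernel $K^M_{\lambda,\mu}(z,w)$, the core function is $G^M_{\lambda,\mu}(z,w)=(1-\bar\lambda z)(1-\bar\mu w)K^M_{\lambda,\mu}(z,w)$, and the core operator is $C_M(f)(z,w)=\int_{\mathbb{T}^2}G^M_{\lambda,\mu}(z,w)f(\lambda,\mu)\,|d\lambda||d\mu|$, $f\in H^2(\mathbb{D}^2)$, with normalized Lebesgue measure. Equivalently, $C_M$ is zero on $H^2(\mathbb{D}^2)\ominus M$ and on $M$ equals $I-R_zR_z^*-R_wR_w^*+R_zR_wR_z^*R_w^*$, where $R_z,R_w$ are the restrictions to $M$ of multiplication by $z,w$. Write $[A,B]=AB-BA$. $M$ is called Hilbert-Schmidt if both $\Sigma_0^M=\|[R_z^*,R_z][R_w^*,R_w]\|_{H.S.}^2$ and $\Sigma_1^M=\|[R_z^*,R_w]\|_{H.S.}^2$ are finite; equivalently, $C_M$ is a Hilbert-Schmidt operator. $\|\cdot\|_{H.S.}$ is the Hilbert-Schmidt norm, taken to be $+\infty$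 for operators that are not Hilbert-Schmidt. *)

theory Defs
  imports "HOL-Complex_Analysis.Complex_Analysis" "HOL-Computational_Algebra.Polynomial" "HOL-Library.Function_Algebras"
begin

text \<open>
  Elements of the Hardy space are functions on the bidisk, represented as total functions
  that are 0 outside the bidisk, so that equality in the Hardy space is HOL equality.
  Vector space operations are the pointwise ones.
\<close>

abbreviation disk :: "complex set" where
  "disk \<equiv> ball 0 1"

abbreviation bidisk :: "(complex \<times> complex) set" where
  "bidisk \<equiv> disk \<times> disk"

type_synonym fun2 = "complex \<times> complex \<Rightarrow> complex"

definition has_h2_coeffs :: "fun2 \<Rightarrow> (nat \<times> nat \<Rightarrow> complex) \<Rightarrow> bool" where
  "has_h2_coeffs f a \<longleftrightarrow>
     (\<lambda>k. (norm (a k))\<^sup>2) summable_on UNIV \<and>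
     (\<forall>z\<in>disk. \<forall>w\<in>disk. ((\<lambda>(i, j). a (i, j) * z ^ i * w ^ j) has_sum f (z, w)) UNIV) \<and>
     (\<forall>p. p \<notin> bidisk \<longrightarrow> f p = 0)"

definition H2 :: "fun2 set" where
  "H2 = {f. \<exists>a. has_h2_coeffs f a}"

definition h2_coeffs :: "fun2 \<Rightarrow> nat \<times> nat \<Rightarrow> complex" where
  "h2_coeffs f = (THE a. has_h2_coeffs f a)"

definition h2_inner :: "fun2 \<Rightarrow> fun2 \<Rightarrow> complex" where
  "h2_inner f g = (\<Sum>\<^sub>\<infinity>k. h2_coeffs f k * cnj (h2_coeffs g k))"

definition h2_norm :: "fun2 \<Rightarrow> real" where
  "h2_norm f = sqrt (\<Sum>\<^sub>\<infinity>k. (norm (h2_coeffs f k))\<^sup>2)"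

definition h2_closure :: "fun2 set \<Rightarrow> fun2 set" where
  "h2_closure X = {g \<in> H2. \<forall>e>0. \<exists>f\<in>X. h2_norm (f - g) < e}"

definition cscale :: "complex \<Rightarrow> fun2 \<Rightarrow> fun2" where
  "cscale c f = (\<lambda>p. c * f p)"

global_interpretation cfun: vector_space cscale
  by unfold_locales (auto simp: cscale_def fun_eq_iff algebra_simps)

definition orthonormal_basis :: "fun2 set \<Rightarrow> fun2 set \<Rightarrow> bool" where
  "orthonormal_basis V E \<longleftrightarrow>
     E \<subseteq> V \<and>
     (\<forall>e\<in>E. \<forall>f\<in>E. h2_inner e f = (if e = f then 1 else 0)) \<and>
     V \<subseteq> h2_closure (cfun.span E)"

definition mult_z :: "fun2 \<Rightarrow> fun2" where
  "mult_z f = (\<lambda>(z, w). z * f (z, w))"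

definition mult_w :: "fun2 \<Rightarrow> fun2" where
  "mult_w f = (\<lambda>(z, w). w * f (z, w))"

definition submodule :: "fun2 set \<Rightarrow> bool" where
  "submodule M \<longleftrightarrow>
     M \<subseteq> H2 \<and> cfun.subspace M \<and> h2_closure M \<subseteq> M \<and>
     mult_z ` M \<subseteq> M \<and> mult_w ` M \<subseteq> M"

text \<open>Polynomials in two variables, as polynomials in \<open>w\<close> with coefficients in \<open>\<complex>[z]\<close>.\<close>

definition poly2 :: "complex poly poly \<Rightarrow> fun2" where
  "poly2 P = (\<lambda>(z, w). poly (poly P [:w:]) z)"

definition generated_submodule :: "fun2 set \<Rightarrow> fun2 set" where
  "generated_submodule X = h2_closure (cfun.span {poly2 P * f | P f. f \<in> X})"

definition circle :: "complex measure" where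
  "circle = distr (uniform_measure lborel {0..2 * pi}) borel cis"

definition torus :: "(complex \<times> complex) measure" where
  "torus = circle \<Otimes>\<^sub>M circle"

definition inner_function :: "(complex \<Rightarrow> complex) \<Rightarrow> bool" where
  "inner_function \<theta> \<longleftrightarrow>
     \<theta> holomorphic_on disk \<and> bounded (\<theta> ` disk) \<and>
     (AE \<zeta> in circle. \<exists>l. ((\<lambda>r. \<theta> (complex_of_real r * \<zeta>)) \<longlongrightarrow> l) (at_left 1) \<and> norm l = 1)"

definition comp_op :: "(complex \<Rightarrow> complex) \<Rightarrow> (complex \<Rightarrow> complex) \<Rightarrow> fun2 \<Rightarrow> fun2" where
  "comp_op \<theta> \<phi> f = (\<lambda>(z, w). if (z, w) \<in> bidisk then f (\<theta> z, \<phi> w) else 0)"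

text \<open>
  The boundary function on the torus of an \<open>H\<^sup>2\<close> function (or of the complex conjugate
  of one) is the \<open>L\<^sup>2\<close> limit of its dilations; it is unique up to a null set.
\<close>

definition is_boundary :: "fun2 \<Rightarrow> fun2 \<Rightarrow> bool" where
  "is_boundary F g \<longleftrightarrow>
     g \<in> borel_measurable torus \<and> integrable torus (\<lambda>p. (norm (g p))\<^sup>2) \<and>
     ((\<lambda>r. \<integral>\<^sup>+ (\<zeta>, \<eta>). ennreal ((norm (F (complex_of_real r * \<zeta>, complex_of_real r * \<eta>) - g (\<zeta>, \<eta>)))\<^sup>2) \<partial>torus)
        \<longlongrightarrow> 0) (at_left 1)"

definition boundary :: "fun2 \<Rightarrow> fun2" where
  "boundary F = (SOME g. is_boundary F g)"

definition rep_kernel :: "fun2 set \<Rightarrow> complex \<times> complex \<Rightarrow> fun2" where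
  "rep_kernel M p = (THE k. k \<in> M \<and> (\<forall>f\<in>M. f p = h2_inner f k))"

definition core_fun :: "fun2 set \<Rightarrow> complex \<times> complex \<Rightarrow> complex \<times> complex \<Rightarrow> complex" where
  "core_fun M = (\<lambda>(l, m) (z, w).
     (1 - cnj l * z) * (1 - cnj m * w) * rep_kernel M (l, m) (z, w))"

definition core_op :: "fun2 set \<Rightarrow> fun2 \<Rightarrow> fun2" where
  "core_op M f = (\<lambda>p. if p \<in> bidisk
     then (\<integral>q. boundary (\<lambda>q'. core_fun M q' p) q * boundary f q \<partial>torus) else 0)"

text \<open>
  For a bounded operator \<open>T\<close> on a closed subspace \<open>V\<close> the sum does not depend on the
  orthonormal basis of \<open>V\<close>.
\<close>

definition hs_norm_sq :: "fun2 set \<Rightarrow> (fun2 \<Rightarrow> fun2) \<Rightarrow> ennreal" where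
  "hs_norm_sq V T =
     (\<Sum>\<^sub>\<infinity>e \<in> (SOME E. orthonormal_basis V E). ennreal ((h2_norm (T e))\<^sup>2))"

definition hs_norm :: "fun2 set \<Rightarrow> (fun2 \<Rightarrow> fun2) \<Rightarrow> ennreal" where
  "hs_norm V T =
     (if hs_norm_sq V T = \<infinity> then \<infinity> else ennreal (sqrt (enn2real (hs_norm_sq V T))))"

definition adj :: "fun2 set \<Rightarrow> (fun2 \<Rightarrow> fun2) \<Rightarrow> fun2 \<Rightarrow> fun2" where
  "adj M A f = (THE g. g \<in> M \<and> (\<forall>h\<in>M. h2_inner (A h) f = h2_inner h g))"

definition commutator :: "(fun2 \<Rightarrow> fun2) \<Rightarrow> (fun2 \<Rightarrow> fun2) \<Rightarrow> fun2 \<Rightarrow> fun2" where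
  "commutator A B = (\<lambda>f. A (B f) - B (A f))"

definition Sigma0 :: "fun2 set \<Rightarrow> ennreal" where
  "Sigma0 M = hs_norm_sq M
     (commutator (adj M mult_z) mult_z \<circ> commutator (adj M mult_w) mult_w)"

definition Sigma1 :: "fun2 set \<Rightarrow> ennreal" where
  "Sigma1 M = hs_norm_sq M (commutator (adj M mult_z) mult_w)"

definition hilbert_schmidt :: "fun2 set \<Rightarrow> bool" where
  "hilbert_schmidt M \<longleftrightarrow> Sigma0 M < \<infinity> \<and> Sigma1 M < \<infinity>"

end

theory Submission
  imports Defs
begin

text \<open>
  Write \<open>C f (z, w) = f (\<theta> z, \<phi> w)\<close>. The core operator of \<open>M\<close> sends \<open>f\<close> to the function
  \<open>p \<mapsto> \<langle>f, G\<^sub>p\<rangle>\<close>, where \<open>G\<^sub>p\<close> is the core function of \<open>M\<close> with first argument \<open>p\<close>; this turns the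
  integral over the torus into an inner product (\<open>core_op_eq\<close>, which rests on
  \<open>integral_boundary\<close>). Everything then takes place in the Hilbert space \<open>H2\<close>.

  The heart of the matter is that the core function of the generated submodule \<open>M'\<close> is
  \<open>G'\<^sub>p = C G\<^sub>q\<close> with \<open>q = (\<theta> z, \<phi> w)\<close> for \<open>p = (z, w)\<close> (\<open>core_fun_lift\<close>). Division by the
  factors in the definition of the core function turns the right-hand side into a candidate for the
  reproducing kernel of \<open>M'\<close>. It lies in \<open>M'\<close> because the geometric series converges in norm. It
  reproduces values because \<open>\<theta>\<close> acts as an isometric multiplier: the functions \<open>\<theta>\<^sup>n S\<^sub>\<lambda>\<close>, with
  \<open>S\<^sub>\<lambda> = (1 - cnj (\<theta> \<lambda>) \<theta>) / (1 - cnj \<lambda> z)\<close>, are orthogonal for different \<open>n\<close>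
  (\<open>inner_model_kernel_powers\<close>). With the same for \<open>\<phi>\<close>, inner products of the functions
  \<open>S\<^sub>\<lambda> S\<^sub>\<mu> C f\<close>, \<open>f \<in> M\<close>, reduce to inner products in \<open>M\<close> (\<open>inner_model_mult\<close>), and these
  functions generate \<open>M'\<close> (\<open>M'_reproduced\<close>).

  Hence the core operator of \<open>M'\<close> is \<open>C T C\<^sup>*\<close> with \<open>T\<close> the core operator of \<open>M\<close> (\<open>core_op_lift\<close>),
  and the two inequalities follow from the bounds \<open>|f|\<^sup>2 / \<kappa> \<le> |C f|\<^sup>2 \<le> \<kappa> |f|\<^sup>2\<close>, where \<open>\<kappa>\<close> is
  the constant of the theorem (\<open>comp_op_bounds\<close>). For these, the powers of \<open>\<theta>\<close> have the Gram matrix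
  of the Poisson kernel at \<open>\<theta> 0\<close>, a Toeplitz matrix that is estimated by an elementary induction
  (\<open>toeplitz_bounds_aux\<close>).

  Finally \<open>M\<close> is Hilbert-Schmidt if and only if its core operator is, since the squared norm of the
  latter is exactly \<open>\<Sigma>\<^sub>0 + \<Sigma>\<^sub>1\<close> (\<open>hs_norm_sq_core_op_Sigma\<close>). Hilbert-Schmidt norms
  are compared throughout by passing to adjoints (\<open>hs_norm_sq_adjoint\<close>).
\<close>

section \<open>Square-summable coefficients\<close>

definition ell2 :: "(nat \<times> nat \<Rightarrow> complex) \<Rightarrow> bool" where
  "ell2 a \<longleftrightarrow> (\<lambda>k. (norm (a k))\<^sup>2) summable_on UNIV"

definition mon :: "nat \<times> nat \<Rightarrow> complex \<times> complex \<Rightarrow> complex" where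
  "mon k p = fst p ^ fst k * snd p ^ snd k"

lemma mon_zero [simp]: "mon (0, 0) p = 1"
  by (simp add: mon_def)

lemma has_h2_coeffs_iff:
  "has_h2_coeffs f a \<longleftrightarrow> ell2 a \<and> (\<forall>p\<in>bidisk. ((\<lambda>k. a k * mon k p) has_sum f p) UNIV)
     \<and> (\<forall>p. p \<notin> bidisk \<longrightarrow> f p = 0)"
  by (auto simp: has_h2_coeffs_def ell2_def mon_def case_prod_unfold mult.assoc)

lemma ell2_mult_abs_summable:
  assumes "ell2 a" "ell2 b"
  shows "(\<lambda>k. norm (a k * b k)) summable_on UNIV"
  using abs_summable_product[of a UNIV b] assms by (simp add: ell2_def norm_mult power2_eq_square)

lemma ell2_mult_summable: "ell2 a \<Longrightarrow> ell2 b \<Longrightarrow> (\<lambda>k. a k * b k) summable_on UNIV"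
  by (rule abs_summable_summable) (rule ell2_mult_abs_summable)

lemma ell2_cnj [simp]: "ell2 (\<lambda>k. cnj (a k)) \<longleftrightarrow> ell2 a"
  by (simp add: ell2_def)

lemma ell2_cmult: "ell2 a \<Longrightarrow> ell2 (\<lambda>k. c * a k)"
  by (simp add: ell2_def norm_mult power_mult_distrib summable_on_cmult_right)

lemma ell2_add:
  assumes "ell2 a" "ell2 b"
  shows "ell2 (\<lambda>k. a k + b k)"
  unfolding ell2_def
proof (rule summable_on_comparison_test)
  show "(\<lambda>k. 2 * (norm (a k))\<^sup>2 + 2 * (norm (b k))\<^sup>2) summable_on UNIV"
    using assms by (intro summable_on_add summable_on_cmult_right) (auto simp: ell2_def)
  fix k
  have "norm (a k + b k) \<le> norm (a k) + norm (b k)" by (rule norm_triangle_ineq)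
  then have "(norm (a k + b k))\<^sup>2 \<le> (norm (a k) + norm (b k))\<^sup>2" by (intro power_mono) auto
  also have "\<dots> \<le> 2 * (norm (a k))\<^sup>2 + 2 * (norm (b k))\<^sup>2"
    using sum_squares_bound[of "norm (a k)" "norm (b k)"] by (simp add: power2_sum)
  finally show "(norm (a k + b k))\<^sup>2 \<le> 2 * (norm (a k))\<^sup>2 + 2 * (norm (b k))\<^sup>2" .
qed auto

lemma summable_geometric_pair:
  fixes x y :: real
  assumes "0 \<le> x" "x < 1" "0 \<le> y" "y < 1"
  shows "(\<lambda>k. x ^ fst k * y ^ snd k) summable_on (UNIV :: (nat \<times> nat) set)"
proof -
  have gx: "(\<lambda>n. x ^ n) summable_on UNIV"
    using assms by (intro summable_nonneg_imp_summable_on summable_geometric) auto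
  have gy: "(\<lambda>n. y ^ n) summable_on UNIV"
    using assms by (intro summable_nonneg_imp_summable_on summable_geometric) auto
  have "(\<lambda>k. x ^ fst k * y ^ snd k) summable_on (Sigma UNIV (\<lambda>_. UNIV) :: (nat \<times> nat) set)"
  proof (rule summable_on_SigmaI)
    show "((\<lambda>n. x ^ fst (m, n) * y ^ snd (m, n)) has_sum (x ^ m * infsum ((^) y) UNIV)) UNIV" for m
      using has_sum_cmult_right[OF has_sum_infsum[OF gy], of "x ^ m"] by simp
    show "(\<lambda>m. x ^ m * infsum ((^) y) UNIV) summable_on UNIV"
      by (intro summable_on_cmult_left gx)
  qed (use assms in auto)
  then show ?thesis by simp
qed

lemma mem_bidisk: "p \<in> bidisk \<longleftrightarrow> norm (fst p) < 1 \<and> norm (snd p) < 1"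
  by (cases p) auto

lemma norm_mon: "norm (mon k p) = norm (fst p) ^ fst k * norm (snd p) ^ snd k"
  by (simp add: mon_def norm_mult norm_power)

lemma ell2_mon:
  assumes "p \<in> bidisk"
  shows "ell2 (\<lambda>k. mon k p)"
proof -
  have "norm x ^ 2 < 1" if "norm x < 1" for x :: complex
    using that by (simp add: power_less_one_iff)
  then show ?thesis
    using summable_geometric_pair[of "norm (fst p)^2" "norm (snd p)^2"] assms
    by (simp add: ell2_def norm_mon power_mult_distrib power_mult[symmetric] mult.commute mem_bidisk)
qed

lemma powser_zero_unique:
  fixes a :: "nat \<Rightarrow> complex"
  assumes "0 < r" and "\<And>z. norm z < r \<Longrightarrow> (\<lambda>n. a n * z ^ n) sums 0"
  shows "a n = 0"
proof (cases "n = 0")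
  case True
  then show ?thesis using assms(2)[of 0] assms(1) by simp
next
  case False
  show ?thesis
  proof (rule ccontr)
    assume "a n \<noteq> 0"
    show False
    proof (rule powser_0_nonzero[of r 0 a "\<lambda>_. 0" n])
      fix s :: real
      assume s: "0 < s" "\<And>z::complex. z \<in> cball 0 s - {0} \<Longrightarrow> (0::complex) \<noteq> 0"
      have "complex_of_real s \<in> cball 0 s - {0}" using s(1) by simp
      then show False using s(2) by blast
    qed (use assms False \<open>a n \<noteq> 0\<close> in auto)
  qed
qed

text \<open>The one-variable identity theorem applies to the coefficients \<open>\<Sum>j. a (i, j) w\<^sup>j\<close> for
  fixed \<open>w\<close>, and then to each of these series in \<open>w\<close>.\<close>

lemma double_powser_zero_unique:
  assumes "\<And>p. p \<in> bidisk \<Longrightarrow> ((\<lambda>k. a k * mon k p) has_sum 0) UNIV"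
  shows "a k = 0"
proof -
  obtain i j where k: "k = (i, j)" by (cases k)
  let ?b = "\<lambda>w i. \<Sum>\<^sub>\<infinity>j. a (i, j) * w ^ j"
  \<comment> \<open>any nonzero first coordinate would do in place of 1/2\<close>
  have inner: "((\<lambda>j. a (i, j) * w ^ j) has_sum ?b w i) UNIV" if "norm w < 1" for w i
  proof -
    have "(\<lambda>(i,j). a (i, j) * mon (i, j) (1/2, w)) summable_on Sigma UNIV (\<lambda>_. UNIV)"
      using has_sum_imp_summable[OF assms[of "(1/2, w)"]] that
      by (simp add: case_prod_unfold mem_bidisk norm_divide)
    then have "(\<lambda>j. a (i, j) * mon (i, j) (1/2, w)) summable_on UNIV"
      by (rule summable_on_SigmaD1) auto
    then have "(\<lambda>j. 2 ^ i * (a (i, j) * mon (i, j) (1/2, w))) summable_on UNIV"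
      by (rule summable_on_cmult_right)
    then show ?thesis
      by (simp add: mon_def field_simps)
  qed
  have b0: "?b w i = 0" if w: "norm w < 1" for w i
  proof (rule powser_zero_unique[of 1])
    fix z :: complex assume z: "norm z < 1"
    have "((\<lambda>i. z ^ i * ?b w i) has_sum 0) UNIV"
    proof (rule has_sum_SigmaD)
      show "((\<lambda>k. a k * mon k (z, w)) has_sum 0) (Sigma UNIV (\<lambda>_. UNIV))"
        using assms[of "(z, w)"] z w by (simp add: mem_bidisk)
      show "((\<lambda>j. a (i, j) * mon (i, j) (z, w)) has_sum z ^ i * ?b w i) UNIV" for i
        using has_sum_cmult_right[OF inner[OF w, of i], of "z ^ i"] by (simp add: mon_def ac_simps)
    qed
    from has_sum_imp_sums[OF this] show "(\<lambda>i. ?b w i * z ^ i) sums 0" by (simp add: mult.commute)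
  qed auto
  have "a (i, j) = 0"
  proof (rule powser_zero_unique[of 1 "\<lambda>j. a (i, j)"])
    fix w :: complex assume "norm w < 1"
    from has_sum_imp_sums[OF inner[OF this, of i]] b0[OF this, of i]
    show "(\<lambda>j. a (i, j) * w ^ j) sums 0" by simp
  qed auto
  then show ?thesis by (simp add: k)
qed

section \<open>The Hardy space as a Hilbert space\<close>

lemma has_h2_coeffs_unique:
  assumes "has_h2_coeffs f a" "has_h2_coeffs f b"
  shows "a = b"
proof
  fix k
  have "((\<lambda>k. (a k - b k) * mon k p) has_sum 0) UNIV" if "p \<in> bidisk" for p
  proof -
    have "((\<lambda>k. a k * mon k p) has_sum f p) UNIV" "((\<lambda>k. - (b k * mon k p)) has_sum (- f p)) UNIV"
      using assms that by (auto simp: has_h2_coeffs_iff intro: has_sum_uminusI)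
    from has_sum_add[OF this] show ?thesis by (simp add: left_diff_distrib)
  qed
  from double_powser_zero_unique[OF this] show "a k = b k" by simp
qed

lemma h2_coeffs_eqI: "has_h2_coeffs f a \<Longrightarrow> h2_coeffs f = a"
  unfolding h2_coeffs_def by (rule the_equality) (auto intro: has_h2_coeffs_unique)

lemma has_h2_coeffs_h2_coeffs: "f \<in> H2 \<Longrightarrow> has_h2_coeffs f (h2_coeffs f)"
  using h2_coeffs_eqI by (auto simp: H2_def)

lemma ell2_h2_coeffs: "f \<in> H2 \<Longrightarrow> ell2 (h2_coeffs f)"
  using has_h2_coeffs_h2_coeffs by (auto simp: has_h2_coeffs_iff)

lemma H2_has_sum: "f \<in> H2 \<Longrightarrow> p \<in> bidisk \<Longrightarrow> ((\<lambda>k. h2_coeffs f k * mon k p) has_sum f p) UNIV"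
  using has_h2_coeffs_h2_coeffs by (auto simp: has_h2_coeffs_iff)

lemma H2_outside: "f \<in> H2 \<Longrightarrow> p \<notin> bidisk \<Longrightarrow> f p = 0"
  using has_h2_coeffs_h2_coeffs has_h2_coeffs_iff by blast

lemma H2_I: "has_h2_coeffs f a \<Longrightarrow> f \<in> H2"
  by (auto simp: H2_def)

lemma H2_eqI:
  assumes "f \<in> H2" "g \<in> H2" "\<And>p. p \<in> bidisk \<Longrightarrow> f p = g p"
  shows "f = g"
  using assms H2_outside by (metis ext)

definition h2fun :: "(nat \<times> nat \<Rightarrow> complex) \<Rightarrow> fun2" where
  "h2fun a = (\<lambda>p. if p \<in> bidisk then \<Sum>\<^sub>\<infinity>k. a k * mon k p else 0)"

lemma has_h2_coeffs_h2fun: "ell2 a \<Longrightarrow> has_h2_coeffs (h2fun a) a"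
  unfolding has_h2_coeffs_iff h2fun_def
  by (auto intro!: has_sum_infsum ell2_mult_summable ell2_mon simp del: mem_Times_iff)

lemma h2fun_in_H2: "ell2 a \<Longrightarrow> h2fun a \<in> H2"
  by (rule H2_I[OF has_h2_coeffs_h2fun])

lemma h2_coeffs_h2fun: "ell2 a \<Longrightarrow> h2_coeffs (h2fun a) = a"
  by (rule h2_coeffs_eqI[OF has_h2_coeffs_h2fun])

lemma H2_coeffs_eqI:
  assumes "f \<in> H2" "g \<in> H2" "h2_coeffs f = h2_coeffs g"
  shows "f = g"
  using H2_has_sum[OF assms(1)] H2_has_sum[OF assms(2)] has_sum_unique
  unfolding assms(3) by (intro H2_eqI[OF assms(1,2)]) blast

lemma cscale_apply [simp]: "cscale c f p = c * f p"
  by (simp add: cscale_def)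

lemma zero_has_h2_coeffs: "has_h2_coeffs 0 (\<lambda>_. 0)"
  by (simp add: has_h2_coeffs_iff ell2_def)

lemma add_has_h2_coeffs:
  assumes "f \<in> H2" "g \<in> H2"
  shows "has_h2_coeffs (f + g) (\<lambda>k. h2_coeffs f k + h2_coeffs g k)"
  unfolding has_h2_coeffs_iff
proof (intro conjI ballI allI impI)
  fix p
  show "((\<lambda>k. (h2_coeffs f k + h2_coeffs g k) * mon k p) has_sum (f + g) p) UNIV" if "p \<in> bidisk"
    using has_sum_add[OF H2_has_sum[OF assms(1) that] H2_has_sum[OF assms(2) that]]
    by (simp add: distrib_right)
  show "(f + g) p = 0" if "p \<notin> bidisk"
    using H2_outside[OF assms(1) that] H2_outside[OF assms(2) that] by simp
qed (intro ell2_add ell2_h2_coeffs assms)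

lemma cscale_has_h2_coeffs:
  assumes "f \<in> H2"
  shows "has_h2_coeffs (cscale c f) (\<lambda>k. c * h2_coeffs f k)"
  unfolding has_h2_coeffs_iff
proof (intro conjI ballI allI impI)
  fix p
  show "((\<lambda>k. (c * h2_coeffs f k) * mon k p) has_sum (cscale c f) p) UNIV" if "p \<in> bidisk"
    using has_sum_cmult_right[OF H2_has_sum[OF assms(1) that], of c] by (simp add: mult.assoc)
  show "cscale c f p = 0" if "p \<notin> bidisk" using H2_outside[OF assms(1) that] by simp
qed (intro ell2_cmult ell2_h2_coeffs assms)

lemma H2_subspace: "cfun.subspace H2"
  unfolding cfun.subspace_def
  using zero_has_h2_coeffs add_has_h2_coeffs cscale_has_h2_coeffs H2_I by blast

lemma H2_0 [simp]: "0 \<in> H2"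
  by (rule cfun.subspace_0[OF H2_subspace])

lemma H2_add: "f \<in> H2 \<Longrightarrow> g \<in> H2 \<Longrightarrow> f + g \<in> H2"
  by (rule cfun.subspace_add[OF H2_subspace])

lemma H2_diff: "f \<in> H2 \<Longrightarrow> g \<in> H2 \<Longrightarrow> f - g \<in> H2"
  by (rule cfun.subspace_diff[OF H2_subspace])

lemma H2_cscale: "f \<in> H2 \<Longrightarrow> cscale c f \<in> H2"
  by (rule cfun.subspace_scale[OF H2_subspace])

lemma H2_sum: "(\<And>i. i \<in> A \<Longrightarrow> F i \<in> H2) \<Longrightarrow> sum F A \<in> H2"
  by (rule cfun.subspace_sum[OF H2_subspace])

lemma h2_coeffs_0 [simp]: "h2_coeffs 0 = (\<lambda>_. 0)"
  by (rule h2_coeffs_eqI[OF zero_has_h2_coeffs])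

lemma h2_coeffs_add:
  "f \<in> H2 \<Longrightarrow> g \<in> H2 \<Longrightarrow> h2_coeffs (f + g) = (\<lambda>k. h2_coeffs f k + h2_coeffs g k)"
  by (rule h2_coeffs_eqI[OF add_has_h2_coeffs])

lemma h2_coeffs_cscale: "f \<in> H2 \<Longrightarrow> h2_coeffs (cscale c f) = (\<lambda>k. c * h2_coeffs f k)"
  by (rule h2_coeffs_eqI[OF cscale_has_h2_coeffs])

lemma diff_eq_add_cscale: "f - g = f + cscale (-1) g"
  by (simp add: fun_eq_iff)

lemma h2_coeffs_diff:
  "f \<in> H2 \<Longrightarrow> g \<in> H2 \<Longrightarrow> h2_coeffs (f - g) = (\<lambda>k. h2_coeffs f k - h2_coeffs g k)"
  unfolding diff_eq_add_cscale[of f g]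
  by (subst h2_coeffs_add) (auto simp: h2_coeffs_cscale H2_cscale simp del: cfun.scale_minus_left)

lemma h2_coeffs_sum:
  "(\<And>i. i \<in> A \<Longrightarrow> F i \<in> H2) \<Longrightarrow> h2_coeffs (sum F A) = (\<lambda>k. \<Sum>i\<in>A. h2_coeffs (F i) k)"
  by (induction A rule: infinite_finite_induct) (auto simp: h2_coeffs_add H2_sum)

subsection \<open>Inner product and norm\<close>

lemma inner_summable:
  assumes "f \<in> H2" "g \<in> H2"
  shows "(\<lambda>k. h2_coeffs f k * cnj (h2_coeffs g k)) summable_on UNIV"
  using assms by (intro ell2_mult_summable) (auto simp: ell2_h2_coeffs)

lemma inner_add_left:
  "f \<in> H2 \<Longrightarrow> g \<in> H2 \<Longrightarrow> h \<in> H2 \<Longrightarrow> h2_inner (f + g) h = h2_inner f h + h2_inner g h"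
  using infsum_add[OF inner_summable inner_summable, of f h g h]
  by (simp add: h2_inner_def h2_coeffs_add distrib_right)

lemma inner_cscale_left:
  "f \<in> H2 \<Longrightarrow> h2_inner (cscale c f) h = c * h2_inner f h"
  by (simp add: h2_inner_def h2_coeffs_cscale mult.assoc infsum_cmult_right')

lemma inner_cnj: "cnj (h2_inner f g) = h2_inner g f"
proof -
  have "cnj (h2_inner f g) = (\<Sum>\<^sub>\<infinity>k. cnj (h2_coeffs f k * cnj (h2_coeffs g k)))"
    unfolding h2_inner_def by (rule infsum_cnj[symmetric])
  then show ?thesis by (simp add: h2_inner_def mult.commute)
qed

lemma inner_diff_left:
  "f \<in> H2 \<Longrightarrow> g \<in> H2 \<Longrightarrow> h \<in> H2 \<Longrightarrow> h2_inner (f - g) h = h2_inner f h - h2_inner g h"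
  unfolding diff_eq_add_cscale[of f g]
  by (subst inner_add_left) (auto simp: inner_cscale_left H2_cscale simp del: cfun.scale_minus_left)

lemma inner_add_right:
  "f \<in> H2 \<Longrightarrow> g \<in> H2 \<Longrightarrow> h \<in> H2 \<Longrightarrow> h2_inner h (f + g) = h2_inner h f + h2_inner h g"
  by (metis inner_add_left inner_cnj complex_cnj_add)

lemma inner_diff_right:
  "f \<in> H2 \<Longrightarrow> g \<in> H2 \<Longrightarrow> h \<in> H2 \<Longrightarrow> h2_inner h (f - g) = h2_inner h f - h2_inner h g"
  by (metis inner_diff_left inner_cnj complex_cnj_diff)

lemma inner_cscale_right:
  "f \<in> H2 \<Longrightarrow> h2_inner h (cscale c f) = cnj c * h2_inner h f"
  by (metis inner_cscale_left inner_cnj complex_cnj_mult)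

lemma inner_0_left [simp]: "h2_inner 0 h = 0"
  and inner_0_right [simp]: "h2_inner h 0 = 0"
  by (simp_all add: h2_inner_def)

lemma inner_sum_left:
  "(\<And>i. i \<in> A \<Longrightarrow> F i \<in> H2) \<Longrightarrow> h \<in> H2 \<Longrightarrow> h2_inner (sum F A) h = (\<Sum>i\<in>A. h2_inner (F i) h)"
  by (induction A rule: infinite_finite_induct) (auto simp: inner_add_left H2_sum)

lemma inner_sum_right:
  "(\<And>i. i \<in> A \<Longrightarrow> F i \<in> H2) \<Longrightarrow> h \<in> H2 \<Longrightarrow> h2_inner h (sum F A) = (\<Sum>i\<in>A. h2_inner h (F i))"
  by (induction A rule: infinite_finite_induct) (auto simp: inner_add_right H2_sum)

lemma norm_sq_eq_infsum: "(h2_norm f)\<^sup>2 = (\<Sum>\<^sub>\<infinity>k. (norm (h2_coeffs f k))\<^sup>2)"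
  unfolding h2_norm_def by (intro real_sqrt_pow2 infsum_nonneg) auto

lemma norm_sq_eq_inner:
  assumes "f \<in> H2"
  shows "h2_inner f f = of_real ((h2_norm f)\<^sup>2)"
  unfolding norm_sq_eq_infsum h2_inner_def complex_norm_square[symmetric]
  by (intro infsumI has_sum_of_real has_sum_infsum)
    (use ell2_h2_coeffs[OF assms] in \<open>simp add: ell2_def\<close>)

lemma norm_sq_eq_Re: "f \<in> H2 \<Longrightarrow> (h2_norm f)\<^sup>2 = Re (h2_inner f f)"
  by (simp add: norm_sq_eq_inner)

lemma h2_norm_nonneg [simp]: "0 \<le> h2_norm f"
  by (simp add: h2_norm_def infsum_nonneg)

lemma h2_norm_0 [simp]: "h2_norm 0 = 0"
  by (simp add: h2_norm_def)

lemma h2_norm_eq_0: "f \<in> H2 \<Longrightarrow> h2_norm f = 0 \<longleftrightarrow> f = 0"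
proof
  assume f: "f \<in> H2" and "h2_norm f = 0"
  then have *: "(\<Sum>\<^sub>\<infinity>k. (norm (h2_coeffs f k))\<^sup>2) = 0" by (simp add: norm_sq_eq_infsum[symmetric])
  have "(norm (h2_coeffs f k))\<^sup>2 = 0" for k
    by (rule nonneg_infsum_le_0D[of _ UNIV])
      (use * ell2_h2_coeffs[OF f] in \<open>auto simp: ell2_def\<close>)
  then show "f = 0" by (intro H2_coeffs_eqI f) (auto simp: fun_eq_iff)
qed simp

lemma norm_add_sq:
  assumes "f \<in> H2" "g \<in> H2"
  shows "(h2_norm (f + g))\<^sup>2 = (h2_norm f)\<^sup>2 + (h2_norm g)\<^sup>2 + 2 * Re (h2_inner f g)"
proof -
  have "Re (h2_inner g f) = Re (h2_inner f g)"
    unfolding inner_cnj[of f g, symmetric] by simp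
  then show ?thesis using assms by (simp add: norm_sq_eq_Re inner_add_left inner_add_right H2_add)
qed

lemma norm_cscale: "f \<in> H2 \<Longrightarrow> h2_norm (cscale c f) = norm c * h2_norm f"
  unfolding h2_norm_def h2_coeffs_cscale norm_mult power_mult_distrib infsum_cmult_right'
  by (simp add: real_sqrt_mult)

lemma norm_diff_sq:
  assumes "f \<in> H2" "g \<in> H2"
  shows "(h2_norm (f - g))\<^sup>2 = (h2_norm f)\<^sup>2 + (h2_norm g)\<^sup>2 - 2 * Re (h2_inner f g)"
  unfolding diff_eq_add_cscale[of f g] using assms
  by (subst norm_add_sq)
    (auto simp: H2_cscale norm_cscale inner_cscale_right simp del: cfun.scale_minus_left)

lemma pythagoras:
  "f \<in> H2 \<Longrightarrow> g \<in> H2 \<Longrightarrow> h2_inner f g = 0 \<Longrightarrow> (h2_norm (f + g))\<^sup>2 = (h2_norm f)\<^sup>2 + (h2_norm g)\<^sup>2"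
  by (simp add: norm_add_sq)

text \<open>Subtracting from \<open>f\<close> its component along \<open>g\<close> yields both the Cauchy-Schwarz inequality and
  the orthogonality of the best approximation in a closed subspace.\<close>

lemma norm_diff_component:
  assumes f: "f \<in> H2" and g: "g \<in> H2" and ng: "h2_norm g \<noteq> 0"
  shows "(h2_norm (f - cscale (h2_inner f g / of_real ((h2_norm g)\<^sup>2)) g))\<^sup>2
           = (h2_norm f)\<^sup>2 - (norm (h2_inner f g))\<^sup>2 / (h2_norm g)\<^sup>2"
proof -
  define N where "N = (h2_norm g)\<^sup>2"
  have N: "N > 0" using ng by (simp add: N_def)
  define c where "c = h2_inner f g / of_real N"
  have "(h2_norm (f - cscale c g))\<^sup>2 = (h2_norm f)\<^sup>2 + (norm c)\<^sup>2 * N - 2 * Re (cnj c * h2_inner f g)"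
    by (simp add: norm_diff_sq f g H2_cscale norm_cscale inner_cscale_right N_def power_mult_distrib)
  also have "cnj c * h2_inner f g = of_real ((norm (h2_inner f g))\<^sup>2 / N)"
    unfolding c_def complex_cnj_divide complex_cnj_complex_of_real
    by (metis (no_types, lifting) complex_norm_square mult.commute of_real_divide times_divide_eq_right)
  also have "(norm c)\<^sup>2 * N = (norm (h2_inner f g))\<^sup>2 / N"
    using N by (simp add: c_def norm_divide power_divide power2_eq_square)
  finally show ?thesis unfolding c_def N_def Re_complex_of_real by linarith
qed

lemma Cauchy_Schwarz:
  assumes f: "f \<in> H2" and g: "g \<in> H2"
  shows "norm (h2_inner f g) \<le> h2_norm f * h2_norm g"
proof (cases "h2_norm g = 0")
  case True
  then show ?thesis using g by (simp add: h2_norm_eq_0)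
next
  case False
  have "(norm (h2_inner f g))\<^sup>2 / (h2_norm g)\<^sup>2 \<le> (h2_norm f)\<^sup>2"
    using norm_diff_component[OF f g False] zero_le_power2 by (metis diff_ge_0_iff_ge)
  then have "(norm (h2_inner f g))\<^sup>2 \<le> (h2_norm f * h2_norm g)\<^sup>2"
    using False by (simp add: divide_le_eq power_mult_distrib)
  then show ?thesis by (rule power2_le_imp_le) simp
qed

lemma norm_triangle:
  assumes "f \<in> H2" "g \<in> H2"
  shows "h2_norm (f + g) \<le> h2_norm f + h2_norm g"
proof (rule power2_le_imp_le)
  have "Re (h2_inner f g) \<le> h2_norm f * h2_norm g"
    using Cauchy_Schwarz[OF assms] complex_Re_le_cmod order_trans by blast
  then show "(h2_norm (f + g))\<^sup>2 \<le> (h2_norm f + h2_norm g)\<^sup>2"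
    by (simp add: norm_add_sq assms power2_sum)
qed simp

lemma h2_norm_minus_commute: "f \<in> H2 \<Longrightarrow> g \<in> H2 \<Longrightarrow> h2_norm (f - g) = h2_norm (g - f)"
proof -
  assume "f \<in> H2" "g \<in> H2"
  then have "h2_norm (cscale (-1) (g - f)) = h2_norm (g - f)"
    by (subst norm_cscale) (auto intro: H2_diff)
  moreover have "cscale (-1) (g - f) = f - g" by (simp add: fun_eq_iff)
  ultimately show ?thesis by (simp only:)
qed

lemma norm_triangle_diff:
  assumes "f \<in> H2" "g \<in> H2" "h \<in> H2"
  shows "h2_norm (f - h) \<le> h2_norm (f - g) + h2_norm (g - h)"
  using norm_triangle[of "f - g" "g - h"] assms by (simp add: H2_diff)

lemma norm_diff_le: "f \<in> H2 \<Longrightarrow> g \<in> H2 \<Longrightarrow> \<bar>h2_norm f - h2_norm g\<bar> \<le> h2_norm (f - g)"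
  using norm_triangle[of g "f - g"] norm_triangle[of f "g - f"] h2_norm_minus_commute[of f g]
  by (simp add: H2_diff)

subsection \<open>Evaluation and the monomial basis\<close>

definition szego :: "complex \<times> complex \<Rightarrow> fun2" where
  "szego p = h2fun (\<lambda>k. cnj (mon k p))"

text \<open>The monomial, cut off outside the bidisk as elements of \<open>H2\<close> have to be.\<close>

definition emon :: "nat \<times> nat \<Rightarrow> fun2" where
  "emon k = (\<lambda>p. if p \<in> bidisk then mon k p else 0)"

lemma szego_in_H2: "p \<in> bidisk \<Longrightarrow> szego p \<in> H2"
  by (simp add: szego_def h2fun_in_H2 ell2_mon)

lemma inner_szego:
  assumes "f \<in> H2" "p \<in> bidisk"
  shows "h2_inner f (szego p) = f p"
  using H2_has_sum[OF assms] assms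
  by (simp add: h2_inner_def szego_def h2_coeffs_h2fun ell2_mon infsumI)

lemma norm_eval_le: "f \<in> H2 \<Longrightarrow> p \<in> bidisk \<Longrightarrow> norm (f p) \<le> h2_norm f * h2_norm (szego p)"
  using Cauchy_Schwarz[OF _ szego_in_H2, of f p] by (simp add: inner_szego)

lemma emon_has_h2_coeffs: "has_h2_coeffs (emon k) (\<lambda>l. if l = k then 1 else 0)"
proof -
  have "((\<lambda>l. (if l = k then 1 else 0) * mon l p) has_sum mon k p) UNIV" for p
    by (rule has_sum_finite_neutralI[of "{k}"]) auto
  moreover have "ell2 (\<lambda>l. if l = k then 1 else 0)"
    unfolding ell2_def
    by (rule finite_nonzero_values_imp_summable_on) (rule finite_subset[of _ "{k}"], auto)
  ultimately show ?thesis by (auto simp: has_h2_coeffs_iff emon_def)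
qed

lemma emon_in_H2 [simp]: "emon k \<in> H2"
  by (rule H2_I[OF emon_has_h2_coeffs])

lemma h2_coeffs_emon: "h2_coeffs (emon k) = (\<lambda>l. if l = k then 1 else 0)"
  by (rule h2_coeffs_eqI[OF emon_has_h2_coeffs])

lemma inner_emon_right: "h2_inner f (emon k) = h2_coeffs f k"
proof -
  have "((\<lambda>l. h2_coeffs f l * cnj (h2_coeffs (emon k) l)) has_sum h2_coeffs f k) UNIV"
    by (rule has_sum_finite_neutralI[of "{k}"]) (auto simp: h2_coeffs_emon)
  then show ?thesis by (simp add: h2_inner_def infsumI)
qed

lemma inner_emon_left: "h2_inner (emon k) f = cnj (h2_coeffs f k)"
  by (metis inner_emon_right inner_cnj)

lemma norm_emon [simp]: "h2_norm (emon k) = 1"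
proof -
  have "(h2_norm (emon k))\<^sup>2 = 1"
    by (simp add: norm_sq_eq_Re inner_emon_right h2_coeffs_emon)
  then show ?thesis by (simp add: power2_eq_1_iff) (metis h2_norm_nonneg not_one_le_zero neg_0_le_iff_le)
qed

subsection \<open>Density of polynomials, Riesz representation and completeness\<close>

text \<open>Square truncations turn the unordered double sums into limits of sequences.\<close>

definition box :: "nat \<Rightarrow> (nat \<times> nat) set" where
  "box n = {..<n} \<times> {..<n}"

lemma finite_box [simp]: "finite (box n)"
  by (simp add: box_def)

lemma box_mono: "m \<le> n \<Longrightarrow> box m \<subseteq> box n"
  by (auto simp: box_def)

lemma filterlim_box: "filterlim box (finite_subsets_at_top UNIV) sequentially"
  unfolding filterlim_iff eventually_finite_subsets_at_top
proof safe
  fix P :: "(nat \<times> nat) set \<Rightarrow> bool" and X :: "(nat \<times> nat) set"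
  assume X: "finite X" and P: "\<forall>Y. finite Y \<and> X \<subseteq> Y \<and> Y \<subseteq> UNIV \<longrightarrow> P Y"
  define N where "N = Suc (Max (insert 0 (fst ` X \<union> snd ` X)))"
  have "X \<subseteq> box N"
  proof
    fix k assume "k \<in> X"
    then have "fst k \<le> Max (insert 0 (fst ` X \<union> snd ` X))" "snd k \<le> Max (insert 0 (fst ` X \<union> snd ` X))"
      using X by (auto intro!: Max_ge)
    then show "k \<in> box N" by (cases k) (auto simp: box_def N_def)
  qed
  then have "P (box n)" if "n \<ge> N" for n using P box_mono[OF that] by (meson finite_box order_trans top_greatest)
  then show "\<forall>\<^sub>F n in sequentially. P (box n)" by (auto simp: eventually_sequentially)
qed

lemma has_sum_box: "(f has_sum s) UNIV \<Longrightarrow> (\<lambda>n. sum f (box n)) \<longlonglongrightarrow> s"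
  unfolding has_sum_def by (rule filterlim_compose[OF _ filterlim_box])

definition pol :: "(nat \<times> nat) set \<Rightarrow> (nat \<times> nat \<Rightarrow> complex) \<Rightarrow> fun2" where
  "pol K a = (\<Sum>k\<in>K. cscale (a k) (emon k))"

definition trunc :: "nat \<Rightarrow> fun2 \<Rightarrow> fun2" where
  "trunc n f = pol (box n) (h2_coeffs f)"

lemma pol_in_H2 [simp]: "pol K a \<in> H2"
  unfolding pol_def by (intro H2_sum H2_cscale emon_in_H2)

lemma trunc_in_H2 [simp]: "trunc n f \<in> H2"
  by (simp add: trunc_def)

lemma h2_coeffs_pol: "finite K \<Longrightarrow> h2_coeffs (pol K a) = (\<lambda>k. if k \<in> K then a k else 0)"
  unfolding pol_def
  by (rule ext, subst h2_coeffs_sum)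
    (simp_all add: H2_cscale h2_coeffs_cscale h2_coeffs_emon if_distrib[of "(*) _"] eq_commute[of _ "_ :: nat \<times> nat"]
      cong: if_cong)

lemma inner_pol: "f \<in> H2 \<Longrightarrow> finite K \<Longrightarrow> h2_inner f (pol K a) = (\<Sum>k\<in>K. h2_coeffs f k * cnj (a k))"
  unfolding pol_def
  by (subst inner_sum_right) (auto simp: H2_cscale inner_cscale_right inner_emon_right mult.commute)

lemma norm_pol: "finite K \<Longrightarrow> (h2_norm (pol K a))\<^sup>2 = (\<Sum>k\<in>K. (norm (a k))\<^sup>2)"
  by (simp add: norm_sq_eq_Re inner_pol h2_coeffs_pol complex_norm_square[symmetric]
      flip: of_real_power of_real_sum)

lemma norm_coeffs_sums:
  assumes "f \<in> H2"
  shows "((\<lambda>k. (norm (h2_coeffs f k))\<^sup>2) has_sum (h2_norm f)\<^sup>2) UNIV"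
  unfolding norm_sq_eq_infsum using ell2_h2_coeffs[OF assms] by (intro has_sum_infsum) (simp add: ell2_def)

lemma norm_diff_trunc:
  assumes "f \<in> H2"
  shows "(h2_norm (f - trunc n f))\<^sup>2 = (h2_norm f)\<^sup>2 - (\<Sum>k\<in>box n. (norm (h2_coeffs f k))\<^sup>2)"
proof -
  have "h2_inner f (trunc n f) = of_real (\<Sum>k\<in>box n. (norm (h2_coeffs f k))\<^sup>2)"
    using assms by (simp add: trunc_def inner_pol complex_norm_square[symmetric])
  then show ?thesis
    using assms by (simp add: norm_diff_sq norm_pol trunc_def)
qed

definition h2_lim :: "(nat \<Rightarrow> fun2) \<Rightarrow> fun2 \<Rightarrow> bool" where
  "h2_lim X g \<longleftrightarrow> (\<forall>n. X n \<in> H2) \<and> g \<in> H2 \<and> (\<lambda>n. h2_norm (X n - g)) \<longlonglongrightarrow> 0"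

lemma h2_limD:
  assumes "h2_lim X g"
  shows "X n \<in> H2" "g \<in> H2" "(\<lambda>n. h2_norm (X n - g)) \<longlonglongrightarrow> 0"
  using assms by (auto simp: h2_lim_def)

lemma trunc_lim: 
  assumes "f \<in> H2"
  shows "h2_lim (\<lambda>n. trunc n f) f"
proof -
  have "(\<lambda>n. (h2_norm f)\<^sup>2 - (\<Sum>k\<in>box n. (norm (h2_coeffs f k))\<^sup>2)) \<longlonglongrightarrow> (h2_norm f)\<^sup>2 - (h2_norm f)\<^sup>2"
    by (intro tendsto_intros has_sum_box norm_coeffs_sums assms)
  then have "(\<lambda>n. (h2_norm (f - trunc n f))\<^sup>2) \<longlonglongrightarrow> 0" using assms by (simp add: norm_diff_trunc)
  from tendsto_real_sqrt[OF this] have "(\<lambda>n. h2_norm (f - trunc n f)) \<longlonglongrightarrow> 0" by simp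
  then show ?thesis using assms by (simp add: h2_lim_def h2_norm_minus_commute)
qed

lemma h2_lim_inner:
  assumes "h2_lim X g" "f \<in> H2"
  shows "(\<lambda>n. h2_inner (X n) f) \<longlonglongrightarrow> h2_inner g f"
proof -
  have "(\<lambda>n. h2_inner (X n) f - h2_inner g f) \<longlonglongrightarrow> 0"
  proof (rule Lim_null_comparison)
    have "norm (h2_inner (X n) f - h2_inner g f) \<le> h2_norm (X n - g) * h2_norm f" for n
      using Cauchy_Schwarz[of "X n - g" f] h2_limD[OF assms(1)] assms(2)
      by (simp add: inner_diff_left H2_diff)
    then show "\<forall>\<^sub>F n in sequentially. norm (h2_inner (X n) f - h2_inner g f) \<le> h2_norm (X n - g) * h2_norm f"
      by simp
    show "(\<lambda>n. h2_norm (X n - g) * h2_norm f) \<longlonglongrightarrow> 0"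
      using h2_limD(3)[OF assms(1)] by (rule tendsto_mult_left_zero)
  qed
  then show ?thesis by (simp add: Lim_null[symmetric])
qed

lemma h2_lim_eval:
  assumes "h2_lim X g" "p \<in> bidisk"
  shows "(\<lambda>n. X n p) \<longlonglongrightarrow> g p"
  using h2_lim_inner[OF assms(1) szego_in_H2[OF assms(2)]] h2_limD[OF assms(1)] assms(2)
  by (simp add: inner_szego del: mem_Times_iff)

lemma h2_lim_norm:
  assumes "h2_lim X g"
  shows "(\<lambda>n. h2_norm (X n)) \<longlonglongrightarrow> h2_norm g"
proof -
  have "(\<lambda>n. h2_norm (X n) - h2_norm g) \<longlonglongrightarrow> 0"
    by (rule Lim_null_comparison[OF _ h2_limD(3)[OF assms]])
      (use norm_diff_le h2_limD[OF assms] in auto)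
  then show ?thesis by (simp add: Lim_null[symmetric])
qed

definition bounded_functional :: "(fun2 \<Rightarrow> complex) \<Rightarrow> bool" where
  "bounded_functional L \<longleftrightarrow> (\<forall>f\<in>H2. \<forall>g\<in>H2. L (f + g) = L f + L g) \<and>
     (\<forall>c. \<forall>f\<in>H2. L (cscale c f) = c * L f) \<and> (\<exists>C. \<forall>f\<in>H2. norm (L f) \<le> C * h2_norm f)"

lemma bounded_functional_lim:
  assumes L: "bounded_functional L" and X: "h2_lim X g"
  shows "(\<lambda>n. L (X n)) \<longlonglongrightarrow> L g"
proof -
  obtain C where C: "\<And>f. f \<in> H2 \<Longrightarrow> norm (L f) \<le> C * h2_norm f"
    using L unfolding bounded_functional_def by blast
  have "L (X n) = L (X n - g) + L g" for n
    using L h2_limD[OF X] by (metis H2_diff bounded_functional_def diff_add_cancel)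
  moreover have "(\<lambda>n. L (X n - g)) \<longlonglongrightarrow> 0"
  proof (rule Lim_null_comparison)
    show "\<forall>\<^sub>F n in sequentially. norm (L (X n - g)) \<le> C * h2_norm (X n - g)"
      using C h2_limD[OF X] by (auto simp: H2_diff)
    show "(\<lambda>n. C * h2_norm (X n - g)) \<longlonglongrightarrow> 0"
      using h2_limD(3)[OF X] by (rule tendsto_mult_right_zero)
  qed
  ultimately show ?thesis using tendsto_add[of "\<lambda>n. L (X n - g)" 0 sequentially "\<lambda>_. L g" "L g"] by simp
qed

lemma bounded_functional_sum:
  assumes "bounded_functional L" "\<And>i. i \<in> A \<Longrightarrow> F i \<in> H2"
  shows "L (sum F A) = (\<Sum>i\<in>A. L (F i))"
proof -
  have "L 0 = 0"
    using assms(1) H2_0 cfun.scale_zero_left mult_zero_left unfolding bounded_functional_def by metis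
  then show ?thesis using assms(2)
    by (induction A rule: infinite_finite_induct)
      (use assms(1) in \<open>auto simp: bounded_functional_def H2_sum\<close>)
qed

lemma bounded_functional_pol:
  "bounded_functional L \<Longrightarrow> L (pol K a) = (\<Sum>k\<in>K. a k * L (emon k))"
  unfolding pol_def
  by (subst bounded_functional_sum) (auto simp: H2_cscale bounded_functional_def)

lemma bounded_functional_inner:
  assumes "g \<in> H2"
  shows "bounded_functional (\<lambda>f. h2_inner f g)"
  unfolding bounded_functional_def using assms Cauchy_Schwarz[OF _ assms]
  by (auto simp: inner_add_left inner_cscale_left mult.commute intro!: exI[of _ "h2_norm g"])

text \<open>Polynomials are dense.\<close>

lemma bounded_functional_eqI:
  assumes "bounded_functional L" "bounded_functional L'" "\<And>k. L (emon k) = L' (emon k)" "f \<in> H2"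
  shows "L f = L' f"
proof (rule LIMSEQ_unique)
  show "(\<lambda>n. L (trunc n f)) \<longlonglongrightarrow> L f" by (rule bounded_functional_lim[OF assms(1) trunc_lim[OF assms(4)]])
  have "(\<lambda>n. L' (trunc n f)) \<longlonglongrightarrow> L' f" by (rule bounded_functional_lim[OF assms(2) trunc_lim[OF assms(4)]])
  then show "(\<lambda>n. L (trunc n f)) \<longlonglongrightarrow> L' f"
    by (simp add: trunc_def bounded_functional_pol assms)
qed

text \<open>The representing vector has the coefficients \<open>cnj (L e\<^sub>k)\<close>. They are square-summable because
  applying \<open>L\<close> to the polynomial with these coefficients gives its squared norm \<open>s\<close>, whence
  \<open>s \<le> C \<surd>s\<close>.\<close>

lemma Riesz:
  assumes L: "bounded_functional L"
  shows "\<exists>g\<in>H2. \<forall>f\<in>H2. L f = h2_inner f g"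
proof -
  obtain C where C: "\<And>f. f \<in> H2 \<Longrightarrow> norm (L f) \<le> C * h2_norm f"
    using L unfolding bounded_functional_def by blast
  define a where "a = (\<lambda>k. cnj (L (emon k)))"
  have bound: "(\<Sum>k\<in>K. (norm (a k))\<^sup>2) \<le> C\<^sup>2" if K: "finite K" for K
  proof -
    define s where "s = (\<Sum>k\<in>K. (norm (a k))\<^sup>2)"
    have "L (pol K a) = of_real s"
      unfolding bounded_functional_pol[OF L] s_def of_real_sum
      unfolding complex_norm_square by (simp add: a_def mult.commute)
    moreover have s: "(h2_norm (pol K a))\<^sup>2 = s" using K by (simp add: norm_pol s_def)
    ultimately have "s \<le> C * h2_norm (pol K a)" using C[of "pol K a"]
      by (metis abs_ge_self norm_of_real order_trans pol_in_H2)
    then have "h2_norm (pol K a) \<le> C \<or> h2_norm (pol K a) = 0"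
      unfolding s[symmetric] power2_eq_square using h2_norm_nonneg[of "pol K a"]
      by (auto simp: mult_le_cancel_right less_le)
    then have "(h2_norm (pol K a))\<^sup>2 \<le> C\<^sup>2"
      by (auto intro: power_mono)
    then show ?thesis by (simp add: s s_def[symmetric])
  qed
  have a: "ell2 a"
    unfolding ell2_def
    by (rule nonneg_bdd_above_summable_on) (auto intro!: bdd_aboveI2[where M = "C\<^sup>2"] bound)
  show ?thesis
  proof (intro bexI ballI)
    fix f assume f: "f \<in> H2"
    have "L (emon k) = h2_inner (emon k) (h2fun a)" for k
      unfolding inner_emon_left h2_coeffs_h2fun[OF a] by (simp add: a_def)
    from bounded_functional_eqI[OF L bounded_functional_inner[OF h2fun_in_H2[OF a]] this f]
    show "L f = h2_inner f (h2fun a)" .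
  qed (rule h2fun_in_H2[OF a])
qed

text \<open>The inner products with a Cauchy sequence converge to a bounded functional; its Riesz vector is
  the limit of the sequence.\<close>

lemma H2_complete:
  assumes X: "\<And>n. X n \<in> H2"
    and cau: "\<And>e. e > 0 \<Longrightarrow> \<exists>N. \<forall>m\<ge>N. \<forall>n\<ge>N. h2_norm (X m - X n) < e"
  obtains g where "h2_lim X g"
proof -
  have conv: "convergent (\<lambda>n. h2_inner f (X n))" if f: "f \<in> H2" for f
  proof (rule Cauchy_convergent, rule metric_CauchyI)
    fix e :: real assume e: "e > 0"
    have "e / (h2_norm f + 1) > 0" using e by (simp add: add_nonneg_pos)
    then obtain N where N: "\<forall>m\<ge>N. \<forall>n\<ge>N. h2_norm (X m - X n) < e / (h2_norm f + 1)" using cau by blast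
    have "dist (h2_inner f (X m)) (h2_inner f (X n)) < e" if "m \<ge> N" "n \<ge> N" for m n
    proof -
      have "dist (h2_inner f (X m)) (h2_inner f (X n)) \<le> h2_norm f * h2_norm (X m - X n)"
        using Cauchy_Schwarz[of f "X m - X n"] f X by (simp add: dist_norm inner_diff_right H2_diff)
      also have "\<dots> \<le> (h2_norm f + 1) * h2_norm (X m - X n)" by (simp add: distrib_right)
      also have "\<dots> < (h2_norm f + 1) * (e / (h2_norm f + 1))"
        using N that by (intro mult_strict_left_mono) (auto simp: add_nonneg_pos)
      also have "\<dots> = e" using h2_norm_nonneg[of f] by (simp add: add_nonneg_eq_0_iff)
      finally show ?thesis .
    qed
    then show "\<exists>M. \<forall>m\<ge>M. \<forall>n\<ge>M. dist (h2_inner f (X m)) (h2_inner f (X n)) < e" by blast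
  qed
  define L where "L = (\<lambda>f. lim (\<lambda>n. h2_inner f (X n)))"
  have L: "(\<lambda>n. h2_inner f (X n)) \<longlonglongrightarrow> L f" if "f \<in> H2" for f
    using conv[OF that] by (simp add: L_def convergent_LIMSEQ_iff)
  obtain N1 where N1: "\<forall>m\<ge>N1. \<forall>n\<ge>N1. h2_norm (X m - X n) < 1" using cau[of 1] by auto
  have "bounded_functional L"
    unfolding bounded_functional_def
  proof (intro conjI ballI allI)
    fix f g assume fg: "f \<in> H2" "g \<in> H2"
    have "(\<lambda>n. h2_inner (f + g) (X n)) \<longlonglongrightarrow> L f + L g"
      using tendsto_add[OF L L] fg X by (simp add: inner_add_left)
    then show "L (f + g) = L f + L g" using L[OF H2_add[OF fg]] LIMSEQ_unique by blast
  next
    fix c f assume f: "f \<in> H2"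
    have "(\<lambda>n. h2_inner (cscale c f) (X n)) \<longlonglongrightarrow> c * L f"
      using tendsto_mult_left[OF L[OF f]] f X by (simp add: inner_cscale_left)
    then show "L (cscale c f) = c * L f" using L[OF H2_cscale[OF f]] LIMSEQ_unique by blast
  next
    show "\<exists>C. \<forall>f\<in>H2. cmod (L f) \<le> C * h2_norm f"
    proof (intro exI ballI)
      fix f assume f: "f \<in> H2"
      show "cmod (L f) \<le> (h2_norm (X N1) + 1) * h2_norm f"
      proof (rule LIMSEQ_le_const2[OF tendsto_norm[OF L[OF f]]], intro exI allI impI)
        fix n assume "n \<ge> N1"
        then have "h2_norm (X n - X N1) < 1" using N1 by blast
        then have "h2_norm (X n) \<le> h2_norm (X N1) + 1"
          using norm_diff_le[OF X X, of n N1] by linarith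
        then have "h2_norm f * h2_norm (X n) \<le> h2_norm f * (h2_norm (X N1) + 1)"
          by (rule mult_left_mono) simp
        then show "cmod (h2_inner f (X n)) \<le> (h2_norm (X N1) + 1) * h2_norm f"
          using Cauchy_Schwarz[OF f X[of n]] by (simp add: mult.commute)
      qed
    qed
  qed
  from Riesz[OF this] obtain g where g: "g \<in> H2" "\<And>f. f \<in> H2 \<Longrightarrow> L f = h2_inner f g" by blast
  have "(\<lambda>n. h2_norm (X n - g)) \<longlonglongrightarrow> 0"
  proof (rule LIMSEQ_I)
    fix e :: real assume e: "e > 0"
    then obtain N where N: "\<forall>m\<ge>N. \<forall>n\<ge>N. h2_norm (X m - X n) < e / 2" using cau[of "e / 2"] by auto
    have "h2_norm (X n - g) \<le> e / 2" if n: "n \<ge> N" for n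
    proof -
      let ?f = "X n - g"
      have f: "?f \<in> H2" using X g by (simp add: H2_diff)
      have "(\<lambda>m. norm (h2_inner ?f (X n - X m))) \<longlonglongrightarrow> norm (h2_inner ?f (X n - g))"
      proof (rule tendsto_norm)
        have "(\<lambda>m. h2_inner ?f (X n) - h2_inner ?f (X m)) \<longlonglongrightarrow> h2_inner ?f (X n) - L ?f"
          by (intro tendsto_intros L f)
        then show "(\<lambda>m. h2_inner ?f (X n - X m)) \<longlonglongrightarrow> h2_inner ?f (X n - g)"
          using g f X by (simp only: inner_diff_right)
      qed
      then have "norm (h2_inner ?f (X n - g)) \<le> h2_norm ?f * (e / 2)"
      proof (rule LIMSEQ_le_const2, intro exI allI impI)
        fix m assume "m \<ge> N"
        then have "h2_norm (X n - X m) \<le> e / 2" using N n by (auto intro: less_imp_le)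
        then show "norm (h2_inner ?f (X n - X m)) \<le> h2_norm ?f * (e / 2)"
          using Cauchy_Schwarz[OF f H2_diff[OF X[of n] X[of m]]] mult_left_mono[OF _ h2_norm_nonneg[of ?f]]
          by fastforce
      qed
      then have "h2_norm ?f * h2_norm ?f \<le> h2_norm ?f * (e / 2)"
        using f by (simp add: norm_sq_eq_inner power2_eq_square norm_mult)
      then show ?thesis using e h2_norm_nonneg[of ?f]
        by (cases "h2_norm ?f = 0") (simp_all add: mult_le_cancel_left_pos order_less_le)
    qed
    then show "\<exists>no. \<forall>n\<ge>no. norm (h2_norm (X n - g) - 0) < e" using e by (force intro!: exI[of _ N])
  qed
  then show ?thesis using that g(1) X by (auto simp: h2_lim_def)
qed

subsection \<open>Closed subspaces and orthogonal projections\<close>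

definition closed_subspace :: "fun2 set \<Rightarrow> bool" where
  "closed_subspace V \<longleftrightarrow> V \<subseteq> H2 \<and> cfun.subspace V \<and> h2_closure V \<subseteq> V"

lemma closed_subspaceD:
  assumes "closed_subspace V"
  shows "f \<in> V \<Longrightarrow> f \<in> H2" "0 \<in> V" "f \<in> V \<Longrightarrow> g \<in> V \<Longrightarrow> f + g \<in> V" "f \<in> V \<Longrightarrow> g \<in> V \<Longrightarrow> f - g \<in> V"
    "f \<in> V \<Longrightarrow> cscale c f \<in> V"
proof -
  have V: "V \<subseteq> H2" "cfun.subspace V" using assms by (auto simp: closed_subspace_def)
  show "f \<in> V \<Longrightarrow> f \<in> H2" using V(1) by blast
  show "0 \<in> V" by (rule cfun.subspace_0[OF V(2)])
  show "f \<in> V \<Longrightarrow> g \<in> V \<Longrightarrow> f + g \<in> V" by (rule cfun.subspace_add[OF V(2)])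
  show "f \<in> V \<Longrightarrow> g \<in> V \<Longrightarrow> f - g \<in> V" by (rule cfun.subspace_diff[OF V(2)])
  show "f \<in> V \<Longrightarrow> cscale c f \<in> V" by (rule cfun.subspace_scale[OF V(2)])
qed

lemma closed_subspace_H2 [simp]: "closed_subspace H2"
  by (auto simp: closed_subspace_def H2_subspace h2_closure_def)

lemma closed_subspace_lim:
  assumes V: "closed_subspace V" and X: "h2_lim X g" "\<And>n. X n \<in> V"
  shows "g \<in> V"
proof -
  have "\<exists>f\<in>V. h2_norm (f - g) < e" if "e > 0" for e
  proof -
    have "\<forall>\<^sub>F n in sequentially. h2_norm (X n - g) < e"
      using order_tendstoD(2)[OF h2_limD(3)[OF X(1)] that] .
    then show ?thesis using X(2) by (auto simp: eventually_sequentially)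
  qed
  then have "g \<in> h2_closure V" using h2_limD(2)[OF X(1)] by (auto simp: h2_closure_def)
  then show ?thesis using V by (auto simp: closed_subspace_def)
qed

lemma h2_closure_lim:
  assumes "g \<in> h2_closure X" "X \<subseteq> H2"
  obtains S where "\<And>n. S n \<in> X" "h2_lim S g"
proof -
  have "\<exists>f\<in>X. h2_norm (f - g) < 1 / real (Suc n)" for n
    using assms by (auto simp: h2_closure_def)
  then obtain S where S: "\<And>n. S n \<in> X" "\<And>n. h2_norm (S n - g) < 1 / real (Suc n)" by metis
  have "(\<lambda>n. h2_norm (S n - g)) \<longlonglongrightarrow> 0"
    by (rule tendsto_sandwich[OF _ _ tendsto_const LIMSEQ_Suc[OF lim_1_over_n]])
      (auto intro!: always_eventually less_imp_le S(2) simp del: of_nat_Suc)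
  then show ?thesis using that[of S] S assms by (auto simp: h2_lim_def h2_closure_def)
qed

lemma h2_closure_subset: "X \<subseteq> H2 \<Longrightarrow> X \<subseteq> h2_closure X"
  by (force simp: h2_closure_def)

lemma h2_closure_minimal:
  assumes "X \<subseteq> V" "closed_subspace V"
  shows "h2_closure X \<subseteq> V"
  using assms unfolding closed_subspace_def h2_closure_def by blast

lemma span_subset_H2: "X \<subseteq> H2 \<Longrightarrow> cfun.span X \<subseteq> H2"
  by (rule cfun.span_minimal[OF _ H2_subspace])

lemma h2_closure_idem:
  assumes "X \<subseteq> H2"
  shows "h2_closure (h2_closure X) \<subseteq> h2_closure X"
proof
  fix g assume g: "g \<in> h2_closure (h2_closure X)"
  have "\<exists>f\<in>X. h2_norm (f - g) < e" if "e > 0" for e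
  proof -
    have e2: "e / 2 > 0" using that by simp
    then obtain h where h: "h \<in> h2_closure X" "h2_norm (h - g) < e / 2"
      using g unfolding h2_closure_def[of "h2_closure X"] by blast
    then obtain f where f: "f \<in> X" "h2_norm (f - h) < e / 2"
      using e2 unfolding h2_closure_def by blast
    have "h2_norm (f - g) \<le> h2_norm (f - h) + h2_norm (h - g)"
      using f h g assms by (intro norm_triangle_diff) (auto simp: h2_closure_def)
    then show ?thesis using f h by force
  qed
  then show "g \<in> h2_closure X" using g by (auto simp: h2_closure_def)
qed

lemma h2_lim_add:
  assumes "h2_lim X f" "h2_lim Y g"
  shows "h2_lim (\<lambda>n. X n + Y n) (f + g)"
proof -
  note X = h2_limD[OF assms(1)] and Y = h2_limD[OF assms(2)]
  have "(\<lambda>n. h2_norm ((X n + Y n) - (f + g))) \<longlonglongrightarrow> 0"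
  proof (rule tendsto_sandwich[OF _ _ tendsto_const])
    show "\<forall>\<^sub>F n in sequentially. h2_norm ((X n + Y n) - (f + g)) \<le> h2_norm (X n - f) + h2_norm (Y n - g)"
    proof (rule always_eventually, rule allI)
      fix n
      have "(X n + Y n) - (f + g) = (X n - f) + (Y n - g)" by (simp add: fun_eq_iff)
      then show "h2_norm ((X n + Y n) - (f + g)) \<le> h2_norm (X n - f) + h2_norm (Y n - g)"
        using norm_triangle[of "X n - f" "Y n - g"] X Y by (simp only: H2_diff)
    qed
    show "(\<lambda>n. h2_norm (X n - f) + h2_norm (Y n - g)) \<longlonglongrightarrow> 0"
      using tendsto_add[OF X(3) Y(3)] by simp
  qed simp
  then show ?thesis using X Y by (auto simp: h2_lim_def H2_add)
qed

lemma h2_lim_cscale: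
  assumes "h2_lim X f"
  shows "h2_lim (\<lambda>n. cscale c (X n)) (cscale c f)"
proof -
  note X = h2_limD[OF assms(1)]
  have "h2_norm (cscale c (X n) - cscale c f) = norm c * h2_norm (X n - f)" for n
    using norm_cscale[of "X n - f" c] X by (simp add: H2_diff cfun.scale_right_diff_distrib)
  then show ?thesis using X tendsto_mult_right_zero[OF X(3), of "norm c"] by (simp add: h2_lim_def H2_cscale)
qed

lemma h2_lim_const: "f \<in> H2 \<Longrightarrow> h2_lim (\<lambda>_. f) f"
  by (simp add: h2_lim_def)

lemma h2_lim_in_closure:
  assumes "h2_lim S g" "\<And>n. S n \<in> X"
  shows "g \<in> h2_closure X"
proof -
  have "\<exists>f\<in>X. h2_norm (f - g) < e" if "e > 0" for e
    using order_tendstoD(2)[OF h2_limD(3)[OF assms(1)] that] assms(2) 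
    by (auto simp: eventually_sequentially)
  then show ?thesis using h2_limD[OF assms(1)] by (auto simp: h2_closure_def)
qed

lemma closed_subspace_closure_span:
  assumes X: "X \<subseteq> H2"
  shows "closed_subspace (h2_closure (cfun.span X))"
  unfolding closed_subspace_def
proof (intro conjI)
  note S = span_subset_H2[OF X]
  show "h2_closure (cfun.span X) \<subseteq> H2" by (auto simp: h2_closure_def)
  show "h2_closure (h2_closure (cfun.span X)) \<subseteq> h2_closure (cfun.span X)"
    by (rule h2_closure_idem[OF S])
  show "cfun.subspace (h2_closure (cfun.span X))"
  proof (rule cfun.subspaceI)
    show "0 \<in> h2_closure (cfun.span X)" using h2_closure_subset[OF S] cfun.span_zero by blast
  next
    fix f g assume "f \<in> h2_closure (cfun.span X)" "g \<in> h2_closure (cfun.span X)"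
    then obtain F G where F: "\<And>n. F n \<in> cfun.span X" "h2_lim F f" 
      and G: "\<And>n. G n \<in> cfun.span X" "h2_lim G g"
      using h2_closure_lim S by metis
    show "f + g \<in> h2_closure (cfun.span X)"
      by (rule h2_lim_in_closure[OF h2_lim_add[OF F(2) G(2)]]) (intro cfun.span_add F G)
  next
    fix c f assume "f \<in> h2_closure (cfun.span X)"
    then obtain F where F: "\<And>n. F n \<in> cfun.span X" "h2_lim F f" 
      using h2_closure_lim S by metis
    show "cscale c f \<in> h2_closure (cfun.span X)"
      by (rule h2_lim_in_closure[OF h2_lim_cscale[OF F(2)]]) (intro cfun.span_scale F)
  qed
qed

lemma closure_span_minimal:
  assumes "X \<subseteq> V" "closed_subspace V"
  shows "h2_closure (cfun.span X) \<subseteq> V"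
  using assms cfun.span_minimal[of X V] by (intro h2_closure_minimal) (auto simp: closed_subspace_def)

text \<open>The vector of \<open>V\<close> closest to \<open>f\<close>, as the limit of a minimising sequence.\<close>

lemma projection_exists:
  assumes V: "closed_subspace V" and f: "f \<in> H2"
  shows "\<exists>g\<in>V. \<forall>h\<in>V. h2_inner (f - g) h = 0"
proof -
  note VD = closed_subspaceD[OF V]
  define D where "D = Inf ((\<lambda>h. (h2_norm (f - h))\<^sup>2) ` V)"
  have bdd: "bdd_below ((\<lambda>h. (h2_norm (f - h))\<^sup>2) ` V)" by (rule bdd_belowI2[of _ 0]) simp
  have D: "D \<le> (h2_norm (f - h))\<^sup>2" if "h \<in> V" for h
    unfolding D_def using that by (intro cInf_lower bdd) auto
  have "\<exists>h\<in>V. (h2_norm (f - h))\<^sup>2 < D + 1 / real (Suc n)" for n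
  proof -
    have "Inf ((\<lambda>h. (h2_norm (f - h))\<^sup>2) ` V) < D + 1 / real (Suc n)" by (simp add: D_def)
    then show ?thesis using VD(2) bdd by (subst (asm) cInf_less_iff) auto
  qed
  then obtain X where X: "\<And>n. X n \<in> V" "\<And>n. (h2_norm (f - X n))\<^sup>2 < D + 1 / real (Suc n)" by metis
  have XH: "X n \<in> H2" for n by (rule VD(1)[OF X(1)])
  \<comment> \<open>by the parallelogram law, since the midpoint of \<open>X m\<close> and \<open>X n\<close> has squared distance at least
    \<open>D\<close> from \<open>f\<close>\<close>
  have close: "(h2_norm (X m - X n))\<^sup>2 \<le> 2 / real (Suc m) + 2 / real (Suc n)" for m n
  proof -
    define u v where "u = f - X m" and "v = f - X n"
    have uv: "u \<in> H2" "v \<in> H2" using f XH by (auto simp: u_def v_def H2_diff)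
    have "cscale (1/2) (X m + X n) \<in> V" by (intro VD X)
    then have "D \<le> (h2_norm (f - cscale (1/2) (X m + X n)))\<^sup>2" by (rule D)
    moreover have "f - cscale (1/2) (X m + X n) = cscale (1/2) (u + v)"
      by (simp add: fun_eq_iff u_def v_def field_simps)
    ultimately have "4 * D \<le> (h2_norm (u + v))\<^sup>2"
      using uv by (simp add: norm_cscale H2_add power_mult_distrib power2_eq_square)
    moreover have "(h2_norm (u - v))\<^sup>2 + (h2_norm (u + v))\<^sup>2 = 2 * (h2_norm u)\<^sup>2 + 2 * (h2_norm v)\<^sup>2"
      using uv by (simp add: norm_add_sq norm_diff_sq)
    moreover have "h2_norm (X m - X n) = h2_norm (u - v)"
      using h2_norm_minus_commute[OF XH XH, of m n] by (simp add: u_def v_def)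
    ultimately show ?thesis using X(2)[of m] X(2)[of n] by (simp add: u_def v_def)
  qed
  obtain g where g: "h2_lim X g"
  proof (rule H2_complete[OF XH])
    fix e :: real assume e: "e > 0"
    obtain N where N: "inverse (real (Suc N)) < e\<^sup>2 / 4" using reals_Archimedean[of "e\<^sup>2 / 4"] e by auto
    have "h2_norm (X m - X n) < e" if "m \<ge> N" "n \<ge> N" for m n
    proof (rule power2_less_imp_less)
      have "1 / real (Suc m) \<le> 1 / real (Suc N)" "1 / real (Suc n) \<le> 1 / real (Suc N)"
        using that by (auto intro!: divide_left_mono)
      then show "(h2_norm (X m - X n))\<^sup>2 < e\<^sup>2" using close[of m n] N by (simp add: inverse_eq_divide)
    qed (use e in simp)
    then show "\<exists>N. \<forall>m\<ge>N. \<forall>n\<ge>N. h2_norm (X m - X n) < e" by blast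
  qed
  have gV: "g \<in> V" by (rule closed_subspace_lim[OF V g X(1)])
  have gH: "g \<in> H2" by (rule VD(1)[OF gV])
  have "h2_lim (\<lambda>n. f + cscale (-1) (X n)) (f + cscale (-1) g)"
    by (intro h2_lim_add h2_lim_cscale h2_lim_const g f)
  from h2_lim_norm[OF this]
  have "(\<lambda>n. (h2_norm (f - X n))\<^sup>2) \<longlonglongrightarrow> (h2_norm (f - g))\<^sup>2"
    unfolding diff_eq_add_cscale[symmetric] by (intro tendsto_intros)
  moreover have "(\<lambda>n. D + 1 / real (Suc n)) \<longlonglongrightarrow> D + 0"
    by (intro tendsto_intros LIMSEQ_Suc[OF lim_1_over_n])
  ultimately have gD: "(h2_norm (f - g))\<^sup>2 \<le> D"
    using X(2) by (intro LIMSEQ_le[of "\<lambda>n. (h2_norm (f - X n))\<^sup>2" _ "\<lambda>n. D + 1 / real (Suc n)"])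
      (auto intro: less_imp_le)
  show ?thesis
  proof (rule bexI[OF _ gV], rule ballI)
    fix h assume h: "h \<in> V"
    then have hH: "h \<in> H2" by (rule VD(1))
    show "h2_inner (f - g) h = 0"
    proof (cases "h2_norm h = 0")
      case True
      then show ?thesis using hH by (simp add: h2_norm_eq_0)
    next
      case False
      \<comment> \<open>moving \<open>g\<close> by the component of \<open>f - g\<close> along \<open>h\<close> cannot decrease the distance\<close>
      define c where "c = h2_inner (f - g) h / of_real ((h2_norm h)\<^sup>2)"
      have "f - g - cscale c h = f - (g + cscale c h)" by (simp add: fun_eq_iff)
      moreover have "g + cscale c h \<in> V" by (intro VD gV h)
      ultimately have "D \<le> (h2_norm (f - g - cscale c h))\<^sup>2" using D by metis
      also have "\<dots> = (h2_norm (f - g))\<^sup>2 - (norm (h2_inner (f - g) h))\<^sup>2 / (h2_norm h)\<^sup>2"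
        unfolding c_def using f gH hH False by (intro norm_diff_component H2_diff)
      finally have "(norm (h2_inner (f - g) h))\<^sup>2 / (h2_norm h)\<^sup>2 \<le> 0" using gD by simp
      moreover have "(h2_norm h)\<^sup>2 > 0" using False by simp
      ultimately have "(norm (h2_inner (f - g) h))\<^sup>2 \<le> 0" by (simp add: divide_le_0_iff)
      then show ?thesis by simp
    qed
  qed
qed

definition proj :: "fun2 set \<Rightarrow> fun2 \<Rightarrow> fun2" where
  "proj V f = (SOME g. g \<in> V \<and> (\<forall>h\<in>V. h2_inner (f - g) h = 0))"

lemma proj:
  assumes "closed_subspace V" "f \<in> H2"
  shows proj_in: "proj V f \<in> V" and inner_proj: "h \<in> V \<Longrightarrow> h2_inner (proj V f) h = h2_inner f h"
proof -
  have *: "proj V f \<in> V \<and> (\<forall>h\<in>V. h2_inner (f - proj V f) h = 0)"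
  proof -
    obtain g where "g \<in> V \<and> (\<forall>h\<in>V. h2_inner (f - g) h = 0)" using projection_exists[OF assms] by blast
    then show ?thesis unfolding proj_def
      by (rule someI[of "\<lambda>g. g \<in> V \<and> (\<forall>h\<in>V. h2_inner (f - g) h = 0)"])
  qed
  then show "proj V f \<in> V" by blast
  assume "h \<in> V"
  then have "h2_inner (f - proj V f) h = 0" using * by blast
  then show "h2_inner (proj V f) h = h2_inner f h"
    using assms * closed_subspaceD(1)[OF assms(1)] \<open>h \<in> V\<close> by (simp add: inner_diff_left)
qed

lemma inner_proj_right:
  "closed_subspace V \<Longrightarrow> f \<in> H2 \<Longrightarrow> h \<in> V \<Longrightarrow> h2_inner h (proj V f) = h2_inner h f"
  by (metis inner_proj inner_cnj)

lemma norm_proj_le: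
  assumes V: "closed_subspace V" and f: "f \<in> H2"
  shows "h2_norm (proj V f) \<le> h2_norm f"
proof -
  let ?g = "proj V f"
  have g: "?g \<in> V" "?g \<in> H2" using proj_in[OF V f] closed_subspaceD(1)[OF V] by auto
  have "h2_norm ?g * h2_norm ?g = norm (h2_inner f ?g)"
    using inner_proj[OF V f g(1)] norm_sq_eq_inner[OF g(2)] by (metis norm_of_real abs_of_nonneg power2_eq_square zero_le_power2)
  also have "\<dots> \<le> h2_norm f * h2_norm ?g" by (rule Cauchy_Schwarz[OF f g(2)])
  finally show ?thesis
    by (metis h2_norm_nonneg less_eq_real_def mult_right_le_imp_le)
qed

lemma eq_of_inner_eq:
  assumes "closed_subspace V" "f \<in> V" "g \<in> V" "\<And>h. h \<in> V \<Longrightarrow> h2_inner f h = h2_inner g h"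
  shows "f = g"
proof -
  have fg: "f - g \<in> V" "f \<in> H2" "g \<in> H2" by (simp_all add: closed_subspaceD[OF assms(1)] assms(2,3))
  have "h2_inner (f - g) (f - g) = 0" using assms(4)[OF fg(1)] fg by (simp add: inner_diff_left H2_diff)
  then have "f - g = 0" using fg by (simp add: norm_sq_eq_inner H2_diff h2_norm_eq_0)
  then show ?thesis by simp
qed

lemma proj_eq_self: "closed_subspace V \<Longrightarrow> f \<in> V \<Longrightarrow> proj V f = f"
  by (rule eq_of_inner_eq[of V]) (auto simp: proj_in inner_proj closed_subspaceD)

lemma proj_eqI:
  "closed_subspace V \<Longrightarrow> f \<in> H2 \<Longrightarrow> g \<in> V \<Longrightarrow> (\<And>h. h \<in> V \<Longrightarrow> h2_inner g h = h2_inner f h) \<Longrightarrow> proj V f = g"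
  by (rule eq_of_inner_eq[of V]) (auto simp: proj_in inner_proj)

subsection \<open>Bounded operators and adjoints\<close>

definition bounded_op :: "fun2 set \<Rightarrow> (fun2 \<Rightarrow> fun2) \<Rightarrow> bool" where
  "bounded_op V A \<longleftrightarrow> (\<forall>f\<in>V. A f \<in> V) \<and> (\<forall>f\<in>V. \<forall>g\<in>V. A (f + g) = A f + A g) \<and>
     (\<forall>c. \<forall>f\<in>V. A (cscale c f) = cscale c (A f)) \<and> (\<exists>C. \<forall>f\<in>V. h2_norm (A f) \<le> C * h2_norm f)"

text \<open>Riesz representation of the functional \<open>h \<mapsto> \<langle>A P h, f\<rangle>\<close>, where the projection \<open>P\<close> to \<open>V\<close>
  extends it to the whole space.\<close>

lemma adj_props:
  assumes V: "closed_subspace V" and A: "bounded_op V A" and f: "f \<in> V"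
  shows adj_in: "adj V A f \<in> V" and inner_adj: "h \<in> V \<Longrightarrow> h2_inner (A h) f = h2_inner h (adj V A f)"
proof -
  note VD = closed_subspaceD[OF V]
  have PV: "proj V h \<in> V" if "h \<in> H2" for h using proj_in[OF V that] .
  obtain C where C: "\<And>f. f \<in> V \<Longrightarrow> h2_norm (A f) \<le> C * h2_norm f"
    using A unfolding bounded_op_def by blast
  have AV: "A h \<in> V" if "h \<in> V" for h using A that by (auto simp: bounded_op_def)
  have "bounded_functional (\<lambda>h. h2_inner (A (proj V h)) f)"
    unfolding bounded_functional_def
  proof (intro conjI ballI allI)
    fix g h assume gh: "g \<in> H2" "h \<in> H2"
    have "proj V (g + h) = proj V g + proj V h"
      using gh by (intro proj_eqI V) (auto simp: H2_add VD PV inner_add_left inner_proj[OF V])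
    then show "h2_inner (A (proj V (g + h))) f = h2_inner (A (proj V g)) f + h2_inner (A (proj V h)) f"
      using gh A f PV AV VD by (simp add: bounded_op_def inner_add_left)
  next
    fix c h assume h: "h \<in> H2"
    have "proj V (cscale c h) = cscale c (proj V h)"
      using h by (intro proj_eqI V) (auto simp: H2_cscale VD PV inner_cscale_left inner_proj[OF V])
    then show "h2_inner (A (proj V (cscale c h))) f = c * h2_inner (A (proj V h)) f"
      using h A f PV AV VD by (simp add: bounded_op_def inner_cscale_left)
  next
    show "\<exists>C. \<forall>h\<in>H2. cmod (h2_inner (A (proj V h)) f) \<le> C * h2_norm h"
    proof (intro exI ballI)
      fix h assume h: "h \<in> H2"
      have "cmod (h2_inner (A (proj V h)) f) \<le> h2_norm (A (proj V h)) * h2_norm f"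
        using h f PV AV VD by (intro Cauchy_Schwarz) auto
      also have "\<dots> \<le> (\<bar>C\<bar> * h2_norm h) * h2_norm f"
      proof (rule mult_right_mono)
        have "h2_norm (A (proj V h)) \<le> C * h2_norm (proj V h)" using C PV h by blast
        also have "\<dots> \<le> \<bar>C\<bar> * h2_norm (proj V h)" by (simp add: mult_right_mono)
        also have "\<dots> \<le> \<bar>C\<bar> * h2_norm h" using norm_proj_le[OF V h] by (simp add: mult_left_mono)
        finally show "h2_norm (A (proj V h)) \<le> \<bar>C\<bar> * h2_norm h" .
      qed simp
      finally show "cmod (h2_inner (A (proj V h)) f) \<le> (\<bar>C\<bar> * h2_norm f) * h2_norm h"
        by (simp add: mult_ac)
    qed
  qed
  from Riesz[OF this] obtain g where g: "g \<in> H2" "\<And>h. h \<in> H2 \<Longrightarrow> h2_inner (A (proj V h)) f = h2_inner h g"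
    by blast
  have "\<exists>!g. g \<in> V \<and> (\<forall>h\<in>V. h2_inner (A h) f = h2_inner h g)"
  proof (rule ex1I[of _ "proj V g"], intro conjI ballI)
    show "proj V g \<in> V" by (rule PV[OF g(1)])
    fix h assume h: "h \<in> V"
    then show "h2_inner (A h) f = h2_inner h (proj V g)"
      using g(2)[of h] VD(1) by (simp add: proj_eq_self[OF V] inner_proj_right[OF V g(1)])
  next
    fix g' assume g': "g' \<in> V \<and> (\<forall>h\<in>V. h2_inner (A h) f = h2_inner h g')"
    show "g' = proj V g"
    proof (rule eq_of_inner_eq[OF V])
      fix h assume h: "h \<in> V"
      have "h2_inner h g' = h2_inner h (proj V g)"
        using g' g(2)[of h] VD(1) h by (simp add: proj_eq_self[OF V] inner_proj_right[OF V g(1)])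
      then show "h2_inner g' h = h2_inner (proj V g) h" by (metis inner_cnj)
    qed (use g' PV g in auto)
  qed
  from theI'[OF this] have *: "adj V A f \<in> V \<and> (\<forall>h\<in>V. h2_inner (A h) f = h2_inner h (adj V A f))"
    unfolding adj_def .
  then show "adj V A f \<in> V" "h \<in> V \<Longrightarrow> h2_inner (A h) f = h2_inner h (adj V A f)" by auto
qed

lemma inner_adj_left:
  "closed_subspace V \<Longrightarrow> bounded_op V A \<Longrightarrow> f \<in> V \<Longrightarrow> h \<in> V \<Longrightarrow> h2_inner (adj V A f) h = h2_inner f (A h)"
  by (metis inner_adj inner_cnj)

section \<open>Orthonormal bases and Hilbert-Schmidt norms\<close>

definition orthonormal :: "fun2 set \<Rightarrow> bool" where
  "orthonormal E \<longleftrightarrow> (\<forall>e\<in>E. \<forall>f\<in>E. h2_inner e f = (if e = f then 1 else 0))"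

lemma orthonormalD: "orthonormal E \<Longrightarrow> e \<in> E \<Longrightarrow> f \<in> E \<Longrightarrow> h2_inner e f = (if e = f then 1 else 0)"
  by (simp add: orthonormal_def)

text \<open>A maximal orthonormal set (Zorn) spans a dense subspace: a vector outside the closed span would
  give, after subtracting its projection, a further unit vector orthogonal to the set.\<close>

lemma orthonormal_basis_exists:
  assumes V: "closed_subspace V"
  shows "\<exists>E. orthonormal_basis V E"
proof -
  note VD = closed_subspaceD[OF V]
  let ?A = "{E. E \<subseteq> V \<and> orthonormal E}"
  have "\<exists>M\<in>?A. \<forall>X\<in>?A. M \<subseteq> X \<longrightarrow> X = M"
  proof (rule subset_Zorn')
    fix C assume C: "subset.chain ?A C"
    have "h2_inner e f = (if e = f then 1 else 0)" if ef: "e \<in> \<Union>C" "f \<in> \<Union>C" for e f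
    proof -
      obtain X Y where X: "X \<in> C" "e \<in> X" and Y: "Y \<in> C" "f \<in> Y" using ef by blast
      have "X \<subseteq> Y \<or> Y \<subseteq> X" using C X Y by (meson subset_chain_def)
      then have "\<exists>Z\<in>C. e \<in> Z \<and> f \<in> Z" using X Y by blast
      then obtain Z where Z: "Z \<in> C" "e \<in> Z" "f \<in> Z" by blast
      then have "orthonormal Z" using C by (auto simp: subset_chain_def)
      then show ?thesis using Z orthonormalD by blast
    qed
    then show "\<Union>C \<in> ?A" using C by (auto simp: orthonormal_def subset_chain_def)
  qed
  then obtain E where E0: "E \<in> ?A" and max0: "\<forall>X\<in>?A. E \<subseteq> X \<longrightarrow> X = E" by (elim bexE)
  have E: "E \<subseteq> V" "orthonormal E" using E0 by simp_all
  have max: "X = E" if "X \<subseteq> V" "orthonormal X" "E \<subseteq> X" for X using max0 that by simp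
  have EH: "E \<subseteq> H2" using E(1) VD(1) by blast
  define W where "W = h2_closure (cfun.span E)"
  have W: "closed_subspace W" unfolding W_def by (rule closed_subspace_closure_span[OF EH])
  have WV: "W \<subseteq> V" unfolding W_def by (rule closure_span_minimal[OF E(1) V])
  have EW: "E \<subseteq> W" unfolding W_def
    using h2_closure_subset[OF span_subset_H2[OF EH]] cfun.span_superset by blast
  have "V \<subseteq> W"
  proof (rule ccontr)
    assume "\<not> V \<subseteq> W"
    then obtain f where f: "f \<in> V" "f \<notin> W" by blast
    have fH: "f \<in> H2" by (rule VD(1)[OF f(1)])
    define u where "u = f - proj W f"
    have pW: "proj W f \<in> W" by (rule proj_in[OF W fH])
    have uV: "u \<in> V" unfolding u_def using f(1) pW WV by (intro VD(4)) auto
    have uH: "u \<in> H2" by (rule VD(1)[OF uV])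
    have pH: "proj W f \<in> H2" using pW closed_subspaceD(1)[OF W] by blast
    have "u \<noteq> 0" using pW f(2) by (auto simp: u_def)
    then have nu: "h2_norm u \<noteq> 0" using uH h2_norm_eq_0 by blast
    define v where "v = cscale (of_real (inverse (h2_norm u))) u"
    have vV: "v \<in> V" unfolding v_def by (intro VD uV)
    have vH: "v \<in> H2" by (rule VD(1)[OF vV])
    have nv: "h2_norm v = 1" unfolding v_def using uH nu by (subst norm_cscale) (auto simp: norm_inverse)
    have vE: "h2_inner v e = 0" if "e \<in> E" for e
    proof -
      have "e \<in> W" "e \<in> H2" using that EW EH by auto
      then have "h2_inner u e = 0"
        using inner_proj[OF W fH] fH pH by (simp add: u_def inner_diff_left)
      then show ?thesis using uH by (simp add: v_def inner_cscale_left)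
    qed
    have vE': "h2_inner e v = 0" if "e \<in> E" for e using vE[OF that] inner_cnj[of v e] by simp
    have vv: "h2_inner v v = 1" using vH nv by (simp add: norm_sq_eq_inner)
    have "v \<notin> E" using vE vv by force
    moreover have "insert v E = E"
    proof (rule max)
      show "orthonormal (insert v E)"
        using E(2) vE vE' vv \<open>v \<notin> E\<close> unfolding orthonormal_def by auto
    qed (use vV E in auto)
    ultimately show False by blast
  qed
  then show ?thesis using E unfolding orthonormal_basis_def W_def orthonormal_def by blast
qed

text \<open>Bessel's inequality and the optimality of the Fourier coefficients in a single identity.\<close>

lemma norm_diff_combination:
  assumes E: "orthonormal E" "E \<subseteq> H2" and F: "finite F" "F \<subseteq> E" and f: "f \<in> H2"
  shows "(h2_norm (f - (\<Sum>e\<in>F. cscale (c e) e)))\<^sup>2 = (h2_norm f)\<^sup>2 -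
    (\<Sum>e\<in>F. (norm (h2_inner f e))\<^sup>2) + (\<Sum>e\<in>F. (norm (c e - h2_inner f e))\<^sup>2)"
proof -
  let ?u = "\<Sum>e\<in>F. cscale (c e) e"
  have FH: "e \<in> H2" if "e \<in> F" for e using that F E by blast
  have u: "?u \<in> H2" by (intro H2_sum H2_cscale FH)
  have inner_u: "h2_inner h ?u = (\<Sum>e\<in>F. cnj (c e) * h2_inner h e)" if "h \<in> H2" for h
    using that FH by (subst inner_sum_right) (auto simp: H2_cscale inner_cscale_right)
  have ue: "h2_inner ?u e = c e" if e: "e \<in> F" for e
  proof -
    have "h2_inner ?u e = (\<Sum>g\<in>F. c g * h2_inner g e)"
      using e FH by (subst inner_sum_left) (auto simp: H2_cscale inner_cscale_left)
    also have "\<dots> = (\<Sum>g\<in>F. if g = e then c g else 0)"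
    proof (rule sum.cong[OF refl])
      fix g assume "g \<in> F"
      then have "h2_inner g e = (if g = e then 1 else 0)" using F e by (intro orthonormalD[OF E(1)]) auto
      then show "c g * h2_inner g e = (if g = e then c g else 0)" by simp
    qed
    finally show ?thesis using F e by simp
  qed
  have "(h2_norm ?u)\<^sup>2 = Re (\<Sum>e\<in>F. cnj (c e) * c e)"
    unfolding norm_sq_eq_Re[OF u] inner_u[OF u] using ue by simp
  then have "(h2_norm (f - ?u))\<^sup>2 = (h2_norm f)\<^sup>2 + (\<Sum>e\<in>F. Re (cnj (c e) * c e) - 2 * Re (cnj (c e) * h2_inner f e))"
    unfolding norm_diff_sq[OF f u] inner_u[OF f] by (simp add: sum_subtractf sum_distrib_left)
  also have "(\<Sum>e\<in>F. Re (cnj (c e) * c e) - 2 * Re (cnj (c e) * h2_inner f e))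
     = (\<Sum>e\<in>F. (norm (c e - h2_inner f e))\<^sup>2 - (norm (h2_inner f e))\<^sup>2)"
  proof (rule sum.cong[OF refl])
    fix e
    show "Re (cnj (c e) * c e) - 2 * Re (cnj (c e) * h2_inner f e)
        = (norm (c e - h2_inner f e))\<^sup>2 - (norm (h2_inner f e))\<^sup>2"
      unfolding cmod_power2 by (simp add: power2_eq_square algebra_simps)
  qed
  finally show ?thesis unfolding sum_subtractf by linarith
qed

lemma Parseval:
  assumes E: "orthonormal_basis V E" and V: "closed_subspace V" and f: "f \<in> V"
  shows "(\<Sum>\<^sub>\<infinity>e\<in>E. ennreal ((norm (h2_inner f e))\<^sup>2)) = ennreal ((h2_norm f)\<^sup>2)"
proof -
  have oE: "orthonormal E" "E \<subseteq> V" using E by (auto simp: orthonormal_basis_def orthonormal_def)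
  have EH: "E \<subseteq> H2" using oE closed_subspaceD(1)[OF V] by blast
  have fH: "f \<in> H2" using f closed_subspaceD(1)[OF V] by blast
  let ?S = "\<lambda>F. \<Sum>e\<in>F. ennreal ((norm (h2_inner f e))\<^sup>2)"
  have S: "?S F = ennreal (\<Sum>e\<in>F. (norm (h2_inner f e))\<^sup>2)" for F by (rule sum_ennreal) auto
  have "(\<Sum>\<^sub>\<infinity>e\<in>E. ennreal ((norm (h2_inner f e))\<^sup>2)) = (SUP F\<in>{F. finite F \<and> F \<subseteq> E}. ?S F)"
    by (rule nonneg_infsum_complete) simp
  also have "\<dots> = ennreal ((h2_norm f)\<^sup>2)"
  proof (rule antisym)
    show "(SUP F\<in>{F. finite F \<and> F \<subseteq> E}. ?S F) \<le> ennreal ((h2_norm f)\<^sup>2)"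
    proof (rule SUP_least)
      fix F assume "F \<in> {F. finite F \<and> F \<subseteq> E}"
      then have F: "finite F" "F \<subseteq> E" by auto
      have "(\<Sum>e\<in>F. (norm (h2_inner f e))\<^sup>2) \<le> (h2_norm f)\<^sup>2"
        using norm_diff_combination[OF oE(1) EH F fH, of "h2_inner f"] 
          zero_le_power2[of "h2_norm (f - (\<Sum>e\<in>F. cscale (h2_inner f e) e))"] by simp
      then show "?S F \<le> ennreal ((h2_norm f)\<^sup>2)" unfolding S by (rule ennreal_leI)
    qed
    show "ennreal ((h2_norm f)\<^sup>2) \<le> (SUP F\<in>{F. finite F \<and> F \<subseteq> E}. ?S F)"
    proof (rule ennreal_le_epsilon)
      fix \<epsilon> :: real assume eps: "0 < \<epsilon>"
      have "f \<in> h2_closure (cfun.span E)" using E f by (auto simp: orthonormal_basis_def)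
      then obtain u where u: "u \<in> cfun.span E" "h2_norm (u - f) < sqrt \<epsilon>"
        using eps unfolding h2_closure_def by (auto dest!: spec[of _ "sqrt \<epsilon>"])
      obtain F c where F: "finite F" "F \<subseteq> E" "u = (\<Sum>e\<in>F. cscale (c e) e)"
        using u(1) unfolding cfun.span_explicit by blast
      have uH: "u \<in> H2" using u(1) span_subset_H2[OF EH] by blast
      have "h2_norm (f - u) < sqrt \<epsilon>" using u(2) h2_norm_minus_commute[OF uH fH] by simp
      then have "(h2_norm (f - u))\<^sup>2 < (sqrt \<epsilon>)\<^sup>2" by (intro power_strict_mono) auto
      then have "(h2_norm f)\<^sup>2 - (\<Sum>e\<in>F. (norm (h2_inner f e))\<^sup>2) \<le> \<epsilon>"
        using norm_diff_combination[OF oE(1) EH F(1,2) fH, of c] eps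
          sum_nonneg[of F "\<lambda>e. (norm (c e - h2_inner f e))\<^sup>2"] by (simp add: F(3))
      then have "ennreal ((h2_norm f)\<^sup>2) \<le> ennreal ((\<Sum>e\<in>F. (norm (h2_inner f e))\<^sup>2) + \<epsilon>)"
        by (intro ennreal_leI) simp
      also have "\<dots> = ?S F + ennreal \<epsilon>" using eps by (simp add: S ennreal_plus sum_nonneg)
      also have "\<dots> \<le> (SUP F\<in>{F. finite F \<and> F \<subseteq> E}. ?S F) + ennreal \<epsilon>"
        using F by (intro add_right_mono SUP_upper) auto
      finally show "ennreal ((h2_norm f)\<^sup>2) \<le> (SUP F\<in>{F. finite F \<and> F \<subseteq> E}. ?S F) + ennreal \<epsilon>" .
    qed
  qed
  finally show ?thesis .
qed

lemma summable_ennreal: "(f :: 'a \<Rightarrow> ennreal) summable_on A"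
  by (rule nonneg_summable_on_complete) simp

lemma infsum_swap_ennreal:
  fixes f :: "'a \<Rightarrow> 'b \<Rightarrow> ennreal"
  shows "(\<Sum>\<^sub>\<infinity>x\<in>A. \<Sum>\<^sub>\<infinity>y\<in>B. f x y) = (\<Sum>\<^sub>\<infinity>y\<in>B. \<Sum>\<^sub>\<infinity>x\<in>A. f x y)"
proof -
  have le: "(\<Sum>\<^sub>\<infinity>x\<in>A. \<Sum>\<^sub>\<infinity>y\<in>B. g x y) \<le> (\<Sum>\<^sub>\<infinity>y\<in>B. \<Sum>\<^sub>\<infinity>x\<in>A. g x y)"
    for g :: "'c \<Rightarrow> 'd \<Rightarrow> ennreal" and A B
  proof -
    have "(\<Sum>x\<in>F. \<Sum>\<^sub>\<infinity>y\<in>B. g x y) \<le> (\<Sum>\<^sub>\<infinity>y\<in>B. \<Sum>\<^sub>\<infinity>x\<in>A. g x y)" if F: "finite F" "F \<subseteq> A" for F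
    proof -
      have "(\<Sum>x\<in>F. \<Sum>\<^sub>\<infinity>y\<in>B. g x y) = (\<Sum>\<^sub>\<infinity>y\<in>B. \<Sum>x\<in>F. g x y)"
        using F(1) by induction (simp_all add: infsum_add summable_ennreal)
      also have "\<dots> \<le> (\<Sum>\<^sub>\<infinity>y\<in>B. \<Sum>\<^sub>\<infinity>x\<in>A. g x y)"
        using F by (intro infsum_mono summable_ennreal)
          (auto simp: nonneg_infsum_complete[of A] intro!: SUP_upper)
      finally show ?thesis .
    qed
    then show ?thesis by (subst nonneg_infsum_complete) (auto intro!: SUP_least)
  qed
  show ?thesis by (rule antisym[OF le le])
qed

definition some_basis :: "fun2 set \<Rightarrow> fun2 set" where
  "some_basis V = (SOME E. orthonormal_basis V E)"

lemma some_basis: "closed_subspace V \<Longrightarrow> orthonormal_basis V (some_basis V)"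
  unfolding some_basis_def by (rule someI_ex) (rule orthonormal_basis_exists)

lemma some_basis_subset: "closed_subspace V \<Longrightarrow> e \<in> some_basis V \<Longrightarrow> e \<in> V"
  using some_basis unfolding orthonormal_basis_def by blast

lemma hs_norm_sq_some_basis: "hs_norm_sq V T = (\<Sum>\<^sub>\<infinity>e\<in>some_basis V. ennreal ((h2_norm (T e))\<^sup>2))"
  by (simp add: hs_norm_sq_def some_basis_def)

lemma hs_norm_sq_cong:
  "closed_subspace V \<Longrightarrow> (\<And>e. e \<in> V \<Longrightarrow> h2_norm (T e) = h2_norm (T' e)) \<Longrightarrow> hs_norm_sq V T = hs_norm_sq V T'"
  unfolding hs_norm_sq_some_basis by (intro infsum_cong) (simp add: some_basis_subset)

text \<open>By Parseval's identity both sides are the sum of \<open>|\<langle>T e, f\<rangle>|\<^sup>2\<close> over the orthonormal bases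
  chosen for \<open>V\<close> and \<open>W\<close>.\<close>

lemma hs_norm_sq_adjoint:
  assumes V: "closed_subspace V" and W: "closed_subspace W"
    and T: "\<And>e. e \<in> V \<Longrightarrow> T e \<in> W" and T': "\<And>f. f \<in> W \<Longrightarrow> T' f \<in> V"
    and adj: "\<And>e f. e \<in> V \<Longrightarrow> f \<in> W \<Longrightarrow> h2_inner (T e) f = h2_inner e (T' f)"
  shows "hs_norm_sq V T = hs_norm_sq W T'"
proof -
  note E = some_basis[OF V] some_basis_subset[OF V] and F = some_basis[OF W] some_basis_subset[OF W]
  have "hs_norm_sq V T = (\<Sum>\<^sub>\<infinity>e\<in>some_basis V. \<Sum>\<^sub>\<infinity>f\<in>some_basis W. ennreal ((norm (h2_inner (T e) f))\<^sup>2))"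
    unfolding hs_norm_sq_some_basis
    by (intro infsum_cong) (simp add: Parseval[OF F(1) W] T E(2))
  also have "\<dots> = (\<Sum>\<^sub>\<infinity>f\<in>some_basis W. \<Sum>\<^sub>\<infinity>e\<in>some_basis V. ennreal ((norm (h2_inner (T e) f))\<^sup>2))"
    by (rule infsum_swap_ennreal)
  also have "\<dots> = (\<Sum>\<^sub>\<infinity>f\<in>some_basis W. \<Sum>\<^sub>\<infinity>e\<in>some_basis V. ennreal ((norm (h2_inner (T' f) e))\<^sup>2))"
  proof (intro infsum_cong)
    fix f e assume "f \<in> some_basis W" "e \<in> some_basis V"
    then have "h2_inner (T e) f = cnj (h2_inner (T' f) e)" using adj E F by (simp add: inner_cnj)
    then show "ennreal ((norm (h2_inner (T e) f))\<^sup>2) = ennreal ((norm (h2_inner (T' f) e))\<^sup>2)" by simp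
  qed
  also have "\<dots> = hs_norm_sq W T'"
    unfolding hs_norm_sq_some_basis
    by (intro infsum_cong) (simp add: Parseval[OF E(1) V] T' F(2))
  finally show ?thesis .
qed

lemma hs_norm_sq_mono:
  assumes V: "closed_subspace V" and "0 \<le> c"
    and "\<And>e. e \<in> V \<Longrightarrow> (h2_norm (T e))\<^sup>2 \<le> c * (h2_norm (T' e))\<^sup>2"
  shows "hs_norm_sq V T \<le> ennreal c * hs_norm_sq V T'"
proof -
  have "hs_norm_sq V T \<le> (\<Sum>\<^sub>\<infinity>e\<in>some_basis V. ennreal c * ennreal ((h2_norm (T' e))\<^sup>2))"
    unfolding hs_norm_sq_some_basis
  proof (rule infsum_mono)
    fix e assume "e \<in> some_basis V"
    then have "(h2_norm (T e))\<^sup>2 \<le> c * (h2_norm (T' e))\<^sup>2" using assms(3) some_basis_subset[OF V] by blast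
    then show "ennreal ((h2_norm (T e))\<^sup>2) \<le> ennreal c * ennreal ((h2_norm (T' e))\<^sup>2)"
      using assms(2) by (simp flip: ennreal_mult)
  qed (rule summable_ennreal)+
  also have "\<dots> = ennreal c * hs_norm_sq V T'"
    unfolding hs_norm_sq_some_basis
    by (simp add: nonneg_infsum_complete SUP_mult_left_ennreal sum_distrib_left del: sum_ennreal)
  finally show ?thesis .
qed

lemma hs_norm_sq_pythagoras:
  assumes V: "closed_subspace V"
    and "\<And>e. e \<in> V \<Longrightarrow> (h2_norm (T e))\<^sup>2 = (h2_norm (T1 e))\<^sup>2 + (h2_norm (T2 e))\<^sup>2"
  shows "hs_norm_sq V T = hs_norm_sq V T1 + hs_norm_sq V T2"
proof -
  have "hs_norm_sq V T = (\<Sum>\<^sub>\<infinity>e\<in>some_basis V. ennreal ((h2_norm (T1 e))\<^sup>2) + ennreal ((h2_norm (T2 e))\<^sup>2))"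
    unfolding hs_norm_sq_some_basis
    by (intro infsum_cong) (simp add: assms(2) some_basis_subset[OF V] ennreal_plus)
  then show ?thesis unfolding hs_norm_sq_some_basis by (simp add: infsum_add summable_ennreal)
qed

section \<open>Boundary values on the torus\<close>

lemma uniform_measure_circle:
  "uniform_measure lborel {0..2 * pi} = density lborel (\<lambda>x. ennreal (indicator {0..2 * pi} x / (2 * pi)))"
proof -
  have "indicator {0..2 * pi} x / ennreal (2 * pi) = ennreal (indicator {0..2 * pi} x / (2 * pi))" for x :: real
    by (auto simp: divide_ennreal indicator_def ennreal_1[symmetric] simp del: ennreal_1)
  then show ?thesis by (simp add: uniform_measure_def)
qed

lemma sets_circle [simp, measurable_cong]: "sets circle = sets borel"
  by (simp add: circle_def)

lemma space_circle [simp]: "space circle = UNIV"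
  by (simp add: circle_def)

lemma cis_measurable [measurable]: "cis \<in> borel_measurable borel"
  by (intro borel_measurable_continuous_onI continuous_intros)

lemma cnj_measurable [measurable]: "cnj \<in> borel_measurable borel"
  by (intro borel_measurable_continuous_onI continuous_intros)

lemma emeasure_circle: "emeasure circle UNIV = 1"
  by (simp add: circle_def emeasure_distr divide_ennreal emeasure_uniform_measure_1)

lemma AE_circle: "AE \<zeta> in circle. norm \<zeta> = 1"
  unfolding circle_def by (subst AE_distr_iff) auto

lemma integral_circle:
  fixes f :: "complex \<Rightarrow> complex"
  assumes "f \<in> borel_measurable borel"
  shows "integral\<^sup>L circle f = (\<integral>t. indicator {0..2 * pi} t *\<^sub>R f (cis t) \<partial>lborel) / (2 * pi)"
proof -
  have [measurable]: "f \<in> borel_measurable borel" by fact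
  have "integral\<^sup>L circle f = (\<integral>t. f (cis t) \<partial>density lborel (\<lambda>x. ennreal (indicator {0..2 * pi} x / (2 * pi))))"
    unfolding circle_def uniform_measure_circle by (subst integral_distr) auto
  also have "\<dots> = (\<integral>t. (indicator {0..2 * pi} t / (2 * pi)) *\<^sub>R f (cis t) \<partial>lborel)"
    by (subst integral_density) auto
  also have "\<dots> = (\<integral>t. (indicator {0..2 * pi} t *\<^sub>R f (cis t)) / (2 * pi) \<partial>lborel)"
    by (intro Bochner_Integration.integral_cong) (auto simp: scaleR_conv_of_real)
  finally show ?thesis by simp
qed

text \<open>The integrand is \<open>t \<mapsto> cis (k t)\<close> with \<open>k = m - n\<close>, which has a periodic primitive unless
  \<open>k = 0\<close>.\<close>

lemma integral_circle_power:
  "(\<integral>\<zeta>. \<zeta> ^ m * cnj (\<zeta> ^ n) \<partial>circle) = (if m = n then 1 else 0)"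
proof -
  define k where "k = real m - real n"
  have eq: "cis t ^ m * cnj (cis t ^ n) = cis (k * t)" for t
    by (simp add: Complex.DeMoivre cis_cnj cis_mult k_def algebra_simps)
  have "(\<integral>t. indicator {0..2 * pi} t *\<^sub>R cis (k * t) \<partial>lborel) = (if m = n then 2 * pi else 0)"
  proof (cases "m = n")
    case True
    have "(\<integral>t. indicator {0..2 * pi} t *\<^sub>R (1::complex) \<partial>lborel) = of_real (2 * pi) - of_real 0"
      by (rule integral_FTC_atLeastAtMost) (auto intro!: derivative_eq_intros)
    then show ?thesis using True by (simp add: k_def)
  next
    case False
    then have k: "k \<noteq> 0" by (simp add: k_def)
    have "(\<integral>t. indicator {0..2 * pi} t *\<^sub>R cis (k * t) \<partial>lborel)
        = cis (k * (2 * pi)) / (\<i> * k) - cis (k * 0) / (\<i> * k)"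
    proof (rule integral_FTC_atLeastAtMost)
      fix t :: real
      have "((\<lambda>t. exp (\<i> * of_real (k * t)) / (\<i> * k)) has_vector_derivative exp (\<i> * of_real (k * t))) (at t within {0..2 * pi})"
        using k by (auto intro!: derivative_eq_intros simp: has_vector_derivative_def[symmetric] field_simps
            intro: has_vector_derivative_real_field)
      then show "((\<lambda>t. cis (k * t) / (\<i> * k)) has_vector_derivative cis (k * t)) (at t within {0..2 * pi})"
        by (simp add: cis_conv_exp)
    qed (auto intro!: continuous_intros)
    also have "cis (k * (2 * pi)) = 1"
      using cis_multiple_2pi[of k] by (simp add: k_def mult_ac)
    finally show ?thesis using False by simp
  qed
  moreover have "(\<lambda>\<zeta>. \<zeta> ^ m * cnj (\<zeta> ^ n)) \<in> borel_measurable borel" by measurable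
  ultimately show ?thesis by (simp only: integral_circle eq) simp
qed

interpretation circle: finite_measure circle
  by standard (simp add: emeasure_circle)

interpretation torus: pair_sigma_finite circle circle ..

lemma sets_torus [simp, measurable_cong]: "sets torus = sets borel"
  unfolding torus_def borel_prod[symmetric] by (rule sets_pair_measure_cong) auto

lemma space_torus [simp]: "space torus = UNIV"
  by (simp add: torus_def space_pair_measure)

interpretation torus_finite: finite_measure torus
proof
  have "emeasure torus (UNIV \<times> UNIV) = emeasure circle UNIV * emeasure circle UNIV"
    unfolding torus_def by (rule circle.emeasure_pair_measure_Times) auto
  then show "emeasure torus (space torus) \<noteq> \<infinity>" by (simp add: emeasure_circle)
qed

lemma emeasure_torus: "emeasure torus UNIV = 1"
proof -
  have "emeasure torus (UNIV \<times> UNIV) = emeasure circle UNIV * emeasure circle UNIV"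
    unfolding torus_def by (rule circle.emeasure_pair_measure_Times) auto
  then show ?thesis by (simp add: emeasure_circle)
qed

lemma AE_torus_fst:
  assumes "AE \<zeta> in circle. P \<zeta>"
  shows "AE q in torus. P (fst q)"
proof -
  obtain N where N: "{\<zeta> \<in> space circle. \<not> P \<zeta>} \<subseteq> N" "emeasure circle N = 0" "N \<in> sets circle"
    using AE_E[OF assms] by metis
  have "emeasure torus (N \<times> UNIV) = emeasure circle N * emeasure circle UNIV"
    unfolding torus_def using N by (intro circle.emeasure_pair_measure_Times) auto
  then show ?thesis using N
    by (intro AE_I'[of "N \<times> UNIV"]) (auto simp: null_sets_def torus_def)
qed

lemma AE_torus_snd:
  assumes "AE \<zeta> in circle. P \<zeta>"
  shows "AE q in torus. P (snd q)"
proof -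
  obtain N where N: "{\<zeta> \<in> space circle. \<not> P \<zeta>} \<subseteq> N" "emeasure circle N = 0" "N \<in> sets circle"
    using AE_E[OF assms] by metis
  have "emeasure torus (UNIV \<times> N) = emeasure circle UNIV * emeasure circle N"
    unfolding torus_def using N by (intro circle.emeasure_pair_measure_Times) auto
  then show ?thesis using N
    by (intro AE_I'[of "UNIV \<times> N"]) (auto simp: null_sets_def torus_def)
qed

lemma AE_torus: "AE q in torus. norm (fst q) = 1 \<and> norm (snd q) = 1"
  using AE_torus_fst[OF AE_circle] AE_torus_snd[OF AE_circle] by eventually_elim simp

lemma norm_mon_torus: "norm (fst q) = 1 \<and> norm (snd q) = 1 \<Longrightarrow> norm (mon k q) = 1"
  by (simp add: norm_mon)

lemma mon_measurable [measurable]: "mon k \<in> borel_measurable borel"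
  unfolding mon_def by (intro borel_measurable_continuous_onI continuous_intros)

lemma integrable_mon_mult: "integrable torus (\<lambda>q. mon k q * cnj (mon l q))"
proof (rule torus_finite.integrable_const_bound[of _ 1])
  show "AE q in torus. norm (mon k q * cnj (mon l q)) \<le> 1"
    using AE_torus by eventually_elim (simp add: norm_mult norm_mon)
qed measurable

lemma integral_mon:
  "(\<integral>q. mon k q * cnj (mon l q) \<partial>torus) = (if k = l then 1 else 0)"
proof -
  obtain i j i' j' where k: "k = (i, j)" and l: "l = (i', j')" by (cases k, cases l)
  have "(\<integral>q. mon k q * cnj (mon l q) \<partial>torus) = (\<integral>x. \<integral>y. mon k (x, y) * cnj (mon l (x, y)) \<partial>circle \<partial>circle)"
    using torus.integral_fst'[of "\<lambda>q. mon k q * cnj (mon l q)"] integrable_mon_mult[of k l]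
    by (simp add: torus_def)
  also have "\<dots> = (\<integral>x. \<integral>y. (x ^ i * cnj (x ^ i')) * (y ^ j * cnj (y ^ j')) \<partial>circle \<partial>circle)"
    by (simp add: k l mon_def mult_ac)
  also have "\<dots> = (if k = l then 1 else 0)"
    by (simp only: integral_mult_right_zero integral_mult_left_zero integral_circle_power) (simp add: k l)
  finally show ?thesis .
qed

subsection \<open>Dilations\<close>

definition dil :: "real \<Rightarrow> complex \<times> complex \<Rightarrow> complex \<times> complex" where
  "dil r q = (of_real r * fst q, of_real r * snd q)"

definition degr :: "nat \<times> nat \<Rightarrow> nat" where
  "degr k = fst k + snd k"

lemma mon_dil: "mon k (dil r q) = of_real (r ^ degr k) * mon k q"
  by (simp add: mon_def dil_def degr_def power_mult_distrib power_add)

lemma dil_bidisk: "norm (fst q) = 1 \<and> norm (snd q) = 1 \<Longrightarrow> 0 \<le> r \<Longrightarrow> r < 1 \<Longrightarrow> dil r q \<in> bidisk"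
  by (simp add: dil_def mem_bidisk norm_mult)

lemma dil_measurable [measurable]: "dil r \<in> borel_measurable borel"
  unfolding dil_def by (intro borel_measurable_continuous_onI continuous_intros)

text \<open>The same as \<open>has_h2_coeffs\<close> without square-summability: it covers functions for which
  membership in the Hardy space is yet to be shown.\<close>

definition power_series :: "fun2 \<Rightarrow> (nat \<times> nat \<Rightarrow> complex) \<Rightarrow> bool" where
  "power_series F a \<longleftrightarrow> (\<forall>p\<in>bidisk. ((\<lambda>k. a k * mon k p) has_sum F p) UNIV) \<and> (\<forall>p. p \<notin> bidisk \<longrightarrow> F p = 0)"

lemma H2_power_series: "F \<in> H2 \<Longrightarrow> power_series F (h2_coeffs F)"
  using has_h2_coeffs_h2_coeffs by (simp add: power_series_def has_h2_coeffs_iff)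

lemma has_h2_coeffs_power_series: "has_h2_coeffs F a \<longleftrightarrow> ell2 a \<and> power_series F a"
  by (auto simp: power_series_def has_h2_coeffs_iff)

lemma power_seriesD:
  assumes "power_series F a"
  shows "p \<in> bidisk \<Longrightarrow> ((\<lambda>k. a k * mon k p) has_sum F p) UNIV" "p \<notin> bidisk \<Longrightarrow> F p = 0"
  using assms unfolding power_series_def by blast+

lemma power_series_measurable:
  assumes "power_series F a"
  shows "F \<in> borel_measurable borel"
proof (rule borel_measurable_LIMSEQ_metric)
  have [measurable]: "bidisk \<in> sets borel"
    by (intro borel_open open_Times open_ball)
  show "(\<lambda>p. indicator bidisk p * (\<Sum>k\<in>box n. a k * mon k p)) \<in> borel_measurable borel" for n
    by measurable
  show "(\<lambda>n. indicator bidisk p * (\<Sum>k\<in>box n. a k * mon k p)) \<longlonglongrightarrow> F p" for p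
    using has_sum_box[OF power_seriesD(1)[OF assms, of p]] power_seriesD(2)[OF assms, of p]
    by (cases "p \<in> bidisk") (simp_all del: mem_Times_iff)
qed

lemma power_series_abs_summable:
  assumes "power_series F a" "0 \<le> r" "r < 1"
  shows "(\<lambda>k. norm (a k) * r ^ degr k) summable_on UNIV"
proof -
  have "(of_real r, of_real r) \<in> bidisk" using assms by (simp add: mem_bidisk)
  then have "(\<lambda>k. a k * mon k (of_real r, of_real r)) summable_on UNIV"
    using assms(1) has_sum_imp_summable unfolding power_series_def by blast
  then have "(\<lambda>k. norm (a k * mon k (of_real r, of_real r))) summable_on UNIV"
    by (simp add: summable_on_iff_abs_summable_on_complex)
  then show ?thesis using assms by (simp add: norm_mult norm_mon degr_def power_add)
qed

context
  fixes F a and r :: real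
  assumes F: "power_series F a" and r: "0 \<le> r" "r < 1"
begin

lemma dilation_has_sum:
  assumes "norm (fst q) = 1 \<and> norm (snd q) = 1"
  shows "((\<lambda>k. a k * of_real (r ^ degr k) * mon k q) has_sum F (dil r q)) UNIV"
  using power_seriesD(1)[OF F dil_bidisk[OF assms r]] by (simp add: mon_dil mult.assoc)

lemma dilation_partial_bound:
  assumes "norm (fst q) = 1 \<and> norm (snd q) = 1"
  shows "norm (\<Sum>k\<in>box n. a k * of_real (r ^ degr k) * mon k q) \<le> (\<Sum>\<^sub>\<infinity>k. norm (a k) * r ^ degr k)"
proof -
  have "norm (\<Sum>k\<in>box n. a k * of_real (r ^ degr k) * mon k q) \<le> (\<Sum>k\<in>box n. norm (a k) * r ^ degr k)"
    by (rule sum_norm_le) (use r norm_mon_torus[OF assms] in \<open>simp add: norm_mult norm_power\<close>)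
  also have "\<dots> \<le> (\<Sum>\<^sub>\<infinity>k. norm (a k) * r ^ degr k)"
    by (rule finite_sum_le_infsum[OF power_series_abs_summable[OF F r]]) (use r in auto)
  finally show ?thesis .
qed

lemma dilation_bound:
  assumes "norm (fst q) = 1 \<and> norm (snd q) = 1"
  shows "norm (F (dil r q)) \<le> (\<Sum>\<^sub>\<infinity>k. norm (a k) * r ^ degr k)"
  by (rule LIMSEQ_le_const2[OF tendsto_norm[OF has_sum_box[OF dilation_has_sum[OF assms]]]])
    (use dilation_partial_bound[OF assms] in auto)

text \<open>Dominated convergence: on a torus of radius \<open>r < 1\<close> all partial sums are bounded by the sum of
  the absolute values.\<close>

lemma dilation_integral_limit:
  assumes [measurable]: "h \<in> borel_measurable borel" and h: "\<And>q. norm (fst q) = 1 \<and> norm (snd q) = 1 \<Longrightarrow> norm (h q) \<le> B"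
  shows "(\<lambda>n. \<Sum>k\<in>box n. a k * of_real (r ^ degr k) * (\<integral>q. mon k q * h q \<partial>torus)) \<longlonglongrightarrow> (\<integral>q. F (dil r q) * h q \<partial>torus)"
proof -
  note [measurable] = power_series_measurable[OF F]
  let ?A = "\<Sum>\<^sub>\<infinity>k. norm (a k) * r ^ degr k"
  have int: "integrable torus (\<lambda>q. mon k q * h q)" for k
  proof (rule torus_finite.integrable_const_bound[of _ B])
    show "AE q in torus. norm (mon k q * h q) \<le> B"
      using AE_torus by eventually_elim (simp add: norm_mult norm_mon h)
  qed measurable
  have "(\<lambda>n. \<integral>q. (\<Sum>k\<in>box n. a k * of_real (r ^ degr k) * mon k q) * h q \<partial>torus) \<longlonglongrightarrow> (\<integral>q. F (dil r q) * h q \<partial>torus)"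
  proof (rule integral_dominated_convergence[where w = "\<lambda>_. ?A * B"])
    show "AE q in torus. (\<lambda>n. (\<Sum>k\<in>box n. a k * of_real (r ^ degr k) * mon k q) * h q) \<longlonglongrightarrow> F (dil r q) * h q"
      using AE_torus by eventually_elim (intro tendsto_intros has_sum_box dilation_has_sum)
    show "AE q in torus. norm ((\<Sum>k\<in>box n. a k * of_real (r ^ degr k) * mon k q) * h q) \<le> ?A * B" for n
      using AE_torus
    proof eventually_elim
      case (elim q)
      then show ?case using dilation_partial_bound[OF elim, of n] h[OF elim] norm_ge_zero order_trans
        unfolding norm_mult by (intro mult_mono) (auto intro: order_trans[OF norm_ge_zero])
    qed
  qed auto
  also have "(\<lambda>n. \<integral>q. (\<Sum>k\<in>box n. a k * of_real (r ^ degr k) * mon k q) * h q \<partial>torus)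
     = (\<lambda>n. \<Sum>k\<in>box n. a k * of_real (r ^ degr k) * (\<integral>q. mon k q * h q \<partial>torus))"
  proof
    fix n
    show "(\<integral>q. (\<Sum>k\<in>box n. a k * of_real (r ^ degr k) * mon k q) * h q \<partial>torus)
       = (\<Sum>k\<in>box n. a k * of_real (r ^ degr k) * (\<integral>q. mon k q * h q \<partial>torus))"
      unfolding sum_distrib_right mult.assoc
      by (subst Bochner_Integration.integral_sum) (auto intro!: integrable_mult_right int)
  qed
  finally show ?thesis .
qed

lemma dilation_coeff:
  "(\<integral>q. F (dil r q) * cnj (mon l q) \<partial>torus) = a l * of_real (r ^ degr l)"
proof (rule LIMSEQ_unique)
  show "(\<lambda>n. \<Sum>k\<in>box n. a k * of_real (r ^ degr k) * (\<integral>q. mon k q * cnj (mon l q) \<partial>torus))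
     \<longlonglongrightarrow> (\<integral>q. F (dil r q) * cnj (mon l q) \<partial>torus)"
    by (rule dilation_integral_limit[where B = 1]) (auto simp: norm_mon)
  have "((\<lambda>k. a k * of_real (r ^ degr k) * (\<integral>q. mon k q * cnj (mon l q) \<partial>torus)) has_sum (a l * of_real (r ^ degr l))) UNIV"
    by (rule has_sum_finite_neutralI[of "{l}"]) (auto simp: integral_mon)
  then show "(\<lambda>n. \<Sum>k\<in>box n. a k * of_real (r ^ degr k) * (\<integral>q. mon k q * cnj (mon l q) \<partial>torus))
     \<longlonglongrightarrow> a l * of_real (r ^ degr l)"
    by (rule has_sum_box)
qed

end

text \<open>Integrating the series of \<open>F\<close> against the conjugate of \<open>G\<close> picks out the coefficients of
  \<open>G\<close>.\<close>

lemma dilation_inner: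
  assumes F: "power_series F a" and G: "power_series G b" and r: "0 \<le> r" "r < 1"
  shows "((\<lambda>k. a k * cnj (b k) * of_real (r ^ degr k) ^ 2) has_sum (\<integral>q. F (dil r q) * cnj (G (dil r q)) \<partial>torus)) UNIV"
proof -
  note [measurable] = power_series_measurable[OF F] power_series_measurable[OF G]
  have *: "(\<integral>q. mon k q * cnj (G (dil r q)) \<partial>torus) = cnj (b k) * of_real (r ^ degr k)" for k
  proof -
    have "(\<integral>q. mon k q * cnj (G (dil r q)) \<partial>torus) = (\<integral>q. cnj (G (dil r q) * cnj (mon k q)) \<partial>torus)"
      by (simp add: mult.commute)
    also have "\<dots> = cnj (\<integral>q. G (dil r q) * cnj (mon k q) \<partial>torus)"
      by (rule Bochner_Integration.integral_cnj)
    finally show ?thesis by (simp add: dilation_coeff[OF G r])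
  qed
  have "(\<lambda>n. \<Sum>k\<in>box n. a k * of_real (r ^ degr k) * (\<integral>q. mon k q * cnj (G (dil r q)) \<partial>torus))
     \<longlonglongrightarrow> (\<integral>q. F (dil r q) * cnj (G (dil r q)) \<partial>torus)"
    by (rule dilation_integral_limit[OF F r]) (auto intro: dilation_bound[OF G r])
  then have lim: "(\<lambda>n. \<Sum>k\<in>box n. a k * cnj (b k) * of_real (r ^ degr k) ^ 2)
     \<longlonglongrightarrow> (\<integral>q. F (dil r q) * cnj (G (dil r q)) \<partial>torus)"
    unfolding * by (simp add: power2_eq_square mult_ac)
  have sq: "(\<lambda>k. norm (x k * x k)) summable_on UNIV" if "(\<lambda>k. norm (x k)) summable_on UNIV" for x :: "nat \<times> nat \<Rightarrow> complex"
  proof -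
    have "(\<lambda>k. norm (x k) * infsum (\<lambda>k. norm (x k)) UNIV) summable_on UNIV"
      using that by (rule summable_on_cmult_left)
    then show ?thesis
      by (rule summable_on_comparison_test)
        (auto simp: norm_mult intro!: mult_left_mono finite_sum_le_infsum[OF that, of "{_}", simplified])
  qed
  have "(\<lambda>k. norm ((a k * of_real (r ^ degr k)) * (cnj (b k) * of_real (r ^ degr k)))) summable_on UNIV"
  proof (intro abs_summable_product[of "\<lambda>k. a k * of_real (r ^ degr k)" UNIV "\<lambda>k. cnj (b k) * of_real (r ^ degr k)"]
      sq[of "\<lambda>k. a k * of_real (r ^ degr k)"] sq[of "\<lambda>k. cnj (b k) * of_real (r ^ degr k)"])
    show "(\<lambda>k. norm (a k * of_real (r ^ degr k))) summable_on UNIV"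
      using power_series_abs_summable[OF F r] r by (simp add: norm_mult norm_power)
    show "(\<lambda>k. norm (cnj (b k) * of_real (r ^ degr k))) summable_on UNIV"
      using power_series_abs_summable[OF G r] r by (simp add: norm_mult norm_power)
  qed
  from abs_summable_summable[OF this]
  have "(\<lambda>k. a k * cnj (b k) * of_real (r ^ degr k) ^ 2) summable_on UNIV"
    by (simp add: power2_eq_square mult_ac)
  then obtain s where s: "((\<lambda>k. a k * cnj (b k) * of_real (r ^ degr k) ^ 2) has_sum s) UNIV"
    by (auto simp: summable_on_def)
  then show ?thesis using LIMSEQ_unique[OF lim has_sum_box[OF s]] by simp
qed

lemma dilation_norm:
  assumes F: "power_series F a" and r: "0 \<le> r" "r < 1"
  shows "((\<lambda>k. (norm (a k))\<^sup>2 * (r ^ degr k)\<^sup>2) has_sum (\<integral>q. (norm (F (dil r q)))\<^sup>2 \<partial>torus)) UNIV"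
proof -
  have "((\<lambda>k. complex_of_real ((norm (a k))\<^sup>2 * (r ^ degr k)\<^sup>2)) has_sum
      (\<integral>q. complex_of_real ((norm (F (dil r q)))\<^sup>2) \<partial>torus)) UNIV"
    using dilation_inner[OF F F r]
    unfolding complex_norm_square[symmetric] of_real_power[symmetric] of_real_mult[symmetric] .
  then show ?thesis by (simp add: has_sum_of_real_iff del: of_real_mult of_real_power)
qed

lemma dilation_norm_integrable:
  assumes F: "power_series F a" and r: "0 \<le> r" "r < 1"
  shows "integrable torus (\<lambda>q. (norm (F (dil r q)))\<^sup>2)"
proof -
  note [measurable] = power_series_measurable[OF F]
  show ?thesis
  proof (rule torus_finite.integrable_const_bound[of _ "(\<Sum>\<^sub>\<infinity>k. norm (a k) * r ^ degr k)\<^sup>2"])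
    show "AE q in torus. norm ((norm (F (dil r q)))\<^sup>2) \<le> (\<Sum>\<^sub>\<infinity>k. norm (a k) * r ^ degr k)\<^sup>2"
      using AE_torus by eventually_elim (simp add: power_mono dilation_bound[OF F r])
  qed measurable
qed

lemma dilation_norm_le:
  assumes F: "F \<in> H2" and r: "0 \<le> r" "r < 1"
  shows "(\<integral>q. (norm (F (dil r q)))\<^sup>2 \<partial>torus) \<le> (h2_norm F)\<^sup>2"
proof (rule has_sum_mono[OF dilation_norm[OF H2_power_series[OF F] r] norm_coeffs_sums[OF F]])
  fix k
  have "(r ^ degr k)\<^sup>2 \<le> 1" using r by (simp add: power_le_one)
  then show "(norm (h2_coeffs F k))\<^sup>2 * (r ^ degr k)\<^sup>2 \<le> (norm (h2_coeffs F k))\<^sup>2"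
    using mult_left_le by fastforce
qed

text \<open>Each finite sum of \<open>|a\<^sub>k|\<^sup>2\<close> is the limit for \<open>r \<rightarrow> 1\<close> of a part of the squared \<open>L\<^sup>2\<close> norm of a
  dilation.\<close>

lemma H2_criterion:
  assumes F: "power_series F a"
    and bound: "\<And>r. 0 < r \<Longrightarrow> r < 1 \<Longrightarrow> (\<integral>q. (norm (F (dil r q)))\<^sup>2 \<partial>torus) \<le> B"
  shows "has_h2_coeffs F a"
proof -
  have "(\<Sum>k\<in>K. (norm (a k))\<^sup>2) \<le> B" if K: "finite K" for K
  proof -
    have "((\<lambda>r. \<Sum>k\<in>K. (norm (a k))\<^sup>2 * (r ^ degr k)\<^sup>2) \<longlongrightarrow> (\<Sum>k\<in>K. (norm (a k))\<^sup>2 * (1 ^ degr k)\<^sup>2)) (at_left 1)"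
      by (intro tendsto_intros)
    moreover have "\<forall>\<^sub>F r in at_left 1. (\<Sum>k\<in>K. (norm (a k))\<^sup>2 * (r ^ degr k)\<^sup>2) \<le> B"
    proof (rule eventually_at_leftI[of 0])
      fix r :: real assume r: "r \<in> {0<..<1}"
      have "(\<Sum>k\<in>K. (norm (a k))\<^sup>2 * (r ^ degr k)\<^sup>2) \<le> (\<integral>q. (norm (F (dil r q)))\<^sup>2 \<partial>torus)"
        using r by (intro finite_sum_le_has_sum[OF dilation_norm[OF F] K]) auto
      also have "\<dots> \<le> B" using r bound by auto
      finally show "(\<Sum>k\<in>K. (norm (a k))\<^sup>2 * (r ^ degr k)\<^sup>2) \<le> B" .
    qed simp
    ultimately have "(\<Sum>k\<in>K. (norm (a k))\<^sup>2 * (1 ^ degr k)\<^sup>2) \<le> B"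
      by (rule tendsto_upperbound) simp
    then show ?thesis by simp
  qed
  then have "ell2 a"
    unfolding ell2_def by (intro nonneg_bdd_above_summable_on) (auto intro!: bdd_aboveI2[where M = B])
  then show ?thesis using F by (simp add: has_h2_coeffs_power_series)
qed

text \<open>The series for the integrals converges uniformly in \<open>r \<in> [0, 1]\<close>, so it is continuous at 1.\<close>

lemma dilation_inner_tendsto:
  assumes F: "F \<in> H2" and G: "G \<in> H2"
  shows "((\<lambda>r. \<integral>q. F (dil r q) * cnj (G (dil r q)) \<partial>torus) \<longlongrightarrow> h2_inner F G) (at_left 1)"
proof -
  let ?c = "\<lambda>k. h2_coeffs F k * cnj (h2_coeffs G k)"
  let ?h = "\<lambda>r::real. \<Sum>\<^sub>\<infinity>k. ?c k * of_real (r ^ degr k) ^ 2"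
  have "uniform_limit {0..1} (\<lambda>X r. \<Sum>k\<in>X. ?c k * of_real (r ^ degr k) ^ 2) ?h (finite_subsets_at_top UNIV)"
  proof (rule Weierstrass_m_test_general)
    show "(\<lambda>k. norm (?c k)) summable_on UNIV"
      using F G by (intro ell2_mult_abs_summable) (auto simp: ell2_h2_coeffs)
    fix k and r :: real assume "r \<in> {0..1}"
    then have "(r ^ degr k)\<^sup>2 \<le> 1" by (simp add: power_le_one)
    then have "norm (?c k) * (r ^ degr k)\<^sup>2 \<le> norm (?c k)" by (intro mult_left_le) auto
    then show "norm (?c k * of_real (r ^ degr k) ^ 2) \<le> norm (?c k)"
      unfolding norm_mult[of "?c k"] norm_power norm_of_real power2_abs .
  qed
  then have "continuous_on {0..1} ?h"
    by (rule uniform_limit_theorem[rotated]) (auto intro!: continuous_intros always_eventually)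
  then have "(?h \<longlongrightarrow> ?h 1) (at 1 within {0..1})"
    unfolding continuous_on_def by (rule bspec) simp
  then have lim: "(?h \<longlongrightarrow> h2_inner F G) (at_left 1)"
    by (simp add: at_within_Icc_at_left h2_inner_def)
  have "\<forall>\<^sub>F r in at_left 1. ?h r = (\<integral>q. F (dil r q) * cnj (G (dil r q)) \<partial>torus)"
    using infsumI[OF dilation_inner[OF H2_power_series[OF F] H2_power_series[OF G]]]
    by (intro eventually_at_leftI[of 0]) simp_all
  from Lim_transform_eventually[OF lim this] show ?thesis .
qed

lemma dilation_norm_tendsto:
  assumes F: "F \<in> H2"
  shows "((\<lambda>r. \<integral>q. (norm (F (dil r q)))\<^sup>2 \<partial>torus) \<longlongrightarrow> (h2_norm F)\<^sup>2) (at_left 1)"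
proof -
  have "((\<lambda>r. Re (\<integral>q. F (dil r q) * cnj (F (dil r q)) \<partial>torus)) \<longlongrightarrow> Re (h2_inner F F)) (at_left 1)"
    by (intro tendsto_intros dilation_inner_tendsto F)
  then show ?thesis
    unfolding complex_norm_square[symmetric] norm_sq_eq_inner[OF F] integral_complex_of_real
      Re_complex_of_real .
qed

subsection \<open>Existence of boundary functions\<close>

abbreviation l2sq :: "fun2 \<Rightarrow> ennreal" where
  "l2sq g \<equiv> \<integral>\<^sup>+ q. ennreal ((norm (g q))\<^sup>2) \<partial>torus"

text \<open>A polynomial on the whole plane: unlike elements of \<open>H2\<close>, it has values on the torus.\<close>

definition bpol :: "(nat \<times> nat) set \<Rightarrow> (nat \<times> nat \<Rightarrow> complex) \<Rightarrow> fun2" where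
  "bpol K a = (\<lambda>q. \<Sum>k\<in>K. a k * mon k q)"

lemma bpol_measurable [measurable]: "bpol K a \<in> borel_measurable borel"
  unfolding bpol_def by measurable

lemma l2sq_bpol:
  assumes K: "finite K"
  shows "l2sq (bpol K a) = ennreal (\<Sum>k\<in>K. (norm (a k))\<^sup>2)"
proof -
  have int: "integrable torus (\<lambda>q. (a k * cnj (a l)) * (mon k q * cnj (mon l q)))" for k l
    by (intro integrable_mult_right integrable_mon_mult)
  have eq: "complex_of_real ((norm (bpol K a q))\<^sup>2)
      = (\<Sum>k\<in>K. \<Sum>l\<in>K. (a k * cnj (a l)) * (mon k q * cnj (mon l q)))" for q
    unfolding complex_norm_square bpol_def cnj_sum sum_product by (simp add: mult_ac)
  have "integrable torus (\<lambda>q. complex_of_real ((norm (bpol K a q))\<^sup>2))"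
    unfolding eq by (intro Bochner_Integration.integrable_sum int)
  then have int': "integrable torus (\<lambda>q. (norm (bpol K a q))\<^sup>2)"
    unfolding complex_of_real_integrable_eq .
  have "complex_of_real (\<integral>q. (norm (bpol K a q))\<^sup>2 \<partial>torus) = (\<integral>q. complex_of_real ((norm (bpol K a q))\<^sup>2) \<partial>torus)"
    by (rule integral_complex_of_real[symmetric])
  also have "\<dots> = (\<Sum>k\<in>K. \<Sum>l\<in>K. (a k * cnj (a l)) * (if k = l then 1 else 0))"
    unfolding eq
    by (subst Bochner_Integration.integral_sum, intro Bochner_Integration.integrable_sum int,
        subst Bochner_Integration.integral_sum, intro int)
      (simp only: integral_mult_right_zero integral_mon)
  also have "\<dots> = (\<Sum>k\<in>K. a k * cnj (a k))"
    using K by (intro sum.cong refl) (simp add: if_distrib[of "(*) _"] cong: if_cong)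
  also have "\<dots> = complex_of_real (\<Sum>k\<in>K. (norm (a k))\<^sup>2)"
    unfolding of_real_sum complex_norm_square ..
  finally have "(\<integral>q. (norm (bpol K a q))\<^sup>2 \<partial>torus) = (\<Sum>k\<in>K. (norm (a k))\<^sup>2)"
    unfolding of_real_eq_iff .
  then show ?thesis using nn_integral_eq_integral[OF int'] by simp
qed

lemma norm_sum3_sq: "(norm (x + y + z))\<^sup>2 \<le> 3 * ((norm x)\<^sup>2 + (norm y)\<^sup>2 + (norm z)\<^sup>2)"
  for x y z :: complex
proof -
  have "(norm (x + y + z))\<^sup>2 \<le> (norm x + norm y + norm z)\<^sup>2"
    by (intro power_mono norm_triangle_le add_right_mono norm_triangle_ineq) auto
  also have "\<dots> \<le> 3 * ((norm x)\<^sup>2 + (norm y)\<^sup>2 + (norm z)\<^sup>2)"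
    using sum_squares_bound[of "norm x" "norm y"] sum_squares_bound[of "norm x" "norm z"]
      sum_squares_bound[of "norm y" "norm z"] by (simp add: power2_sum distrib_left distrib_right)
  finally show ?thesis .
qed

lemma ennreal_3_sum:
  "0 \<le> a \<Longrightarrow> 0 \<le> b \<Longrightarrow> 0 \<le> c \<Longrightarrow> ennreal (3 * (a + b + c)) = 3 * (ennreal a + ennreal b + ennreal c)"
  by (simp add: ennreal_mult ennreal_plus)

lemma l2sq_sum3:
  assumes [measurable]: "f \<in> borel_measurable borel" "g \<in> borel_measurable borel" "h \<in> borel_measurable borel"
  shows "l2sq (\<lambda>q. f q + g q + h q) \<le> 3 * (l2sq f + l2sq g + l2sq h)"
proof -
  have "l2sq (\<lambda>q. f q + g q + h q) \<le> (\<integral>\<^sup>+ q. 3 * (ennreal ((norm (f q))\<^sup>2) + ennreal ((norm (g q))\<^sup>2) + ennreal ((norm (h q))\<^sup>2)) \<partial>torus)"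
  proof (rule nn_integral_mono)
    fix q
    have "ennreal ((norm (f q + g q + h q))\<^sup>2) \<le> ennreal (3 * ((norm (f q))\<^sup>2 + (norm (g q))\<^sup>2 + (norm (h q))\<^sup>2))"
      by (intro ennreal_leI norm_sum3_sq)
    also have "\<dots> = 3 * (ennreal ((norm (f q))\<^sup>2) + ennreal ((norm (g q))\<^sup>2) + ennreal ((norm (h q))\<^sup>2))"
      by (rule ennreal_3_sum) simp_all
    finally show "ennreal ((norm (f q + g q + h q))\<^sup>2) \<le> 3 * (ennreal ((norm (f q))\<^sup>2) + ennreal ((norm (g q))\<^sup>2) + ennreal ((norm (h q))\<^sup>2))" .
  qed
  also have "\<dots> = 3 * (l2sq f + l2sq g + l2sq h)"
    by (simp add: nn_integral_cmult nn_integral_add)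
  finally show ?thesis .
qed

text \<open>Completeness of \<open>L\<^sup>2\<close> of the torus, for sequences that converge geometrically: such a
  sequence converges almost everywhere, and Fatou's lemma identifies the limit.\<close>

lemma l2_complete_fast:
  fixes p :: "nat \<Rightarrow> fun2"
  assumes meas [measurable]: "\<And>n. p n \<in> borel_measurable borel"
    and fast: "\<And>m n. n \<le> m \<Longrightarrow> l2sq (\<lambda>q. p m q - p n q) \<le> ennreal ((1/4) ^ n)"
  shows "\<exists>g\<in>borel_measurable borel. \<forall>n. l2sq (\<lambda>q. g q - p n q) \<le> ennreal ((1/4) ^ n)"
proof -
  have "(\<integral>\<^sup>+ q. (\<Sum>n. ennreal (norm (p (Suc n) q - p n q))) \<partial>torus)
      = (\<Sum>n. \<integral>\<^sup>+ q. ennreal (norm (p (Suc n) q - p n q)) \<partial>torus)"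
    by (rule nn_integral_suminf) measurable
  also have "\<dots> \<le> (\<Sum>n. ennreal ((1/2) ^ n))"
  proof (rule suminf_le)
    fix n
    have "(\<integral>\<^sup>+ q. ennreal (norm (p (Suc n) q - p n q)) \<partial>torus)
        \<le> (\<integral>\<^sup>+ q. ennreal (2 ^ n / 2) * ennreal ((norm (p (Suc n) q - p n q))\<^sup>2) + ennreal ((1/2) ^ n / 2) \<partial>torus)"
    proof (rule nn_integral_mono)
      fix q
      \<comment> \<open>by the arithmetic-geometric mean inequality for \<open>2\<^sup>n x\<^sup>2\<close> and \<open>2\<^sup>-\<^sup>n\<close>\<close>
      define x where "x = norm (p (Suc n) q - p n q)"
      have "0 \<le> (2 ^ n * x - 1)\<^sup>2" by simp
      then have "2 * (2 ^ n * x) \<le> 2 ^ n * (2 ^ n * x\<^sup>2) + 1" by (simp add: power2_eq_square algebra_simps)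
      then have "2 ^ n * (2 * x) \<le> 2 ^ n * (2 ^ n * x\<^sup>2 + (1/2) ^ n)"
        by (simp add: algebra_simps power_divide)
      then have "x \<le> 2 ^ n / 2 * x\<^sup>2 + (1/2) ^ n / 2" by simp
      then have "ennreal x \<le> ennreal (2 ^ n / 2 * x\<^sup>2 + (1/2) ^ n / 2)" by (rule ennreal_leI)
      then show "ennreal x \<le> ennreal (2 ^ n / 2) * ennreal (x\<^sup>2) + ennreal ((1/2) ^ n / 2)"
        by (subst ennreal_mult[symmetric]) (simp_all flip: ennreal_plus)
    qed
    also have "\<dots> = ennreal (2 ^ n / 2) * l2sq (\<lambda>q. p (Suc n) q - p n q) + ennreal ((1/2) ^ n / 2)"
      by (subst nn_integral_add) (simp_all add: nn_integral_cmult emeasure_torus)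
    also have "\<dots> \<le> ennreal (2 ^ n / 2) * ennreal ((1/4) ^ n) + ennreal ((1/2) ^ n / 2)"
      by (intro add_right_mono mult_left_mono fast) auto
    also have "\<dots> = ennreal (2 ^ n / 2 * (1/4) ^ n + (1/2) ^ n / 2)"
      by (subst ennreal_mult[symmetric]) (simp_all flip: ennreal_plus)
    also have "2 ^ n / 2 * (1/4) ^ n + (1/2) ^ n / 2 = (1/2 :: real) ^ n"
      by (simp add: power_divide power_mult_distrib[symmetric] field_simps)
    finally show "(\<integral>\<^sup>+ q. ennreal (norm (p (Suc n) q - p n q)) \<partial>torus) \<le> ennreal ((1/2) ^ n)" .
  qed auto
  also have "\<dots> = ennreal (\<Sum>n. (1/2) ^ n)"
    by (rule suminf_ennreal2) (auto intro: summable_geometric)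
  finally have "(\<integral>\<^sup>+ q. (\<Sum>n. ennreal (norm (p (Suc n) q - p n q))) \<partial>torus) \<noteq> \<infinity>"
    by (auto simp: top_unique)
  then have "AE q in torus. (\<Sum>n. ennreal (norm (p (Suc n) q - p n q))) \<noteq> \<infinity>"
    by (intro nn_integral_PInf_AE) auto
  then have conv: "AE q in torus. (\<lambda>n. p n q) \<longlonglongrightarrow> lim (\<lambda>n. p n q)"
  proof eventually_elim
    case (elim q)
    have "summable (\<lambda>n. norm (p (Suc n) q - p n q))"
      by (rule summable_suminf_not_top) (use elim in auto)
    then have "summable (\<lambda>n. p (Suc n) q - p n q)" by (rule summable_norm_cancel)
    then have "convergent (\<lambda>n. \<Sum>i<n. p (Suc i) q - p i q)" by (simp add: summable_iff_convergent)
    then have "convergent (\<lambda>n. p n q - p 0 q)" by (simp only: sum_lessThan_telescope[of "\<lambda>n. p n q"])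
    then have "convergent (\<lambda>n. p n q)" by (simp add: convergent_diff_const_right_iff)
    then show ?case by (simp add: convergent_LIMSEQ_iff)
  qed
  define g where "g q = lim (\<lambda>n. p n q)" for q
  have [measurable]: "g \<in> borel_measurable borel" unfolding g_def by measurable
  have "l2sq (\<lambda>q. g q - p n q) \<le> ennreal ((1/4) ^ n)" for n
  proof -
    have "l2sq (\<lambda>q. g q - p n q) \<le> (\<integral>\<^sup>+ q. liminf (\<lambda>m. ennreal ((norm (p m q - p n q))\<^sup>2)) \<partial>torus)"
    proof (rule nn_integral_mono_AE, use conv in eventually_elim)
      case (elim q)
      then have "(\<lambda>m. ennreal ((norm (p m q - p n q))\<^sup>2)) \<longlonglongrightarrow> ennreal ((norm (g q - p n q))\<^sup>2)"
        unfolding g_def by (intro tendsto_intros tendsto_ennrealI)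
      then show ?case using lim_imp_Liminf trivial_limit_sequentially by fastforce
    qed
    also have "\<dots> \<le> liminf (\<lambda>m. l2sq (\<lambda>q. p m q - p n q))"
      by (rule nn_integral_liminf) measurable
    also have "\<dots> \<le> ennreal ((1/4) ^ n)"
    proof -
      have "liminf (\<lambda>m. l2sq (\<lambda>q. p m q - p n q)) \<le> liminf (\<lambda>m::nat. ennreal ((1/4) ^ n))"
        by (rule Liminf_mono) (use fast in \<open>auto simp: eventually_sequentially\<close>)
      then show ?thesis by (simp add: Liminf_const)
    qed
    finally show ?thesis .
  qed
  then show ?thesis by (intro bexI[of _ g]) auto
qed

lemma is_boundary_iff:
  "is_boundary F g \<longleftrightarrow> g \<in> borel_measurable torus \<and> integrable torus (\<lambda>p. (norm (g p))\<^sup>2) \<and>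
     ((\<lambda>r. l2sq (\<lambda>q. F (dil r q) - g q)) \<longlongrightarrow> 0) (at_left 1)"
  by (simp add: is_boundary_def dil_def case_prod_unfold)

lemma l2sq_dil_diff_le:
  assumes F: "F \<in> H2" and r: "0 \<le> r" "r < 1"
  shows "l2sq (\<lambda>q. F (dil r q) - bpol (box n) (h2_coeffs F) (dil r q)) \<le> ennreal ((h2_norm (F - trunc n F))\<^sup>2)"
proof -
  let ?G = "F - trunc n F"
  have G: "?G \<in> H2" using F by (simp add: H2_diff)
  have tr: "trunc n F p = bpol (box n) (h2_coeffs F) p" if "p \<in> bidisk" for p
  proof -
    have "((\<lambda>k. h2_coeffs (trunc n F) k * mon k p) has_sum trunc n F p) UNIV"
      by (rule H2_has_sum[OF trunc_in_H2 that])
    moreover have "((\<lambda>k. h2_coeffs (trunc n F) k * mon k p) has_sum bpol (box n) (h2_coeffs F) p) UNIV"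
      unfolding trunc_def h2_coeffs_pol[OF finite_box] bpol_def
      by (rule has_sum_finite_neutralI[of "box n"]) auto
    ultimately show ?thesis by (rule has_sum_unique)
  qed
  have "l2sq (\<lambda>q. F (dil r q) - bpol (box n) (h2_coeffs F) (dil r q)) = l2sq (\<lambda>q. ?G (dil r q))"
    by (rule nn_integral_cong_AE, use AE_torus in eventually_elim) (simp add: tr dil_bidisk r del: mem_Times_iff)
  also have "\<dots> = ennreal (\<integral>q. (norm (?G (dil r q)))\<^sup>2 \<partial>torus)"
    by (rule nn_integral_eq_integral[OF dilation_norm_integrable[OF H2_power_series[OF G] r]]) simp
  also have "\<dots> \<le> ennreal ((h2_norm ?G)\<^sup>2)"
    by (rule ennreal_leI[OF dilation_norm_le[OF G r]])
  finally show ?thesis .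
qed

text \<open>The boundary function is the \<open>L\<^sup>2\<close> limit \<open>g\<close> of truncations \<open>p\<^sub>n\<close> of the series, so large that
  the remainders decrease geometrically. A dilation \<open>F\<^sub>r\<close> is close to \<open>g\<close> because \<open>F\<^sub>r\<close> is close to
  the dilation of \<open>p\<^sub>n\<close> uniformly in \<open>r\<close>, and the latter tends to \<open>p\<^sub>n\<close> for \<open>r \<rightarrow> 1\<close>.\<close>

lemma boundary_exists:
  assumes F: "F \<in> H2"
  shows "\<exists>g. is_boundary F g"
proof -
  let ?a = "h2_coeffs F"
  let ?err = "\<lambda>n. (h2_norm F)\<^sup>2 - (\<Sum>k\<in>box n. (norm (?a k))\<^sup>2)"
  note [measurable] = power_series_measurable[OF H2_power_series[OF F]]
  have sum_le: "(\<Sum>k\<in>K. (norm (?a k))\<^sup>2) \<le> (h2_norm F)\<^sup>2" if "finite K" for K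
    by (rule finite_sum_le_has_sum[OF norm_coeffs_sums[OF F]]) (use that in auto)
  have "?err \<longlonglongrightarrow> (h2_norm F)\<^sup>2 - (h2_norm F)\<^sup>2"
    by (intro tendsto_intros has_sum_box norm_coeffs_sums F)
  then have err0: "?err \<longlonglongrightarrow> 0" by simp
  have "\<exists>N. ?err N < (1/4) ^ n" for n
  proof -
    have "\<forall>\<^sub>F N in sequentially. ?err N < (1/4) ^ n" using order_tendstoD(2)[OF err0] by simp
    then show ?thesis by (auto simp: eventually_sequentially)
  qed
  then obtain M where M: "\<And>n. ?err (M n) < (1/4) ^ n" by metis
  \<comment> \<open>increasing truncation orders, so that differences of truncations are again partial sums\<close>
  define N where "N n = Max (M ` {..n})" for n
  have N_mono: "N n \<le> N m" if "n \<le> m" for n m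
    unfolding N_def using that by (intro Max_mono) auto
  have NM: "M n \<le> N n" for n unfolding N_def by (intro Max_ge) auto
  have errN: "?err (N n) \<le> (1/4) ^ n" for n
  proof -
    have "(\<Sum>k\<in>box (M n). (norm (?a k))\<^sup>2) \<le> (\<Sum>k\<in>box (N n). (norm (?a k))\<^sup>2)"
      by (intro sum_mono2 box_mono NM) auto
    then show ?thesis using M[of n] by linarith
  qed
  define p where "p n = bpol (box (N n)) ?a" for n
  have [measurable]: "p n \<in> borel_measurable borel" for n unfolding p_def by measurable
  have "\<exists>g\<in>borel_measurable borel. \<forall>n. l2sq (\<lambda>q. g q - p n q) \<le> ennreal ((1/4) ^ n)"
  proof (rule l2_complete_fast)
    fix m n :: nat assume "n \<le> m"
    then have sub: "box (N n) \<subseteq> box (N m)" by (intro box_mono N_mono)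
    have "p m q - p n q = bpol (box (N m) - box (N n)) ?a q" for q
      unfolding p_def bpol_def using sub by (simp add: sum_diff)
    then have "l2sq (\<lambda>q. p m q - p n q) = ennreal (\<Sum>k\<in>box (N m) - box (N n). (norm (?a k))\<^sup>2)"
      by (simp add: l2sq_bpol)
    also have "\<dots> \<le> ennreal ((1/4) ^ n)"
      using sum_le[of "box (N m)"] errN[of n] sub by (intro ennreal_leI) (simp add: sum_diff)
    finally show "l2sq (\<lambda>q. p m q - p n q) \<le> ennreal ((1/4) ^ n)" .
  qed measurable
  then obtain g where [measurable]: "g \<in> borel_measurable borel"
    and g: "\<And>n. l2sq (\<lambda>q. g q - p n q) \<le> ennreal ((1/4) ^ n)" by blast
  have int: "integrable torus (\<lambda>q. (norm (g q))\<^sup>2)"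
  proof (rule integrableI_bounded)
    have "l2sq g = l2sq (\<lambda>q. (g q - p 0 q) + p 0 q + 0)" by simp
    also have "\<dots> \<le> 3 * (l2sq (\<lambda>q. g q - p 0 q) + l2sq (p 0) + l2sq (\<lambda>q. 0))"
      by (rule l2sq_sum3) measurable
    also have "\<dots> < \<infinity>"
    proof -
      have "l2sq (\<lambda>q. g q - p 0 q) < \<infinity>" using g[of 0] by (simp add: order_le_less_trans)
      moreover have "l2sq (p 0) < \<infinity>" by (simp add: p_def l2sq_bpol)
      ultimately show ?thesis by (simp add: ennreal_mult_less_top)
    qed
    finally show "(\<integral>\<^sup>+ q. ennreal (norm ((norm (g q))\<^sup>2)) \<partial>torus) < \<infinity>" by simp
  qed measurable
  have "((\<lambda>r. l2sq (\<lambda>q. F (dil r q) - g q)) \<longlongrightarrow> 0) (at_left 1)"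
  proof (rule order_tendstoI)
    fix e :: ennreal assume e: "0 < e"
    obtain e' :: real where e': "0 < e'" "ennreal e' \<le> e"
    proof (cases e)
      case (real x)
      then show ?thesis using e that[of x] by simp
    next
      case top
      then show ?thesis using that[of 1] by simp
    qed
    \<comment> \<open>three error terms, each below \<open>e' / 9\<close>, and the factor 3 of \<open>l2sq_sum3\<close>\<close>
    have "(\<lambda>n. (1/4 :: real) ^ n) \<longlonglongrightarrow> 0" by (intro LIMSEQ_power_zero) auto
    then have "\<forall>\<^sub>F n in sequentially. (1/4 :: real) ^ n < e' / 9"
      using e' by (intro order_tendstoD) auto
    then obtain n where n: "(1/4 :: real) ^ n < e' / 9" by (auto simp: eventually_sequentially)
    let ?s = "\<lambda>r::real. \<Sum>k\<in>box (N n). (norm (?a k))\<^sup>2 * (r ^ degr k - 1)\<^sup>2"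
    have "(?s \<longlongrightarrow> (\<Sum>k\<in>box (N n). (norm (?a k))\<^sup>2 * (1 ^ degr k - 1)\<^sup>2)) (at_left 1)"
      by (intro tendsto_intros)
    then have "\<forall>\<^sub>F r in at_left 1. ?s r < e' / 9" using e' by (intro order_tendstoD) auto
    moreover have "\<forall>\<^sub>F r in at_left 1. r \<in> {0<..<1::real}"
      by (rule eventually_at_leftI[of 0]) auto
    ultimately show "\<forall>\<^sub>F r in at_left 1. l2sq (\<lambda>q. F (dil r q) - g q) < e"
    proof eventually_elim
      case (elim r)
      then have r: "0 \<le> r" "r < 1" by auto
      have 1: "l2sq (\<lambda>q. F (dil r q) - p n (dil r q)) \<le> ennreal ((1/4) ^ n)"
        using l2sq_dil_diff_le[OF F r, of "N n"] errN[of n]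
        unfolding p_def norm_diff_trunc[OF F] by (meson ennreal_leI order_trans)
      have "p n (dil r q) - p n q = bpol (box (N n)) (\<lambda>k. ?a k * of_real (r ^ degr k - 1)) q" for q
        unfolding p_def bpol_def sum_subtractf[symmetric] mon_dil by (simp add: algebra_simps)
      then have 2: "l2sq (\<lambda>q. p n (dil r q) - p n q) = ennreal (?s r)"
        by (simp only: l2sq_bpol[OF finite_box] norm_mult power_mult_distrib norm_of_real power2_abs)
      have 3: "l2sq (\<lambda>q. p n q - g q) \<le> ennreal ((1/4) ^ n)"
        using g[of n] by (simp only: norm_minus_commute)
      have "l2sq (\<lambda>q. F (dil r q) - g q)
          = l2sq (\<lambda>q. (F (dil r q) - p n (dil r q)) + (p n (dil r q) - p n q) + (p n q - g q))" by simp
      also have "\<dots> \<le> 3 * (l2sq (\<lambda>q. F (dil r q) - p n (dil r q)) + l2sq (\<lambda>q. p n (dil r q) - p n q) + l2sq (\<lambda>q. p n q - g q))"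
        by (rule l2sq_sum3) measurable
      also have "\<dots> \<le> 3 * (ennreal ((1/4) ^ n) + ennreal (?s r) + ennreal ((1/4) ^ n))"
        using 1 2 3 by (intro mult_left_mono add_mono) auto
      also have "\<dots> = ennreal (3 * ((1/4) ^ n + ?s r + (1/4) ^ n))"
        by (rule ennreal_3_sum[symmetric]) (auto intro: sum_nonneg)
      also have "\<dots> < ennreal e'" using n elim(1) e'(1) by (intro ennreal_lessI) auto
      finally show ?case using e'(2) by simp
    qed
  qed simp
  then show ?thesis using int unfolding is_boundary_iff by (intro exI[of _ g]) auto
qed

lemma is_boundary_boundary: "is_boundary F g \<Longrightarrow> is_boundary F (boundary F)"
  unfolding boundary_def by (rule someI[of "is_boundary F"])

lemma is_boundary_cnj: "is_boundary F g \<Longrightarrow> is_boundary (\<lambda>q. cnj (F q)) (\<lambda>q. cnj (g q))"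
  unfolding is_boundary_iff complex_cnj_diff[symmetric] complex_mod_cnj
  using measurable_compose[OF _ cnj_measurable, of g torus] by blast

subsection \<open>The boundary inner product\<close>

lemma l2_Cauchy_Schwarz:
  assumes [measurable]: "f \<in> borel_measurable borel" "g \<in> borel_measurable borel"
    and f: "integrable torus (\<lambda>q. (norm (f q))\<^sup>2)" and g: "integrable torus (\<lambda>q. (norm (g q))\<^sup>2)"
  shows "integrable torus (\<lambda>q. f q * g q)"
    and "(norm (\<integral>q. f q * g q \<partial>torus))\<^sup>2 \<le> enn2real (l2sq f) * enn2real (l2sq g)"
proof -
  have fin: "l2sq f < \<infinity>" "l2sq g < \<infinity>"
    using nn_integral_eq_integral[OF f] nn_integral_eq_integral[OF g] by auto
  have le: "(\<integral>\<^sup>+ q. ennreal (norm (f q * g q)) \<partial>torus)\<^sup>2 \<le> l2sq f * l2sq g"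
    using Cauchy_Schwarz_nn_integral[of "\<lambda>q. ennreal (norm (f q))" torus "\<lambda>q. ennreal (norm (g q))"]
    by (simp add: norm_mult ennreal_mult ennreal_power)
  have "(\<integral>\<^sup>+ q. ennreal (norm (f q * g q)) \<partial>torus)\<^sup>2 < \<infinity>"
    using le fin by (simp add: ennreal_mult_less_top order_le_less_trans)
  then have "(\<integral>\<^sup>+ q. ennreal (norm (f q * g q)) \<partial>torus) < \<infinity>"
    by (cases "(\<integral>\<^sup>+ q. ennreal (norm (f q * g q)) \<partial>torus)") (auto simp: power2_eq_square ennreal_mult_top)
  then show int: "integrable torus (\<lambda>q. f q * g q)" by (intro integrableI_bounded) auto
  have "(norm (\<integral>q. f q * g q \<partial>torus))\<^sup>2 \<le> (\<integral>q. norm (f q * g q) \<partial>torus)\<^sup>2"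
    by (intro power_mono integral_norm_bound) auto
  also have "\<dots> \<le> enn2real (l2sq f * l2sq g)"
  proof -
    have "ennreal ((\<integral>q. norm (f q * g q) \<partial>torus)\<^sup>2) \<le> l2sq f * l2sq g"
      using le nn_integral_eq_integral[OF integrable_norm[OF int]] by (simp add: ennreal_power)
    moreover have "l2sq f * l2sq g < \<infinity>" using fin by (simp add: ennreal_mult_less_top)
    ultimately show ?thesis using enn2real_mono[of "ennreal ((\<integral>q. norm (f q * g q) \<partial>torus)\<^sup>2)"] by simp
  qed
  finally show "(norm (\<integral>q. f q * g q \<partial>torus))\<^sup>2 \<le> enn2real (l2sq f) * enn2real (l2sq g)"
    by (simp add: enn2real_mult)
qed

lemma l2_integrable_diff:
  assumes [measurable]: "f \<in> borel_measurable borel" "g \<in> borel_measurable borel"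
    and f: "integrable torus (\<lambda>q. (norm (f q))\<^sup>2)" and g: "integrable torus (\<lambda>q. (norm (g q))\<^sup>2)"
  shows "integrable torus (\<lambda>q. (norm (f q - g q :: complex))\<^sup>2)"
proof (rule Bochner_Integration.integrable_bound)
  show "integrable torus (\<lambda>q. 3 * ((norm (f q))\<^sup>2 + (norm (g q))\<^sup>2))"
    by (intro integrable_mult_right Bochner_Integration.integrable_add f g)
  show "AE q in torus. norm ((norm (f q - g q))\<^sup>2) \<le> norm (3 * ((norm (f q))\<^sup>2 + (norm (g q))\<^sup>2))"
    using norm_sum3_sq[of "f _" "- g _" 0] by (intro AE_I2) simp
qed measurable

text \<open>The integrals of \<open>F\<^sub>r cnj G\<^sub>r\<close> converge to both sides: to the left by continuity of the \<open>L\<^sup>2\<close>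
  pairing, to the right by \<open>dilation_inner_tendsto\<close>.\<close>

lemma integral_boundary:
  assumes F: "F \<in> H2" and G: "G \<in> H2"
  shows "(\<integral>q. boundary (\<lambda>q. cnj (G q)) q * boundary F q \<partial>torus) = h2_inner F G"
proof -
  define g where "g = boundary F"
  define h where "h = boundary (\<lambda>q. cnj (G q))"
  have "is_boundary F g" unfolding g_def using boundary_exists[OF F] is_boundary_boundary by blast
  then have [measurable]: "g \<in> borel_measurable borel" and g: "integrable torus (\<lambda>q. (norm (g q))\<^sup>2)"
    "((\<lambda>r. l2sq (\<lambda>q. F (dil r q) - g q)) \<longlongrightarrow> 0) (at_left 1)" by (auto simp: is_boundary_iff)
  have "is_boundary (\<lambda>q. cnj (G q)) h"
  proof -
    obtain g' where "is_boundary G g'" using boundary_exists[OF G] by blast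
    from is_boundary_boundary[OF is_boundary_cnj[OF this]] show ?thesis by (simp only: h_def)
  qed
  then have [measurable]: "h \<in> borel_measurable borel" and h: "integrable torus (\<lambda>q. (norm (h q))\<^sup>2)"
    "((\<lambda>r. l2sq (\<lambda>q. cnj (G (dil r q)) - h q)) \<longlongrightarrow> 0) (at_left 1)" by (auto simp: is_boundary_iff)
  note [measurable] = power_series_measurable[OF H2_power_series[OF F]] power_series_measurable[OF H2_power_series[OF G]]
  let ?I = "\<integral>q. h q * g q \<partial>torus"
  let ?J = "\<lambda>r. \<integral>q. F (dil r q) * cnj (G (dil r q)) \<partial>torus"
  let ?u = "\<lambda>r. enn2real (l2sq (\<lambda>q. cnj (G (dil r q)) - h q))"
  let ?v = "\<lambda>r. enn2real (l2sq (\<lambda>q. F (dil r q) - g q))"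
  have u0: "(?u \<longlongrightarrow> 0) (at_left 1)" and v0: "(?v \<longlongrightarrow> 0) (at_left 1)"
    using tendsto_enn2real[of 0, OF _ ] h(2) g(2) by (force intro: tendsto_enn2real)+
  have bound: "norm (?J r - ?I) \<le> sqrt ((h2_norm G)\<^sup>2 * ?v r) + sqrt (?u r * enn2real (l2sq g))"
    if r: "r \<in> {0<..<1}" for r :: real
  proof -
    have r': "0 \<le> r" "r < 1" using r by auto
    let ?f = "\<lambda>q. F (dil r q)" and ?k = "\<lambda>q. cnj (G (dil r q))"
    have f: "integrable torus (\<lambda>q. (norm (?f q))\<^sup>2)"
      by (rule dilation_norm_integrable[OF H2_power_series[OF F] r'])
    have k: "integrable torus (\<lambda>q. (norm (?k q))\<^sup>2)"
      using dilation_norm_integrable[OF H2_power_series[OF G] r'] by simp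
    have kG: "enn2real (l2sq ?k) \<le> (h2_norm G)\<^sup>2"
    proof -
      have "l2sq ?k = ennreal (\<integral>q. (norm (G (dil r q)))\<^sup>2 \<partial>torus)"
        using nn_integral_eq_integral[OF k] by simp
      then show ?thesis using dilation_norm_le[OF G r'] by simp
    qed
    note fg = l2_integrable_diff[OF _ _ f g(1)] and kh = l2_integrable_diff[OF _ _ k h(1)]
    have "?J r - ?I = (\<integral>q. ?k q * (?f q - g q) \<partial>torus) + (\<integral>q. (?k q - h q) * g q \<partial>torus)"
    proof -
      have "integrable torus (\<lambda>q. ?k q * (?f q - g q))" "integrable torus (\<lambda>q. (?k q - h q) * g q)"
        by (intro l2_Cauchy_Schwarz fg kh k g; measurable)+
      then have "(\<integral>q. ?k q * (?f q - g q) \<partial>torus) + (\<integral>q. (?k q - h q) * g q \<partial>torus)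
        = (\<integral>q. ?k q * (?f q - g q) + (?k q - h q) * g q \<partial>torus)"
        by (rule Bochner_Integration.integral_add[symmetric])
      also have "\<dots> = (\<integral>q. ?f q * ?k q - h q * g q \<partial>torus)"
        by (simp add: algebra_simps)
      also have "\<dots> = ?J r - ?I"
        by (intro Bochner_Integration.integral_diff l2_Cauchy_Schwarz f k h g; measurable)
      finally show ?thesis by simp
    qed
    also have "norm \<dots> \<le> sqrt ((h2_norm G)\<^sup>2 * ?v r) + sqrt (?u r * enn2real (l2sq g))"
    proof (rule norm_triangle_le, rule add_mono)
      have "(norm (\<integral>q. ?k q * (?f q - g q) \<partial>torus))\<^sup>2 \<le> enn2real (l2sq ?k) * ?v r"
        by (intro l2_Cauchy_Schwarz fg k; measurable)
      also have "\<dots> \<le> (h2_norm G)\<^sup>2 * ?v r" using kG by (intro mult_right_mono) auto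
      finally show "norm (\<integral>q. ?k q * (?f q - g q) \<partial>torus) \<le> sqrt ((h2_norm G)\<^sup>2 * ?v r)"
        by (rule real_le_rsqrt)
      have "(norm (\<integral>q. (?k q - h q) * g q \<partial>torus))\<^sup>2 \<le> ?u r * enn2real (l2sq g)"
        by (intro l2_Cauchy_Schwarz kh g; measurable)
      then show "norm (\<integral>q. (?k q - h q) * g q \<partial>torus) \<le> sqrt (?u r * enn2real (l2sq g))"
        by (rule real_le_rsqrt)
    qed
    finally show ?thesis .
  qed
  have "((\<lambda>r. sqrt ((h2_norm G)\<^sup>2 * ?v r) + sqrt (?u r * enn2real (l2sq g))) \<longlongrightarrow> 
      sqrt ((h2_norm G)\<^sup>2 * 0) + sqrt (0 * enn2real (l2sq g))) (at_left 1)"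
    by (intro tendsto_intros u0 v0)
  then have lim: "((\<lambda>r. sqrt ((h2_norm G)\<^sup>2 * ?v r) + sqrt (?u r * enn2real (l2sq g))) \<longlongrightarrow> 0) (at_left 1)"
    by simp
  have "\<forall>\<^sub>F r in at_left 1. norm (?J r - ?I) \<le> sqrt ((h2_norm G)\<^sup>2 * ?v r) + sqrt (?u r * enn2real (l2sq g))"
    by (rule eventually_at_leftI[of 0, OF bound]) simp_all
  then have "((\<lambda>r. ?J r - ?I) \<longlongrightarrow> 0) (at_left 1)"
    using lim by (rule Lim_null_comparison)
  then have "(?J \<longlongrightarrow> ?I) (at_left 1)" by (simp add: Lim_null[symmetric])
  from tendsto_unique[OF _ this dilation_inner_tendsto[OF F G]]
  show ?thesis unfolding g_def h_def by simp
qed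

section \<open>Isometric multipliers\<close>

text \<open>Coordinate functions and inner functions are multipliers of this kind.\<close>

definition isom_mult :: "fun2 \<Rightarrow> bool" where
  "isom_mult \<tau> \<longleftrightarrow> (\<forall>f\<in>H2. \<tau> * f \<in> H2 \<and> h2_norm (\<tau> * f) = h2_norm f)"

lemma isom_mult_in_H2: "isom_mult \<tau> \<Longrightarrow> f \<in> H2 \<Longrightarrow> \<tau> * f \<in> H2"
  and isom_mult_norm: "isom_mult \<tau> \<Longrightarrow> f \<in> H2 \<Longrightarrow> h2_norm (\<tau> * f) = h2_norm f"
  by (auto simp: isom_mult_def)

lemma mult_cscale: "\<tau> * cscale c f = cscale c (\<tau> * f)"
  by (simp add: fun_eq_iff)

text \<open>By polarization; the imaginary part comes from replacing \<open>f\<close> by \<open>- \<i> f\<close>.\<close>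

lemma inner_isom_mult:
  assumes \<tau>: "isom_mult \<tau>" and f: "f \<in> H2" and g: "g \<in> H2"
  shows "h2_inner (\<tau> * f) (\<tau> * g) = h2_inner f g"
proof -
  have re: "Re (h2_inner (\<tau> * f) (\<tau> * g)) = Re (h2_inner f g)" if f: "f \<in> H2" and g: "g \<in> H2" for f g
  proof -
    have "(h2_norm (\<tau> * f + \<tau> * g))\<^sup>2 = (h2_norm (f + g))\<^sup>2"
      using isom_mult_norm[OF \<tau> H2_add[OF f g]] by (simp add: distrib_left)
    then show ?thesis
      using f g by (simp add: norm_add_sq isom_mult_in_H2[OF \<tau>] isom_mult_norm[OF \<tau>])
  qed
  have "Re (h2_inner (\<tau> * cscale (- \<i>) f) (\<tau> * g)) = Re (h2_inner (cscale (- \<i>) f) g)"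
    by (rule re[OF H2_cscale[OF f] g])
  then have "Im (h2_inner (\<tau> * f) (\<tau> * g)) = Im (h2_inner f g)"
    unfolding mult_cscale inner_cscale_left[OF f] inner_cscale_left[OF isom_mult_in_H2[OF \<tau> f]] by simp
  then show ?thesis using re[OF f g] by (simp add: complex_eq_iff)
qed

lemma isom_mult_one [simp]: "isom_mult 1"
  by (simp add: isom_mult_def)

lemma isom_mult_mult: "isom_mult \<sigma> \<Longrightarrow> isom_mult \<tau> \<Longrightarrow> isom_mult (\<sigma> * \<tau>)"
  by (simp add: isom_mult_def mult.assoc)

lemma isom_mult_power: "isom_mult \<tau> \<Longrightarrow> isom_mult (\<tau> ^ n)"
  by (induction n) (simp_all add: isom_mult_mult)

lemma fun_power_apply: "(f ^ n) x = f x ^ n"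
  for f :: "'a \<Rightarrow> 'b :: comm_ring_1"
  by (induction n) simp_all

text \<open>All powers of \<open>\<tau>\<close> are isometric multipliers, so they stay bounded at each point, because
  evaluation is continuous.\<close>

lemma isom_mult_le_1:
  assumes \<tau>: "isom_mult \<tau>" and p: "p \<in> bidisk"
  shows "norm (\<tau> p) \<le> 1"
proof (rule ccontr)
  assume "\<not> norm (\<tau> p) \<le> 1"
  then have gt: "1 < norm (\<tau> p)" by simp
  have "norm (\<tau> p) ^ n \<le> h2_norm (szego p)" for n
  proof -
    have "norm ((\<tau> ^ n * emon (0, 0)) p) \<le> h2_norm (\<tau> ^ n * emon (0, 0)) * h2_norm (szego p)"
      by (rule norm_eval_le[OF isom_mult_in_H2[OF isom_mult_power[OF \<tau>] emon_in_H2] p])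
    moreover have "emon (0, 0) p = 1" using p by (simp add: emon_def del: mem_Times_iff)
    ultimately show ?thesis
      by (simp add: fun_power_apply norm_power isom_mult_norm[OF isom_mult_power[OF \<tau>]])
  qed
  moreover obtain n where "h2_norm (szego p) < norm (\<tau> p) ^ n"
    using real_arch_pow[OF gt] by blast
  ultimately show False by (meson not_le)
qed

lemma has_sum_shift:
  fixes l :: "nat \<times> nat"
  assumes "(g has_sum s) UNIV"
  shows "((\<lambda>k. if fst l \<le> fst k \<and> snd l \<le> snd k then g (fst k - fst l, snd k - snd l) else 0) has_sum s) UNIV"
    (is "(?g has_sum s) UNIV")
proof -
  let ?h = "\<lambda>k :: nat \<times> nat. (fst l + fst k, snd l + snd k)"
  have inj: "inj ?h" by (auto simp: inj_on_def)
  have "?g \<circ> ?h = g" by (auto simp: fun_eq_iff)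
  then have "(?g has_sum s) (range ?h)"
    using has_sum_reindex[OF inj, of ?g s] assms by simp
  moreover have "?g k = 0" if "k \<notin> range ?h" for k
  proof (rule ccontr)
    assume "?g k \<noteq> 0"
    then have "k = ?h (fst k - fst l, snd k - snd l)" by (auto split: if_splits)
    then show False using that by blast
  qed
  ultimately show ?thesis
    using has_sum_cong_neutral[of UNIV "range ?h" ?g ?g s] by simp
qed

lemma isom_mult_mon: "isom_mult (mon l)"
  unfolding isom_mult_def
proof (intro ballI conjI)
  fix f assume f: "f \<in> H2"
  define b where "b k = (if fst l \<le> fst k \<and> snd l \<le> snd k then h2_coeffs f (fst k - fst l, snd k - snd l) else 0)" for k
  have nb: "(norm (b k))\<^sup>2 = (if fst l \<le> fst k \<and> snd l \<le> snd k then (norm (h2_coeffs f (fst k - fst l, snd k - snd l)))\<^sup>2 else 0)" for k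
    by (simp add: b_def)
  have sum: "((\<lambda>k. (norm (b k))\<^sup>2) has_sum (h2_norm f)\<^sup>2) UNIV"
    unfolding nb by (rule has_sum_shift[OF norm_coeffs_sums[OF f]])
  have "has_h2_coeffs (mon l * f) b"
    unfolding has_h2_coeffs_iff
  proof (intro conjI ballI allI impI)
    show "ell2 b" using sum by (auto simp: ell2_def summable_on_def)
    fix p
    show "(mon l * f) p = 0" if "p \<notin> bidisk" using H2_outside[OF f that] by simp
    assume p: "p \<in> bidisk"
    have "((\<lambda>k. mon l p * (h2_coeffs f k * mon k p)) has_sum mon l p * f p) UNIV"
      by (rule has_sum_cmult_right[OF H2_has_sum[OF f p]])
    from has_sum_shift[OF this, of l]
    have "((\<lambda>k. if fst l \<le> fst k \<and> snd l \<le> snd k then mon l p *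
        (h2_coeffs f (fst k - fst l, snd k - snd l) * mon (fst k - fst l, snd k - snd l) p) else 0)
        has_sum mon l p * f p) UNIV" .
    moreover have "(if fst l \<le> fst k \<and> snd l \<le> snd k then mon l p *
        (h2_coeffs f (fst k - fst l, snd k - snd l) * mon (fst k - fst l, snd k - snd l) p) else 0)
        = b k * mon k p" for k
    proof (cases "fst l \<le> fst k \<and> snd l \<le> snd k")
      case True
      then have "mon k p = mon l p * mon (fst k - fst l, snd k - snd l) p"
        using power_add[of "fst p" "fst l" "fst k - fst l"] power_add[of "snd p" "snd l" "snd k - snd l"]
        by (simp add: mon_def)
      then show ?thesis using True by (simp add: b_def)
    qed (auto simp: b_def)
    ultimately show "((\<lambda>k. b k * mon k p) has_sum (mon l * f) p) UNIV" by simp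
  qed
  then show "mon l * f \<in> H2" by (rule H2_I)
  have "(h2_norm (mon l * f))\<^sup>2 = (h2_norm f)\<^sup>2"
    unfolding norm_sq_eq_infsum[of "mon l * f"] h2_coeffs_eqI[OF \<open>has_h2_coeffs (mon l * f) b\<close>]
    using sum by (rule infsumI)
  then show "h2_norm (mon l * f) = h2_norm f" by simp
qed

lemma mult_z_eq: "mult_z f = fst * f"
  and mult_w_eq: "mult_w f = snd * f"
  by (auto simp: mult_z_def mult_w_def fun_eq_iff)

lemma isom_mult_fst: "isom_mult fst"
  and isom_mult_snd: "isom_mult snd"
proof -
  have "mon (1, 0) = fst" "mon (0, 1) = snd" by (auto simp: mon_def fun_eq_iff)
  then show "isom_mult fst" "isom_mult snd" using isom_mult_mon by metis+
qed

section \<open>The core operator of a submodule\<close>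

lemma bounded_op_isom_mult:
  assumes V: "closed_subspace V" and \<tau>: "isom_mult \<tau>" and inv: "\<And>f. f \<in> V \<Longrightarrow> \<tau> * f \<in> V"
  shows "bounded_op V ((*) \<tau>)"
  unfolding bounded_op_def
proof (intro conjI ballI allI)
  show "\<exists>C. \<forall>f\<in>V. h2_norm (\<tau> * f) \<le> C * h2_norm f"
    using isom_mult_norm[OF \<tau> closed_subspaceD(1)[OF V]] by (intro exI[of _ 1]) simp
qed (simp_all add: inv distrib_left mult_cscale)

locale invariant_subspace =
  fixes M :: "fun2 set"
  assumes submodule: "submodule M"
begin

lemma closed: "closed_subspace M"
  using submodule by (simp add: submodule_def closed_subspace_def)

lemmas in_H2 = closed_subspaceD(1)[OF closed]
  and zero_in = closed_subspaceD(2)[OF closed]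
  and add_in = closed_subspaceD(3)[OF closed]
  and diff_in = closed_subspaceD(4)[OF closed]
  and cscale_in = closed_subspaceD(5)[OF closed]

lemma mult_z_in: "f \<in> M \<Longrightarrow> mult_z f \<in> M" and mult_w_in: "f \<in> M \<Longrightarrow> mult_w f \<in> M"
  using submodule by (auto simp: submodule_def)

lemma bounded_op_z: "bounded_op M mult_z" and bounded_op_w: "bounded_op M mult_w"
proof -
  have z: "mult_z = (*) fst" by (rule ext) (rule mult_z_eq)
  show "bounded_op M mult_z"
    unfolding z using mult_z_in unfolding mult_z_eq by (rule bounded_op_isom_mult[OF closed isom_mult_fst])
  have w: "mult_w = (*) snd" by (rule ext) (rule mult_w_eq)
  show "bounded_op M mult_w"
    unfolding w using mult_w_in unfolding mult_w_eq by (rule bounded_op_isom_mult[OF closed isom_mult_snd])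
qed

abbreviation zs where "zs \<equiv> adj M mult_z"
abbreviation ws where "ws \<equiv> adj M mult_w"

lemmas zs_in = adj_in[OF closed bounded_op_z]
  and ws_in = adj_in[OF closed bounded_op_w]
  and inner_z = inner_adj[OF closed bounded_op_z]
  and inner_w = inner_adj[OF closed bounded_op_w]
  and inner_zs = inner_adj_left[OF closed bounded_op_z]
  and inner_ws = inner_adj_left[OF closed bounded_op_w]

lemmas in_simps = zs_in ws_in mult_z_in mult_w_in zero_in add_in diff_in cscale_in
lemmas inner_simps = inner_diff_left inner_diff_right inner_add_left inner_add_right

lemma eqI: "f \<in> M \<Longrightarrow> g \<in> M \<Longrightarrow> (\<And>h. h \<in> M \<Longrightarrow> h2_inner f h = h2_inner g h) \<Longrightarrow> f = g"
  by (rule eq_of_inner_eq[OF closed])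

lemma zs_diff: "f \<in> M \<Longrightarrow> g \<in> M \<Longrightarrow> zs (f - g) = zs f - zs g"
  by (rule eqI) (simp_all add: in_simps in_H2 inner_simps inner_zs)

lemma zs_z: "f \<in> M \<Longrightarrow> zs (mult_z f) = f"
  by (rule eqI)
    (simp_all add: in_simps inner_zs, simp add: mult_z_eq inner_isom_mult isom_mult_fst in_H2)

lemma ws_w: "f \<in> M \<Longrightarrow> ws (mult_w f) = f"
  by (rule eqI)
    (simp_all add: in_simps inner_ws, simp add: mult_w_eq inner_isom_mult isom_mult_snd in_H2)

lemma mult_zw_commute: "mult_z (mult_w f) = mult_w (mult_z f)"
  by (simp add: mult_z_eq mult_w_eq mult.left_commute)

lemma zs_ws_commute: "f \<in> M \<Longrightarrow> zs (ws f) = ws (zs f)"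
  by (rule eqI) (simp_all add: in_simps inner_ws inner_zs mult_zw_commute)

lemma mult_z_diff: "mult_z (f - g) = mult_z f - mult_z g"
  by (simp add: mult_z_eq right_diff_distrib)

lemma norm_mult_z: "f \<in> M \<Longrightarrow> h2_norm (mult_z f) = h2_norm f"
  and norm_mult_w: "f \<in> M \<Longrightarrow> h2_norm (mult_w f) = h2_norm f"
  by (simp_all add: mult_z_eq mult_w_eq isom_mult_norm isom_mult_fst isom_mult_snd in_H2)

subsection \<open>The reproducing kernel and the integral formula\<close>

text \<open>For \<open>p\<close> in the bidisk this is the projection of the Szego kernel to \<open>M\<close>; outside, where all
  functions vanish, it is 0.\<close>

lemma rep_kernel:
  shows rep_kernel_in: "rep_kernel M p \<in> M"
    and inner_rep_kernel: "f \<in> M \<Longrightarrow> h2_inner f (rep_kernel M p) = f p"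
proof -
  have ex: "\<exists>k. k \<in> M \<and> (\<forall>f\<in>M. f p = h2_inner f k)"
  proof (cases "p \<in> bidisk")
    case True
    have "f p = h2_inner f (proj M (szego p))" if "f \<in> M" for f
      using that True by (simp add: inner_proj_right[OF closed szego_in_H2] inner_szego in_H2 del: mem_Times_iff)
    then show ?thesis using proj_in[OF closed szego_in_H2[OF True]] by blast
  next
    case False
    then show ?thesis using H2_outside[OF in_H2] zero_in by (intro exI[of _ 0]) (simp del: mem_Times_iff)
  qed
  have "\<exists>!k. k \<in> M \<and> (\<forall>f\<in>M. f p = h2_inner f k)"
  proof (rule ex_ex1I[OF ex])
    fix k k' assume k: "k \<in> M \<and> (\<forall>f\<in>M. f p = h2_inner f k)" "k' \<in> M \<and> (\<forall>f\<in>M. f p = h2_inner f k')"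
    show "k = k'"
    proof (rule eqI)
      fix h assume "h \<in> M"
      then have "h2_inner h k = h2_inner h k'" using k by metis
      then show "h2_inner k h = h2_inner k' h" by (metis inner_cnj)
    qed (use k in auto)
  qed
  from theI'[OF this] have *: "rep_kernel M p \<in> M \<and> (\<forall>f\<in>M. f p = h2_inner f (rep_kernel M p))"
    unfolding rep_kernel_def .
  then show "rep_kernel M p \<in> M" "f \<in> M \<Longrightarrow> h2_inner f (rep_kernel M p) = f p" by auto
qed

lemma rep_kernel_eqI:
  assumes "k \<in> M" "\<And>f. f \<in> M \<Longrightarrow> h2_inner f k = f p"
  shows "rep_kernel M p = k"
proof (rule eqI)
  fix h assume "h \<in> M"
  then have "h2_inner h (rep_kernel M p) = h2_inner h k" using assms inner_rep_kernel by simp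
  then show "h2_inner (rep_kernel M p) h = h2_inner k h" by (metis inner_cnj)
qed (use assms rep_kernel_in in auto)

lemma rep_kernel_hermitian: "rep_kernel M q p = cnj (rep_kernel M p q)"
  using inner_rep_kernel[OF rep_kernel_in, of q p] inner_rep_kernel[OF rep_kernel_in, of p q] inner_cnj
  by metis

lemma core_fun_hermitian: "core_fun M q p = cnj (core_fun M p q)"
  using rep_kernel_hermitian[of q p] by (cases p; cases q) (simp add: core_fun_def mult_ac)

lemma core_fun_eq:
  "core_fun M p = rep_kernel M p - cscale (cnj (fst p)) (mult_z (rep_kernel M p))
     - cscale (cnj (snd p)) (mult_w (rep_kernel M p))
     + cscale (cnj (fst p) * cnj (snd p)) (mult_z (mult_w (rep_kernel M p)))"
  by (cases p) (auto simp: core_fun_def fun_eq_iff mult_z_def mult_w_def algebra_simps)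

lemma core_fun_in: "core_fun M p \<in> M"
  unfolding core_fun_eq by (intro in_simps rep_kernel_in)

text \<open>As a function of its first argument the core function is the conjugate of an element of
  \<open>M\<close>, so the integral of boundary functions is an inner product.\<close>

lemma core_op_eq:
  assumes f: "f \<in> H2"
  shows "core_op M f p = (if p \<in> bidisk then h2_inner f (core_fun M p) else 0)"
  using integral_boundary[OF f in_H2[OF core_fun_in[of p]]]
  by (simp add: core_op_def core_fun_hermitian[of _ p] del: mem_Times_iff)

text \<open>The factors \<open>1 - cnj \<lambda> z\<close> and \<open>1 - cnj \<mu> w\<close> of the core function are moved to \<open>f\<close> by
  taking adjoints.\<close>

lemma core_op_on_M:
  assumes f: "f \<in> M"
  shows "core_op M f = f - mult_z (zs f) - mult_w (ws f) + mult_z (mult_w (ws (zs f)))" (is "_ = ?g")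
proof
  fix p
  have g: "?g \<in> M" by (intro in_simps f)
  show "core_op M f p = ?g p"
  proof (cases "p \<in> bidisk")
    case False
    then show ?thesis using H2_outside[OF in_H2[OF g] False] core_op_eq[OF in_H2[OF f]] by metis
  next
    case True
    let ?K = "rep_kernel M p"
    note K = rep_kernel_in[of p]
    note [simp] = in_simps f K in_H2 H2_add H2_diff H2_cscale
    have "core_op M f p = h2_inner f (core_fun M p)" using True core_op_eq[OF in_H2[OF f]] by metis
    also have "\<dots> = h2_inner f ?K - fst p * h2_inner (zs f) ?K - snd p * h2_inner (ws f) ?K
        + fst p * snd p * h2_inner (ws (zs f)) ?K"
      unfolding core_fun_eq
      by (simp add: inner_simps inner_cscale_right inner_zs inner_ws)
    also have "\<dots> = ?g p"
      by (simp add: inner_rep_kernel mult_z_eq mult_w_eq)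
    finally show ?thesis .
  qed
qed

lemma core_op_in_of_M: "f \<in> M \<Longrightarrow> core_op M f \<in> M"
  unfolding core_op_on_M by (intro in_simps)

lemma core_op_proj:
  assumes f: "f \<in> H2"
  shows "core_op M f = core_op M (proj M f)"
proof
  fix p
  show "core_op M f p = core_op M (proj M f) p"
    unfolding core_op_eq[OF f] core_op_eq[OF in_H2[OF proj_in[OF closed f]]]
      inner_proj[OF closed f core_fun_in] ..
qed

lemma core_op_in: "f \<in> H2 \<Longrightarrow> core_op M f \<in> M"
  unfolding core_op_proj[of f] by (rule core_op_in_of_M[OF proj_in[OF closed]])

lemma core_op_selfadjoint_on_M:
  assumes f: "f \<in> M" and g: "g \<in> M"
  shows "h2_inner (core_op M f) g = h2_inner f (core_op M g)"
proof -
  note [simp] = in_simps f g in_H2 H2_add H2_diff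
  have "h2_inner (core_op M f) g = h2_inner f g - h2_inner (zs f) (zs g) - h2_inner (ws f) (ws g)
      + h2_inner (ws (zs f)) (ws (zs g))"
    unfolding core_op_on_M[OF f] by (simp add: inner_simps inner_z inner_w)
  also have "\<dots> = h2_inner f (core_op M g)"
    unfolding core_op_on_M[OF g] by (simp add: inner_simps inner_zs inner_ws)
  finally show ?thesis .
qed

lemma core_op_selfadjoint:
  assumes f: "f \<in> H2" and g: "g \<in> H2"
  shows "h2_inner (core_op M f) g = h2_inner f (core_op M g)"
proof -
  note P = proj_in[OF closed f] proj_in[OF closed g]
  have "h2_inner (core_op M f) g = h2_inner (core_op M (proj M f)) (proj M g)"
    unfolding core_op_proj[OF f] by (rule inner_proj_right[OF closed g core_op_in_of_M[OF P(1)], symmetric])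
  also have "\<dots> = h2_inner (proj M f) (core_op M (proj M g))"
    by (rule core_op_selfadjoint_on_M[OF P])
  also have "\<dots> = h2_inner f (core_op M g)"
    unfolding core_op_proj[OF g] by (rule inner_proj[OF closed f core_op_in_of_M[OF P(2)]])
  finally show ?thesis .
qed

subsection \<open>The Hilbert-Schmidt norm of the core operator\<close>

lemma hs_norm_sq_core_op: "hs_norm_sq H2 (core_op M) = hs_norm_sq M (core_op M)"
  by (rule hs_norm_sq_adjoint[OF closed_subspace_H2 closed])
    (auto simp: core_op_in in_H2 core_op_selfadjoint)

text \<open>Let \<open>Z\<close>, \<open>W\<close> be the restrictions of multiplication by the coordinates to \<open>M\<close>, and
  \<open>p = 1 - Z Z\<^sup>*\<close>, \<open>q = 1 - W W\<^sup>*\<close>. As \<open>Z\<close> and \<open>W\<close> are isometries, these are the self-commutators,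
  and \<open>Z [Z\<^sup>*, W] W\<^sup>* = Z Z\<^sup>* W W\<^sup>* - Z W Z\<^sup>* W\<^sup>*\<close>, so the core operator is
  \<open>p q - Z [Z\<^sup>*, W] W\<^sup>*\<close>. The two terms have orthogonal ranges since \<open>p Z = 0\<close>.\<close>

lemma core_op_pythagoras:
  assumes e: "e \<in> M"
  shows "(h2_norm (core_op M e))\<^sup>2
     = (h2_norm ((commutator zs mult_z \<circ> commutator ws mult_w) e))\<^sup>2 + (h2_norm (commutator zs mult_w (ws e)))\<^sup>2"
proof -
  define u where "u = e - mult_w (ws e)"
  define v where "v = zs (mult_w (ws e)) - mult_w (zs (ws e))"
  have u: "u \<in> M" and v: "v \<in> M" unfolding u_def v_def by (intro in_simps e)+
  have pq: "(commutator zs mult_z \<circ> commutator ws mult_w) e = u - mult_z (zs u)"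
    using e u by (simp add: commutator_def zs_z ws_w u_def)
  have X: "commutator zs mult_w (ws e) = v" by (simp add: commutator_def v_def)
  have "core_op M e = (u - mult_z (zs u)) - mult_z v"
    unfolding core_op_on_M[OF e] u_def v_def using e
    by (simp add: zs_diff in_simps mult_z_diff zs_ws_commute)
  moreover have "h2_inner (u - mult_z (zs u)) (mult_z v) = 0"
    using u v by (simp add: inner_diff_left in_simps in_H2 zs_diff zs_z flip: inner_zs)
  ultimately have "(h2_norm (core_op M e))\<^sup>2 = (h2_norm (u - mult_z (zs u)))\<^sup>2 + (h2_norm (mult_z v))\<^sup>2"
    using u v by (simp add: norm_diff_sq in_simps in_H2)
  then show ?thesis unfolding pq X using v by (simp add: norm_mult_z)
qed

text \<open>In the second term of \<open>core_op_pythagoras\<close> the factor \<open>W\<^sup>*\<close> does not change the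
  Hilbert-Schmidt norm: taking adjoints moves it to the left as the isometry \<open>W\<close>.\<close>

lemma hs_norm_sq_core_op_Sigma: "hs_norm_sq H2 (core_op M) = Sigma0 M + Sigma1 M"
proof -
  \<comment> \<open>\<open>?Y\<close> is the adjoint of \<open>?X\<close>\<close>
  let ?X = "commutator zs mult_w" and ?Y = "commutator ws mult_z"
  have X: "?X f \<in> M" and Y: "?Y f \<in> M" if "f \<in> M" for f
    unfolding commutator_def using that by (intro in_simps; simp)+
  have XY: "h2_inner (?X f) g = h2_inner f (?Y g)" if "f \<in> M" "g \<in> M" for f g
    unfolding commutator_def using that
    by (simp add: inner_simps in_simps in_H2 inner_zs inner_ws inner_z inner_w)
  have "hs_norm_sq M (\<lambda>e. ?X (ws e)) = hs_norm_sq M (\<lambda>e. mult_w (?Y e))"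
    by (rule hs_norm_sq_adjoint[OF closed closed]) (auto simp: X Y in_simps XY inner_ws)
  also have "\<dots> = hs_norm_sq M ?Y"
    by (rule hs_norm_sq_cong[OF closed]) (simp add: norm_mult_w Y)
  also have "\<dots> = hs_norm_sq M ?X"
    by (rule hs_norm_sq_adjoint[OF closed closed]) (use X Y XY inner_cnj in metis)+
  finally have "hs_norm_sq M (\<lambda>e. ?X (ws e)) = Sigma1 M" by (simp add: Sigma1_def)
  moreover have "hs_norm_sq M (core_op M) = Sigma0 M + hs_norm_sq M (\<lambda>e. ?X (ws e))"
    unfolding Sigma0_def by (rule hs_norm_sq_pythagoras[OF closed core_op_pythagoras])
  ultimately show ?thesis by (simp add: hs_norm_sq_core_op)
qed

lemma hilbert_schmidt_iff: "hilbert_schmidt M \<longleftrightarrow> hs_norm_sq H2 (core_op M) < \<infinity>"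
  unfolding hilbert_schmidt_def hs_norm_sq_core_op_Sigma by simp

end

section \<open>Extension from polynomials to the Hardy space\<close>

text \<open>The upper bound on polynomials makes the images of the truncations of \<open>f\<close> a Cauchy sequence,
  and because norm convergence implies pointwise convergence its limit can only be \<open>L f\<close>. Both bounds
  pass to the limit.\<close>

lemma weighted_composition_bounds:
  fixes m :: fun2 and \<sigma> :: "complex \<times> complex \<Rightarrow> complex \<times> complex"
  defines "L \<equiv> \<lambda>f p. if p \<in> bidisk then m p * f (\<sigma> p) else 0"
  assumes \<sigma>: "\<And>p. p \<in> bidisk \<Longrightarrow> \<sigma> p \<in> bidisk"
    and pol: "\<And>K a. finite K \<Longrightarrow> L (pol K a) \<in> H2"
      "\<And>K a. finite K \<Longrightarrow> c * (h2_norm (pol K a))\<^sup>2 \<le> (h2_norm (L (pol K a)))\<^sup>2"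
      "\<And>K a. finite K \<Longrightarrow> (h2_norm (L (pol K a)))\<^sup>2 \<le> C * (h2_norm (pol K a))\<^sup>2"
    and f: "f \<in> H2"
  shows "L f \<in> H2" "c * (h2_norm f)\<^sup>2 \<le> (h2_norm (L f))\<^sup>2" "(h2_norm (L f))\<^sup>2 \<le> C * (h2_norm f)\<^sup>2"
proof -
  define X where "X n = L (trunc n f)" for n
  note T = h2_limD[OF trunc_lim[OF f]]
  have XH: "X n \<in> H2" for n unfolding X_def trunc_def by (rule pol) simp
  have bound: "(h2_norm (X m - X n))\<^sup>2 \<le> C * (h2_norm (trunc m f - trunc n f))\<^sup>2" for m n
  proof -
    define b where "b k = h2_coeffs (trunc m f) k - h2_coeffs (trunc n f) k" for k
    have "trunc m f - trunc n f = pol (box m \<union> box n) b"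
      by (rule H2_coeffs_eqI)
        (auto simp: H2_diff h2_coeffs_diff h2_coeffs_pol b_def fun_eq_iff trunc_def)
    moreover have "X m - X n = L (trunc m f - trunc n f)"
      by (simp add: X_def L_def fun_eq_iff algebra_simps)
    ultimately show ?thesis by (simp add: pol(3))
  qed
  obtain g where g: "h2_lim X g"
  proof (rule H2_complete[OF XH])
    fix e :: real assume e: "e > 0"
    define d where "d = e / (2 * (sqrt \<bar>C\<bar> + 1))"
    have d: "d > 0" unfolding d_def using e by (simp add: add_nonneg_pos)
    obtain N where N: "\<And>n. n \<ge> N \<Longrightarrow> h2_norm (trunc n f - f) < d"
      using order_tendstoD(2)[OF T(3) d] by (auto simp: eventually_sequentially)
    have "h2_norm (X m - X n) < e" if mn: "m \<ge> N" "n \<ge> N" for m n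
    proof -
      have "h2_norm (trunc m f - trunc n f) \<le> h2_norm (trunc m f - f) + h2_norm (f - trunc n f)"
        by (rule norm_triangle_diff) (simp_all add: f)
      then have lt: "h2_norm (trunc m f - trunc n f) < 2 * d"
        using N[OF mn(1)] N[OF mn(2)] h2_norm_minus_commute[OF f trunc_in_H2[of n f]] by linarith
      have "(h2_norm (X m - X n))\<^sup>2 \<le> \<bar>C\<bar> * (h2_norm (trunc m f - trunc n f))\<^sup>2"
        using bound[of m n] mult_right_mono[OF abs_ge_self[of C] zero_le_power2[of "h2_norm (trunc m f - trunc n f)"]]
        by linarith
      also have "\<dots> = (sqrt \<bar>C\<bar> * h2_norm (trunc m f - trunc n f))\<^sup>2"
        by (simp add: power_mult_distrib)
      finally have "h2_norm (X m - X n) \<le> sqrt \<bar>C\<bar> * h2_norm (trunc m f - trunc n f)"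
        by (rule power2_le_imp_le) simp
      also have "\<dots> \<le> (sqrt \<bar>C\<bar> + 1) * h2_norm (trunc m f - trunc n f)"
        by (intro mult_right_mono) auto
      also have "\<dots> < (sqrt \<bar>C\<bar> + 1) * (2 * d)"
        using lt by (intro mult_strict_left_mono) (auto simp: add_nonneg_pos)
      also have "\<dots> = e"
      proof -
        have "x * (2 * (e / (2 * x))) = e" if "x \<noteq> 0" for x :: real using that by simp
        moreover have "sqrt \<bar>C\<bar> + 1 \<noteq> 0" using real_sqrt_ge_zero[of "\<bar>C\<bar>"] by linarith
        ultimately show ?thesis unfolding d_def by blast
      qed
      finally show ?thesis .
    qed
    then show "\<exists>N. \<forall>m\<ge>N. \<forall>n\<ge>N. h2_norm (X m - X n) < e" by blast
  qed
  have gH: "g \<in> H2" by (rule h2_limD(2)[OF g])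
  have "L f = g"
  proof
    fix p
    show "L f p = g p"
    proof (cases "p \<in> bidisk")
      case True
      have "(\<lambda>n. X n p) \<longlonglongrightarrow> g p" by (rule h2_lim_eval[OF g True])
      moreover have "(\<lambda>n. X n p) \<longlonglongrightarrow> m p * f (\<sigma> p)"
        using tendsto_mult_left[OF h2_lim_eval[OF trunc_lim[OF f] \<sigma>[OF True]], of "m p"] True
        by (simp add: X_def L_def del: mem_Times_iff)
      ultimately show ?thesis using True LIMSEQ_unique by (simp add: L_def del: mem_Times_iff) 
    next
      case False
      then show ?thesis using H2_outside[OF gH False] by (simp add: L_def del: mem_Times_iff)
    qed
  qed
  then show "L f \<in> H2" using gH by simp
  have lim: "(\<lambda>n. (h2_norm (X n))\<^sup>2) \<longlonglongrightarrow> (h2_norm (L f))\<^sup>2" "(\<lambda>n. (h2_norm (trunc n f))\<^sup>2) \<longlonglongrightarrow> (h2_norm f)\<^sup>2"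
    unfolding \<open>L f = g\<close> by (intro tendsto_intros h2_lim_norm g trunc_lim f)+
  show "c * (h2_norm f)\<^sup>2 \<le> (h2_norm (L f))\<^sup>2"
    by (rule LIMSEQ_le[OF tendsto_mult_left[OF lim(2)] lim(1)]) (simp add: X_def trunc_def pol(2))
  show "(h2_norm (L f))\<^sup>2 \<le> C * (h2_norm f)\<^sup>2"
    by (rule LIMSEQ_le[OF lim(1) tendsto_mult_left[OF lim(2)]]) (simp add: X_def trunc_def pol(3))
qed

section \<open>Inner functions as isometric multipliers\<close>

lemma pol_apply: "finite K \<Longrightarrow> pol K a p = (if p \<in> bidisk then \<Sum>k\<in>K. a k * mon k p else 0)"
  unfolding pol_def by (induction K rule: finite_induct) (simp, simp add: emon_def del: mem_Times_iff)

lemma norm_mon_le_1: "p \<in> bidisk \<Longrightarrow> norm (mon k p) \<le> 1"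
  unfolding norm_mon mem_bidisk by (intro mult_le_one power_le_one zero_le_power norm_ge_zero less_imp_le) simp_all

lemma filterlim_at_left_1: "filterlim (\<lambda>n. 1 - 1 / real (n + 2)) (at_left 1) sequentially"
proof (rule tendsto_imp_filterlim_at_left)
  have "(\<lambda>n. 1 - 1 / real (n + 2)) \<longlonglongrightarrow> 1 - 0"
    by (intro tendsto_intros LIMSEQ_ignore_initial_segment[OF lim_1_over_n])
  then show "(\<lambda>n. 1 - 1 / real (n + 2)) \<longlonglongrightarrow> 1" by simp
qed simp

text \<open>Inner functions of two variables with an explicit power series; \<open>\<theta>\<close> and \<open>\<phi>\<close>, as functions of
  one of the coordinates, are the instances of interest.\<close>

locale inner_on_bidisk =
  fixes \<Theta> :: fun2 and a :: "nat \<times> nat \<Rightarrow> complex" and B :: real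
  assumes power_series: "power_series \<Theta> a"
    and bounded: "\<And>p. p \<in> bidisk \<Longrightarrow> norm (\<Theta> p) \<le> B"
    and radial: "AE q in torus. \<exists>l. ((\<lambda>r. \<Theta> (dil r q)) \<longlongrightarrow> l) (at_left 1) \<and> norm l = 1"
begin

lemma in_H2: "\<Theta> \<in> H2"
proof (rule H2_I[OF H2_criterion[OF power_series]])
  fix r :: real assume r: "0 < r" "r < 1"
  have "(\<integral>q. (norm (\<Theta> (dil r q)))\<^sup>2 \<partial>torus) \<le> (\<integral>q. B\<^sup>2 \<partial>torus)"
  proof (rule integral_mono_AE)
    show "integrable torus (\<lambda>q. (norm (\<Theta> (dil r q)))\<^sup>2)"
      by (rule dilation_norm_integrable[OF power_series]) (use r in auto)
    show "AE q in torus. (norm (\<Theta> (dil r q)))\<^sup>2 \<le> B\<^sup>2"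
      using AE_torus by eventually_elim (intro power_mono bounded dil_bidisk; use r in simp)
  qed simp
  then show "(\<integral>q. (norm (\<Theta> (dil r q)))\<^sup>2 \<partial>torus) \<le> B\<^sup>2"
    by (simp add: measure_def emeasure_torus)
qed

lemma mult_pol_in_H2: "\<Theta> * pol K b \<in> H2"
proof -
  have "\<Theta> * emon k = mon k * \<Theta>" for k
    using H2_outside[OF in_H2] by (auto simp: fun_eq_iff emon_def)
  then have "\<Theta> * emon k \<in> H2" for k using isom_mult_in_H2[OF isom_mult_mon in_H2] by simp
  then show ?thesis
    unfolding pol_def sum_distrib_left mult_cscale by (intro H2_sum H2_cscale)
qed

text \<open>The squared norm of \<open>\<Theta> q\<close> is the limit of \<open>\<integral> |\<Theta>|\<^sup>2 |q|\<^sup>2\<close> over dilated tori, and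
  \<open>|\<Theta>|\<^sup>2\<close> tends to 1 boundedly.\<close>

lemma norm_mult_pol:
  assumes K: "finite K"
  shows "h2_norm (\<Theta> * pol K b) = h2_norm (pol K b)"
proof -
  let ?q = "pol K b"
  let ?F = "\<Theta> * ?q"
  define S where "S = (\<Sum>k\<in>K. norm (b k))"
  define r where "r n = 1 - 1 / real (n + 2)" for n
  have r: "0 \<le> r n" "r n < 1" for n by (auto simp: r_def)
  note [measurable] = power_series_measurable[OF power_series]
    power_series_measurable[OF H2_power_series[OF pol_in_H2[of K b]]]
  have S: "norm (?q p) \<le> S" if "p \<in> bidisk" for p
    unfolding S_def pol_apply[OF K] using that
    by (auto intro!: sum_norm_le mult_left_le norm_mon_le_1 simp: norm_mult simp del: mem_Times_iff)
  have "(\<lambda>n. \<integral>q. ((norm (\<Theta> (dil (r n) q)))\<^sup>2 - 1) * (norm (?q (dil (r n) q)))\<^sup>2 \<partial>torus) \<longlonglongrightarrow> (\<integral>q. 0 \<partial>torus)"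
  proof (rule integral_dominated_convergence[where w = "\<lambda>_. (B\<^sup>2 + 1) * S\<^sup>2"])
    show "AE q in torus. (\<lambda>n. ((norm (\<Theta> (dil (r n) q)))\<^sup>2 - 1) * (norm (?q (dil (r n) q)))\<^sup>2) \<longlonglongrightarrow> 0"
      using AE_torus radial
    proof eventually_elim
      case (elim q)
      then obtain l where l: "((\<lambda>r. \<Theta> (dil r q)) \<longlongrightarrow> l) (at_left 1)" "norm l = 1" by blast
      have "(\<lambda>n. \<Theta> (dil (r n) q)) \<longlonglongrightarrow> l"
        unfolding r_def by (rule filterlim_compose[OF l(1) filterlim_at_left_1])
      then have "(\<lambda>n. (norm (\<Theta> (dil (r n) q)))\<^sup>2 - 1) \<longlonglongrightarrow> (norm l)\<^sup>2 - 1" by (intro tendsto_intros)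
      then have 0: "(\<lambda>n. ((norm (\<Theta> (dil (r n) q)))\<^sup>2 - 1) * S\<^sup>2) \<longlonglongrightarrow> 0"
        using l(2) by (intro tendsto_mult_left_zero) simp
      show ?case
      proof (rule tendsto_rabs_zero_cancel, rule tendsto_sandwich[OF _ _ tendsto_const tendsto_rabs_zero[OF 0]])
        show "\<forall>\<^sub>F n in sequentially. \<bar>((norm (\<Theta> (dil (r n) q)))\<^sup>2 - 1) * (norm (?q (dil (r n) q)))\<^sup>2\<bar>
            \<le> \<bar>((norm (\<Theta> (dil (r n) q)))\<^sup>2 - 1) * S\<^sup>2\<bar>"
          unfolding abs_mult using S[OF dil_bidisk[OF elim(1) r]]
          by (intro always_eventually allI mult_left_mono) (auto intro: power_mono)
      qed simp
    qed
    fix n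
    show "AE q in torus. norm (((norm (\<Theta> (dil (r n) q)))\<^sup>2 - 1) * (norm (?q (dil (r n) q)))\<^sup>2) \<le> (B\<^sup>2 + 1) * S\<^sup>2"
      using AE_torus
    proof eventually_elim
      case (elim q)
      have "(norm (\<Theta> (dil (r n) q)))\<^sup>2 \<le> B\<^sup>2" "(norm (?q (dil (r n) q)))\<^sup>2 \<le> S\<^sup>2"
        using bounded[OF dil_bidisk[OF elim r]] S[OF dil_bidisk[OF elim r]] by (auto intro: power_mono)
      then show ?case unfolding norm_mult
        by (intro mult_mono) (auto simp: abs_le_iff intro: order_trans[of _ 1])
    qed
  qed auto
  moreover have "(\<integral>q. ((norm (\<Theta> (dil (r n) q)))\<^sup>2 - 1) * (norm (?q (dil (r n) q)))\<^sup>2 \<partial>torus)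
      = (\<integral>q. (norm (?F (dil (r n) q)))\<^sup>2 \<partial>torus) - (\<integral>q. (norm (?q (dil (r n) q)))\<^sup>2 \<partial>torus)" for n
  proof -
    have "integrable torus (\<lambda>q. (norm (?F (dil (r n) q)))\<^sup>2)" "integrable torus (\<lambda>q. (norm (?q (dil (r n) q)))\<^sup>2)"
      by (rule dilation_norm_integrable[OF H2_power_series[OF mult_pol_in_H2] r],
          rule dilation_norm_integrable[OF H2_power_series[OF pol_in_H2] r])
    then have "(\<integral>q. (norm (?F (dil (r n) q)))\<^sup>2 \<partial>torus) - (\<integral>q. (norm (?q (dil (r n) q)))\<^sup>2 \<partial>torus)
      = (\<integral>q. (norm (?F (dil (r n) q)))\<^sup>2 - (norm (?q (dil (r n) q)))\<^sup>2 \<partial>torus)"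
      by (rule Bochner_Integration.integral_diff[symmetric])
    also have "\<dots> = (\<integral>q. ((norm (\<Theta> (dil (r n) q)))\<^sup>2 - 1) * (norm (?q (dil (r n) q)))\<^sup>2 \<partial>torus)"
      by (simp add: norm_mult power_mult_distrib left_diff_distrib)
    finally show ?thesis by simp
  qed
  ultimately have "(\<lambda>n. (\<integral>q. (norm (?F (dil (r n) q)))\<^sup>2 \<partial>torus) - (\<integral>q. (norm (?q (dil (r n) q)))\<^sup>2 \<partial>torus)) \<longlonglongrightarrow> 0"
    by simp
  moreover have "(\<lambda>n. (\<integral>q. (norm (?F (dil (r n) q)))\<^sup>2 \<partial>torus) - (\<integral>q. (norm (?q (dil (r n) q)))\<^sup>2 \<partial>torus))
     \<longlonglongrightarrow> (h2_norm ?F)\<^sup>2 - (h2_norm ?q)\<^sup>2"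
    unfolding r_def
    by (intro tendsto_diff filterlim_compose[OF dilation_norm_tendsto[OF mult_pol_in_H2] filterlim_at_left_1]
      filterlim_compose[OF dilation_norm_tendsto[OF pol_in_H2] filterlim_at_left_1])
  ultimately have "(h2_norm ?F)\<^sup>2 - (h2_norm ?q)\<^sup>2 = 0" using LIMSEQ_unique by blast
  then show ?thesis by simp
qed

lemma isom_mult: "isom_mult \<Theta>"
  unfolding isom_mult_def
proof
  fix f assume f: "f \<in> H2"
  have eq: "(\<lambda>p. if p \<in> bidisk then \<Theta> p * g p else 0) = \<Theta> * g" for g
    using H2_outside[OF in_H2] by (auto simp: fun_eq_iff)
  have "\<Theta> * f \<in> H2" "1 * (h2_norm f)\<^sup>2 \<le> (h2_norm (\<Theta> * f))\<^sup>2" "(h2_norm (\<Theta> * f))\<^sup>2 \<le> 1 * (h2_norm f)\<^sup>2"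
    using weighted_composition_bounds[of "\<lambda>p. p" \<Theta> 1 1 f] f
    unfolding eq by (simp_all add: mult_pol_in_H2 norm_mult_pol)
  then show "\<Theta> * f \<in> H2 \<and> h2_norm (\<Theta> * f) = h2_norm f"
    by (simp add: power2_eq_iff_nonneg[THEN iffD1, OF _ _ order_antisym])
qed

end

definition lift_z :: "(complex \<Rightarrow> complex) \<Rightarrow> fun2" where
  "lift_z \<theta> = (\<lambda>p. if p \<in> bidisk then \<theta> (fst p) else 0)"

definition lift_w :: "(complex \<Rightarrow> complex) \<Rightarrow> fun2" where
  "lift_w \<phi> = (\<lambda>p. if p \<in> bidisk then \<phi> (snd p) else 0)"

text \<open>The Taylor series converges absolutely, hence as an unordered sum.\<close>

lemma holomorphic_has_sum:
  assumes "\<theta> holomorphic_on disk"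
  shows "\<exists>t. \<forall>z\<in>disk. ((\<lambda>i. t i * z ^ i) has_sum \<theta> z) (UNIV :: nat set)"
proof -
  define t where "t i = (deriv ^^ i) \<theta> 0 / fact i" for i
  have sums: "(\<lambda>i. t i * z ^ i) sums \<theta> z" if "z \<in> disk" for z
    using holomorphic_power_series[OF assms that] by (simp add: t_def)
  have "((\<lambda>i. t i * z ^ i) has_sum \<theta> z) UNIV" if z: "z \<in> disk" for z
  proof (rule norm_summable_imp_has_sum[OF _ sums[OF z]])
    obtain \<rho> where \<rho>: "norm z < \<rho>" "\<rho> < 1" using z dense[of "norm z" 1] by auto
    then have "0 < \<rho>" using norm_ge_zero order_le_less_trans by blast
    then have "summable (\<lambda>i. t i * of_real \<rho> ^ i)" using \<rho> by (intro sums_summable[OF sums]) simp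
    then show "summable (\<lambda>i. norm (t i * z ^ i))"
      by (rule powser_insidea) (use \<rho> \<open>0 < \<rho>\<close> in simp)
  qed
  then show ?thesis by blast
qed

text \<open>Applied to \<open>x = fst\<close> and \<open>x = snd\<close>, with \<open>e\<close> enumerating the monomials that are powers
  of \<open>x\<close>.\<close>

lemma inner_function_coordinate:
  assumes \<theta>: "inner_function \<theta>"
    and e: "inj e" "\<And>i p. mon (e i) p = x p ^ i"
    and x: "\<And>p. p \<in> bidisk \<Longrightarrow> x p \<in> disk" "\<And>r q. x (dil r q) = of_real r * x q"
    and AE_x: "\<And>P. AE \<zeta> in circle. P \<zeta> \<Longrightarrow> AE q in torus. P (x q)"
  defines "\<Theta> \<equiv> \<lambda>p. if p \<in> bidisk then \<theta> (x p) else 0"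
  shows "isom_mult \<Theta>"
proof -
  obtain t where t: "\<And>z. z \<in> disk \<Longrightarrow> ((\<lambda>i. t i * z ^ i) has_sum \<theta> z) (UNIV :: nat set)"
    using holomorphic_has_sum \<theta> unfolding inner_function_def by blast
  obtain B where B: "\<And>z. z \<in> disk \<Longrightarrow> norm (\<theta> z) \<le> B"
    using \<theta> unfolding inner_function_def bounded_iff by blast
  have rad: "AE \<zeta> in circle. \<exists>l. ((\<lambda>r. \<theta> (complex_of_real r * \<zeta>)) \<longlongrightarrow> l) (at_left 1) \<and> norm l = 1"
    using \<theta> unfolding inner_function_def by blast
  have ev: "\<forall>\<^sub>F r in at_left 1. r \<in> {0<..<1::real}" by (rule eventually_at_leftI[of 0]) auto
  define a where "a k = (if k \<in> range e then t (inv e k) else 0)" for k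
  have "inner_on_bidisk \<Theta> a B"
  proof
    show "power_series \<Theta> a"
      unfolding power_series_def
    proof (intro conjI ballI allI impI)
      fix p assume p: "p \<in> bidisk"
      have "(\<lambda>k. a k * mon k p) \<circ> e = (\<lambda>i. t i * x p ^ i)"
        by (simp add: fun_eq_iff a_def e(2) inv_f_f[OF e(1)])
      then have "((\<lambda>k. a k * mon k p) has_sum \<theta> (x p)) (range e)"
        using has_sum_reindex[OF e(1), of "\<lambda>k. a k * mon k p"] t[OF x(1)[OF p]] by simp
      then have "((\<lambda>k. a k * mon k p) has_sum \<theta> (x p)) UNIV"
        by (rule has_sum_cong_neutral[THEN iffD1, rotated -1]) (auto simp: a_def)
      then show "((\<lambda>k. a k * mon k p) has_sum \<Theta> p) UNIV"
        using p by (simp add: \<Theta>_def del: mem_Times_iff)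
    qed (simp add: \<Theta>_def del: mem_Times_iff)
    show "AE q in torus. \<exists>l. ((\<lambda>r. \<Theta> (dil r q)) \<longlongrightarrow> l) (at_left 1) \<and> norm l = 1"
      using AE_torus AE_x[OF rad]
    proof eventually_elim
      case (elim q)
      then obtain l where l: "((\<lambda>r. \<theta> (complex_of_real r * x q)) \<longlongrightarrow> l) (at_left 1)" "norm l = 1" by blast
      have "\<forall>\<^sub>F r in at_left 1. \<theta> (complex_of_real r * x q) = \<Theta> (dil r q)"
        using ev by eventually_elim (use dil_bidisk[OF elim(1)] in \<open>simp add: \<Theta>_def x(2) del: mem_Times_iff\<close>)
      from Lim_transform_eventually[OF l(1) this] show ?case using l(2) by blast
    qed
    show "norm (\<Theta> p) \<le> B" if "p \<in> bidisk" for p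
      using B[OF x(1)[OF that]] that by (simp add: \<Theta>_def del: mem_Times_iff)
  qed
  then show ?thesis by (rule inner_on_bidisk.isom_mult)
qed

lemma isom_mult_lift:
  assumes "inner_function \<theta>"
  shows "isom_mult (lift_z \<theta>)" "isom_mult (lift_w \<theta>)"
proof -
  show "isom_mult (lift_z \<theta>)"
    unfolding lift_z_def
    by (rule inner_function_coordinate[OF assms, of "\<lambda>i. (i, 0)" fst])
      (auto simp: inj_on_def mon_def dil_def mem_bidisk AE_torus_fst)
  show "isom_mult (lift_w \<theta>)"
    unfolding lift_w_def
    by (rule inner_function_coordinate[OF assms, of "\<lambda>j. (0, j)" snd])
      (auto simp: inj_on_def mon_def dil_def mem_bidisk AE_torus_snd)
qed

text \<open>Isometric multipliers are bounded by 1 in the bidisk; the maximum principle makes the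
  inequality strict.\<close>

lemma inner_function_less_1:
  assumes \<theta>: "inner_function \<theta>" and nc: "\<not> \<theta> constant_on disk" and z: "z \<in> disk"
  shows "norm (\<theta> z) < 1"
proof -
  have le: "norm (\<theta> z) \<le> 1" if "z \<in> disk" for z
    using isom_mult_le_1[OF isom_mult_lift(1)[OF \<theta>], of "(z, 0)"] that by (simp add: lift_z_def)
  have "norm (\<theta> z) \<noteq> 1"
  proof
    assume "norm (\<theta> z) = 1"
    then have "\<theta> constant_on disk"
      using \<theta> z le by (intro maximum_modulus_principle[of \<theta> disk disk z]) (auto simp: inner_function_def)
    then show False using nc by simp
  qed
  then show ?thesis using le[OF z] by simp
qed

section \<open>Functions of one variable inside the Hardy space\<close>

text \<open>\<open>\<pi>\<close> is the projection to one of the coordinate axes, or another map that either preserves or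
  annihilates each monomial; \<open>S\<close> tells the monomials that it preserves.\<close>

definition slice :: "(complex \<times> complex \<Rightarrow> complex \<times> complex) \<Rightarrow> (nat \<times> nat \<Rightarrow> bool) \<Rightarrow> bool" where
  "slice \<pi> S \<longleftrightarrow> (\<forall>k p. mon k (\<pi> p) = (if S k then mon k p else 0)) \<and> (\<forall>p\<in>bidisk. \<pi> p \<in> bidisk)"

definition fixed_by :: "(complex \<times> complex \<Rightarrow> complex \<times> complex) \<Rightarrow> fun2 set" where
  "fixed_by \<pi> = {F \<in> H2. \<forall>p\<in>bidisk. F p = F (\<pi> p)}"

lemma slice_z: "slice (\<lambda>p. (0, snd p)) (\<lambda>k. fst k = 0)"
  and slice_w: "slice (\<lambda>p. (fst p, 0)) (\<lambda>k. snd k = 0)"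
  unfolding slice_def mem_bidisk by (auto simp: mon_def)

lemma slice_has_sum:
  assumes "slice \<pi> S" "f \<in> H2" "p \<in> bidisk"
  shows "((\<lambda>k. (if S k then h2_coeffs f k else 0) * mon k p) has_sum f (\<pi> p)) UNIV"
proof -
  have "\<pi> p \<in> bidisk" using assms unfolding slice_def by blast
  from H2_has_sum[OF assms(2) this] show ?thesis
  proof (rule has_sum_cong[THEN iffD1, rotated])
    fix k
    have "mon k (\<pi> p) = (if S k then mon k p else 0)" using assms(1) unfolding slice_def by blast
    then show "h2_coeffs f k * mon k (\<pi> p) = (if S k then h2_coeffs f k else 0) * mon k p" by simp
  qed
qed

lemma slice_coeffs_eq_0:
  assumes "slice \<pi> S" "f \<in> H2" "\<And>p. p \<in> bidisk \<Longrightarrow> f (\<pi> p) = 0" "S k"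
  shows "h2_coeffs f k = 0"
proof -
  have "((\<lambda>k. (if S k then h2_coeffs f k else 0) * mon k p) has_sum 0) UNIV" if "p \<in> bidisk" for p
    using slice_has_sum[OF assms(1,2) that] assms(3)[OF that] by simp
  from double_powser_zero_unique[OF this, of k] show ?thesis using assms(4) by simp
qed

lemma fixed_by_coeffs_eq_0:
  assumes "slice \<pi> S" "f \<in> fixed_by \<pi>" "\<not> S k"
  shows "h2_coeffs f k = 0"
proof -
  have f: "f \<in> H2" "\<And>p. p \<in> bidisk \<Longrightarrow> f (\<pi> p) = f p" using assms(2) unfolding fixed_by_def by auto
  have "((\<lambda>k. (h2_coeffs f k - (if S k then h2_coeffs f k else 0)) * mon k p) has_sum (f p - f p)) UNIV"
    if "p \<in> bidisk" for p
    using has_sum_add[OF H2_has_sum[OF f(1) that] has_sum_uminusI[OF slice_has_sum[OF assms(1) f(1) that]]] f(2)[OF that]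
    by (simp add: left_diff_distrib)
  then have "((\<lambda>k. (h2_coeffs f k - (if S k then h2_coeffs f k else 0)) * mon k p) has_sum 0) UNIV"
    if "p \<in> bidisk" for p
    using that by (simp del: mem_Times_iff)
  from double_powser_zero_unique[OF this, of k] show ?thesis using assms(3) by simp
qed

text \<open>The two functions have no monomial in common: those of \<open>h\<close> are preserved by \<open>\<pi>\<close>, and those of
  \<open>f\<close> are annihilated.\<close>

lemma inner_slice_eq_0:
  assumes "slice \<pi> S" "f \<in> H2" "\<And>p. p \<in> bidisk \<Longrightarrow> f (\<pi> p) = 0" "h \<in> fixed_by \<pi>"
  shows "h2_inner f h = 0"
proof -
  have "h2_coeffs f k * cnj (h2_coeffs h k) = 0" for k
    using slice_coeffs_eq_0[OF assms(1-3)] fixed_by_coeffs_eq_0[OF assms(1,4)] by (cases "S k") auto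
  then have "(\<lambda>k. h2_coeffs f k * cnj (h2_coeffs h k)) = (\<lambda>_. 0)" by (rule ext)
  then show ?thesis unfolding h2_inner_def by (simp only: infsum_0_simp)
qed

lemma fixed_byD: "h \<in> fixed_by \<pi> \<Longrightarrow> h \<in> H2"
  by (simp add: fixed_by_def)

lemma inner_mult_fixed_by:
  assumes \<pi>: "slice \<pi> S" and \<tau>: "isom_mult \<tau>" "\<And>p. p \<in> bidisk \<Longrightarrow> \<tau> (\<pi> p) = a"
    and g: "g \<in> H2" and h: "h \<in> fixed_by \<pi>"
  shows "h2_inner (\<tau> * g) h = a * h2_inner g h"
proof -
  have "h2_inner (\<tau> * g - cscale a g) h = 0"
    by (rule inner_slice_eq_0[OF \<pi> _ _ h])
      (simp_all add: \<tau> isom_mult_in_H2 H2_diff H2_cscale g del: mem_Times_iff)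
  then show ?thesis
    using g fixed_byD[OF h] by (simp add: inner_diff_left inner_cscale_left isom_mult_in_H2 \<tau> H2_cscale)
qed

section \<open>Norm bounds for the composition operator\<close>

text \<open>Let \<open>V\<close> be a subspace with \<open>\<langle>\<tau> g, h\<rangle> = a \<langle>g, h\<rangle>\<close> for \<open>h \<in> V\<close>. The Gram matrix of the
  spaces \<open>\<tau>\<^sup>n V\<close> is then the Toeplitz matrix with entries \<open>a\<^sup>j\<close> on the diagonal number \<open>j \<ge> 0\<close> and
  the conjugates on the other side; its symbol is the Poisson kernel at \<open>a\<close>, which lies between
  \<open>(1 - \<alpha>) / (1 + \<alpha>)\<close> and \<open>(1 + \<alpha>) / (1 - \<alpha>)\<close> for \<open>\<alpha> = |a|\<close>. These bounds are proved by
  induction on the number of terms, using \<open>\<Sum> \<tau>\<^sup>n F\<^sub>n = F\<^sub>0 + \<tau> \<Sum> \<tau>\<^sup>n F\<^sub>n\<^sub>+\<^sub>1\<close>. The vector \<open>g \<in> V\<close>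
  is the projection of the sum to \<open>V\<close>, and the multiples of \<open>|g|\<^sup>2\<close> are chosen such that the
  induction step reduces to \<open>(1 - \<alpha>) (q - \<alpha> q') \<le> |F\<^sub>0|\<^sup>2 \<le> (1 + \<alpha>) (q + \<alpha> q')\<close>, where \<open>q\<close> is
  \<open>|g|\<^sup>2\<close> and \<open>q'\<close> is the same quantity for the sum that starts at \<open>F\<^sub>1\<close>.\<close>

lemma toeplitz_bounds_aux:
  assumes \<tau>: "isom_mult \<tau>" and V: "V \<subseteq> H2" "cfun.subspace V"
    and a: "\<And>g h. g \<in> H2 \<Longrightarrow> h \<in> V \<Longrightarrow> h2_inner (\<tau> * g) h = a * h2_inner g h" "norm a < 1"
    and F: "\<And>n. F n \<in> V"
  defines "\<alpha> \<equiv> norm a"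
  shows "\<exists>g\<in>V. (\<forall>h\<in>V. h2_inner (\<Sum>n<N. \<tau> ^ n * F n) h = h2_inner g h) \<and>
    (1 - \<alpha>) * ((h2_norm (\<Sum>n<N. \<tau> ^ n * F n))\<^sup>2 + \<alpha> * (h2_norm g)\<^sup>2) \<le> (1 + \<alpha>) * (\<Sum>n<N. (h2_norm (F n))\<^sup>2) \<and>
    (1 - \<alpha>) * (\<Sum>n<N. (h2_norm (F n))\<^sup>2) + \<alpha> * (1 + \<alpha>) * (h2_norm g)\<^sup>2 \<le> (1 + \<alpha>) * (h2_norm (\<Sum>n<N. \<tau> ^ n * F n))\<^sup>2"
  using F
proof (induction N arbitrary: F)
  case 0
  have "h2_norm (\<Sum>n<0. \<tau> ^ n * F n) = 0" by (simp only: lessThan_0 sum.empty h2_norm_0)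
  then show ?case
    by (intro bexI[of _ 0] cfun.subspace_0[OF V(2)]) (simp_all only: lessThan_0 sum.empty h2_norm_0, simp)
next
  case (Suc N)
  define s' where "s' = (\<Sum>n<N. \<tau> ^ n * F (Suc n))"
  define s where "s = (\<Sum>n<Suc N. \<tau> ^ n * F n)"
  define E' where "E' = (\<Sum>n<N. (h2_norm (F (Suc n)))\<^sup>2)"
  obtain g' where g': "g' \<in> V" "\<And>h. h \<in> V \<Longrightarrow> h2_inner s' h = h2_inner g' h"
    and up: "(1 - \<alpha>) * ((h2_norm s')\<^sup>2 + \<alpha> * (h2_norm g')\<^sup>2) \<le> (1 + \<alpha>) * E'"
    and lo: "(1 - \<alpha>) * E' + \<alpha> * (1 + \<alpha>) * (h2_norm g')\<^sup>2 \<le> (1 + \<alpha>) * (h2_norm s')\<^sup>2"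
    using Suc.IH[of "\<lambda>n. F (Suc n)"] Suc.prems unfolding s'_def E'_def by blast
  have VH: "h \<in> H2" if "h \<in> V" for h using that V(1) by blast
  have s'H: "s' \<in> H2" unfolding s'_def
    by (intro H2_sum isom_mult_in_H2[OF isom_mult_power[OF \<tau>]] VH Suc.prems)
  have g'H: "g' \<in> H2" by (rule VH[OF g'(1)])
  \<comment> \<open>the orthogonal decomposition \<open>s = g + \<rho>\<close> with respect to \<open>V\<close>\<close>
  define \<rho> where "\<rho> = \<tau> * s' - cscale a g'"
  define g where "g = F 0 + cscale a g'"
  have gV: "g \<in> V" unfolding g_def by (intro cfun.subspace_add[OF V(2)] cfun.subspace_scale[OF V(2)] Suc.prems g')
  have gH: "g \<in> H2" by (rule VH[OF gV])
  have \<tau>s'H: "\<tau> * s' \<in> H2" by (rule isom_mult_in_H2[OF \<tau> s'H])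
  have \<rho>H: "\<rho> \<in> H2" unfolding \<rho>_def by (intro H2_diff \<tau>s'H H2_cscale g'H)
  have s_eq: "s = g + \<rho>"
  proof -
    have "s = F 0 + \<tau> * s'"
      unfolding s_def s'_def sum.lessThan_Suc_shift sum_distrib_left by (simp add: mult.assoc)
    then show ?thesis by (simp add: g_def \<rho>_def)
  qed
  have \<rho>V: "h2_inner \<rho> h = 0" if h: "h \<in> V" for h
    unfolding \<rho>_def
    using a(1)[OF s'H h] g'(2)[OF h] by (simp add: inner_diff_left \<tau>s'H H2_cscale g'H VH[OF h] inner_cscale_left)
  have g\<rho>: "h2_inner g \<rho> = 0" using \<rho>V[OF gV] inner_cnj[of \<rho> g] by simp
  have norm_\<rho>: "(h2_norm \<rho>)\<^sup>2 = (h2_norm s')\<^sup>2 - \<alpha>\<^sup>2 * (h2_norm g')\<^sup>2"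
  proof -
    have "h2_inner (\<tau> * s') (cscale a g') = of_real (\<alpha>\<^sup>2 * (h2_norm g')\<^sup>2)"
      using a(1)[OF s'H g'(1)] g'(2)[OF g'(1)] norm_sq_eq_inner[OF g'H] complex_norm_square[of a]
      by (simp add: inner_cscale_right[OF g'H] \<alpha>_def mult_ac)
    then show ?thesis
      unfolding \<rho>_def norm_diff_sq[OF \<tau>s'H H2_cscale[OF g'H]]
      by (simp add: isom_mult_norm[OF \<tau> s'H] norm_cscale[OF g'H] power_mult_distrib \<alpha>_def)
  qed
  have norm_s: "(h2_norm s)\<^sup>2 = (h2_norm g)\<^sup>2 + (h2_norm s')\<^sup>2 - \<alpha>\<^sup>2 * (h2_norm g')\<^sup>2"
    unfolding s_eq pythagoras[OF gH \<rho>H g\<rho>] norm_\<rho> by simp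
  have F0: "F 0 = g - cscale a g'" by (simp add: g_def)
  have cs: "\<bar>2 * Re (h2_inner g (cscale a g'))\<bar> \<le> \<alpha> * ((h2_norm g)\<^sup>2 + (h2_norm g')\<^sup>2)"
  proof -
    have "\<bar>Re (h2_inner g (cscale a g'))\<bar> \<le> h2_norm g * (\<alpha> * h2_norm g')"
      using abs_Re_le_cmod[of "h2_inner g (cscale a g')"] Cauchy_Schwarz[OF gH H2_cscale[OF g'H], of a]
      by (simp add: norm_cscale[OF g'H] \<alpha>_def)
    moreover have "\<alpha> * (2 * h2_norm g * h2_norm g') \<le> \<alpha> * ((h2_norm g)\<^sup>2 + (h2_norm g')\<^sup>2)"
      using sum_squares_bound[of "h2_norm g" "h2_norm g'"] by (intro mult_left_mono) (auto simp: \<alpha>_def)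
    ultimately show ?thesis by (simp add: abs_mult mult_ac)
  qed
  have norm_F0: "(h2_norm (F 0))\<^sup>2 = (h2_norm g)\<^sup>2 + \<alpha>\<^sup>2 * (h2_norm g')\<^sup>2 - 2 * Re (h2_inner g (cscale a g'))"
    unfolding F0 norm_diff_sq[OF gH H2_cscale[OF g'H]] by (simp add: norm_cscale[OF g'H] power_mult_distrib \<alpha>_def)
  define q q' Q' f0 where "q = (h2_norm g)\<^sup>2" and "q' = (h2_norm g')\<^sup>2" and "Q' = (h2_norm s')\<^sup>2"
    and "f0 = (h2_norm (F 0))\<^sup>2"
  have f0_lo: "(1 - \<alpha>) * (q - \<alpha> * q') \<le> f0" and f0_up: "f0 \<le> (1 + \<alpha>) * (q + \<alpha> * q')"
    using cs norm_F0 unfolding q_def[symmetric] q'_def[symmetric] f0_def[symmetric]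
    by (simp_all add: abs_le_iff algebra_simps power2_eq_square)
  have \<alpha>: "0 \<le> \<alpha>" "\<alpha> < 1" using a(2) by (auto simp: \<alpha>_def)
  have E: "(\<Sum>n<Suc N. (h2_norm (F n))\<^sup>2) = f0 + E'"
    unfolding sum.lessThan_Suc_shift by (simp add: f0_def E'_def)
  have "(1 - \<alpha>) * ((q + Q' - \<alpha>\<^sup>2 * q') + \<alpha> * q) \<le> (1 + \<alpha>) * (f0 + E')"
  proof -
    have "(1 + \<alpha>) * ((1 - \<alpha>) * (q - \<alpha> * q')) \<le> (1 + \<alpha>) * f0"
      using f0_lo \<alpha> by (intro mult_left_mono) auto
    moreover have "(1 - \<alpha>) * ((q + Q' - \<alpha>\<^sup>2 * q') + \<alpha> * q)
        = (1 + \<alpha>) * ((1 - \<alpha>) * (q - \<alpha> * q')) + (1 - \<alpha>) * (Q' + \<alpha> * q')"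
      by (simp add: algebra_simps power2_eq_square)
    ultimately show ?thesis using up unfolding q'_def Q'_def by (simp add: distrib_left)
  qed
  moreover have "(1 - \<alpha>) * (f0 + E') + \<alpha> * (1 + \<alpha>) * q \<le> (1 + \<alpha>) * (q + Q' - \<alpha>\<^sup>2 * q')"
  proof -
    have "(1 - \<alpha>) * f0 \<le> (1 - \<alpha>) * ((1 + \<alpha>) * (q + \<alpha> * q'))"
      using f0_up \<alpha> by (intro mult_left_mono) auto
    moreover have "(1 - \<alpha>) * ((1 + \<alpha>) * (q + \<alpha> * q')) + \<alpha> * (1 + \<alpha>) * q
        = (1 + \<alpha>) * (q + Q' - \<alpha>\<^sup>2 * q') - (1 + \<alpha>) * Q' + \<alpha> * (1 + \<alpha>) * q'"
      by (simp add: algebra_simps power2_eq_square)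
    moreover have "(1 - \<alpha>) * (f0 + E') = (1 - \<alpha>) * f0 + (1 - \<alpha>) * E'" by (rule distrib_left)
    ultimately show ?thesis using lo unfolding q'_def[symmetric] Q'_def[symmetric] by linarith
  qed
  moreover have "h2_inner s h = h2_inner g h" if h: "h \<in> V" for h
    unfolding s_eq inner_add_left[OF gH \<rho>H VH[OF h]] \<rho>V[OF h] by simp
  ultimately show ?case
    unfolding s_def[symmetric] E norm_s q_def q'_def Q'_def by (intro bexI[OF _ gV]) blast
qed

lemma toeplitz_bounds:
  assumes "isom_mult \<tau>" "V \<subseteq> H2" "cfun.subspace V"
    and "\<And>g h. g \<in> H2 \<Longrightarrow> h \<in> V \<Longrightarrow> h2_inner (\<tau> * g) h = a * h2_inner g h" "norm a < 1"
    and "\<And>n. F n \<in> V"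
  shows "(1 - norm a) / (1 + norm a) * (\<Sum>n<N. (h2_norm (F n))\<^sup>2) \<le> (h2_norm (\<Sum>n<N. \<tau> ^ n * F n))\<^sup>2"
    and "(h2_norm (\<Sum>n<N. \<tau> ^ n * F n))\<^sup>2 \<le> (1 + norm a) / (1 - norm a) * (\<Sum>n<N. (h2_norm (F n))\<^sup>2)"
proof -
  define E Q \<alpha> where "E = (\<Sum>n<N. (h2_norm (F n))\<^sup>2)" and "Q = (h2_norm (\<Sum>n<N. \<tau> ^ n * F n))\<^sup>2"
    and "\<alpha> = norm a"
  have \<alpha>: "0 \<le> \<alpha>" "\<alpha> < 1" using assms(5) by (auto simp: \<alpha>_def)
  obtain g where g: "(1 - \<alpha>) * (Q + \<alpha> * (h2_norm g)\<^sup>2) \<le> (1 + \<alpha>) * E"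
      "(1 - \<alpha>) * E + \<alpha> * (1 + \<alpha>) * (h2_norm g)\<^sup>2 \<le> (1 + \<alpha>) * Q"
    using toeplitz_bounds_aux[of \<tau> V a F N, OF assms(1-3) _ assms(5,6)] assms(4)
    unfolding E_def Q_def \<alpha>_def by blast
  have "0 \<le> (1 - \<alpha>) * (\<alpha> * (h2_norm g)\<^sup>2)" "0 \<le> \<alpha> * (1 + \<alpha>) * (h2_norm g)\<^sup>2" using \<alpha> by auto
  then have "(1 - \<alpha>) * Q \<le> (1 + \<alpha>) * E" "(1 - \<alpha>) * E \<le> (1 + \<alpha>) * Q"
    using g by (simp_all add: distrib_left)
  then show "(1 - norm a) / (1 + norm a) * E \<le> Q" "Q \<le> (1 + norm a) / (1 - norm a) * E"
    using \<alpha> unfolding \<alpha>_def[symmetric] by (simp_all add: field_simps)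
qed

lemma fixed_by_subspace: "cfun.subspace (fixed_by \<pi>)"
  by (rule cfun.subspaceI) (auto simp: fixed_by_def H2_add H2_cscale)

lemma fixed_by_mult:
  assumes "slice \<pi> S" "isom_mult \<tau>" "\<And>p. p \<in> bidisk \<Longrightarrow> \<tau> (\<pi> p) = \<tau> p" "F \<in> fixed_by \<pi>"
  shows "\<tau> * F \<in> fixed_by \<pi>"
  using assms isom_mult_in_H2 unfolding fixed_by_def by auto

lemma emon_0_fixed_by: "slice \<pi> S \<Longrightarrow> emon (0, 0) \<in> fixed_by \<pi>"
proof -
  assume \<pi>: "slice \<pi> S"
  have "emon (0, 0) p = emon (0, 0) (\<pi> p)" if "p \<in> bidisk" for p
    using \<pi> that unfolding slice_def emon_def mon_zero by (metis (full_types))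
  then show ?thesis unfolding fixed_by_def by (simp del: mem_Times_iff)
qed

text \<open>The maximum of the Poisson kernel at \<open>a\<close> on the circle; the minimum is its inverse.\<close>

definition poisson_const :: "complex \<Rightarrow> real" where
  "poisson_const a = (1 + norm a) / (1 - norm a)"

lemma poisson_const_pos: "norm a < 1 \<Longrightarrow> 0 < poisson_const a"
  unfolding poisson_const_def by (intro divide_pos_pos) (auto simp: add_pos_nonneg)

lemma inverse_poisson_const: "(1 - norm a) / (1 + norm a) = inverse (poisson_const a)"
  by (simp add: poisson_const_def)

locale inner_pair =
  fixes \<theta> \<phi> :: "complex \<Rightarrow> complex"
  assumes inner: "inner_function \<theta>" "inner_function \<phi>"
    and nonconstant: "\<not> \<theta> constant_on disk" "\<not> \<phi> constant_on disk"
begin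

abbreviation t1 where "t1 \<equiv> lift_z \<theta>"
abbreviation t2 where "t2 \<equiv> lift_w \<phi>"

definition comp_pt :: "complex \<times> complex \<Rightarrow> complex \<times> complex" where
  "comp_pt p = (\<theta> (fst p), \<phi> (snd p))"

abbreviation C where "C \<equiv> comp_op \<theta> \<phi>"

lemma comp_pt_bidisk: "p \<in> bidisk \<Longrightarrow> comp_pt p \<in> bidisk"
  using inner_function_less_1[OF inner(1) nonconstant(1)] inner_function_less_1[OF inner(2) nonconstant(2)]
  unfolding comp_pt_def mem_bidisk by simp

lemma norm_at_0: "norm (\<theta> 0) < 1" "norm (\<phi> 0) < 1"
  using inner_function_less_1[OF inner(1) nonconstant(1)] inner_function_less_1[OF inner(2) nonconstant(2)]
  by auto

lemma comp_op_eq: "C f = (\<lambda>p. if p \<in> bidisk then f (comp_pt p) else 0)"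
  by (auto simp: comp_op_def comp_pt_def)

lemma comp_op_apply: "p \<in> bidisk \<Longrightarrow> C f p = f (comp_pt p)"
  and comp_op_outside: "p \<notin> bidisk \<Longrightarrow> C f p = 0"
  unfolding comp_op_eq by (simp_all del: mem_Times_iff)

lemmas isom_t1 = isom_mult_lift(1)[OF inner(1)]
  and isom_t2 = isom_mult_lift(2)[OF inner(2)]

lemma t1_apply: "p \<in> bidisk \<Longrightarrow> t1 p = \<theta> (fst p)"
  and t2_apply: "p \<in> bidisk \<Longrightarrow> t2 p = \<phi> (snd p)"
  unfolding lift_z_def lift_w_def by (simp_all del: mem_Times_iff)

lemma pol_box:
  assumes "finite K"
  obtains N b where "pol K a = pol (box N) b"
proof -
  have "\<forall>\<^sub>F n in sequentially. K \<subseteq> box n"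
    using filterlim_box[unfolded filterlim_iff, rule_format, of "\<lambda>X. K \<subseteq> X"] assms
    by (auto simp: eventually_finite_subsets_at_top)
  then obtain N where "K \<subseteq> box N" by (auto simp: eventually_sequentially)
  then have "pol K a = pol (box N) (\<lambda>k. if k \<in> K then a k else 0)"
    by (intro H2_coeffs_eqI) (auto simp: h2_coeffs_pol assms fun_eq_iff)
  then show ?thesis by (rule that)
qed

lemma sum_box: "(\<Sum>k\<in>box N. f k) = (\<Sum>i<N. \<Sum>j<N. f (i, j))"
  unfolding box_def by (simp add: sum.cartesian_product)

lemma comp_op_pol:
  "C (pol (box N) b) = (\<Sum>i<N. t1 ^ i * (\<Sum>j<N. t2 ^ j * cscale (b (i, j)) (emon (0, 0))))"
proof
  fix p
  have sum_apply: "(\<Sum>i<N. F i) p = (\<Sum>i<N. F i p)" for F :: "nat \<Rightarrow> fun2"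
    by (induction N) simp_all
  show "C (pol (box N) b) p = (\<Sum>i<N. t1 ^ i * (\<Sum>j<N. t2 ^ j * cscale (b (i, j)) (emon (0, 0)))) p"
  proof (cases "p \<in> bidisk")
    case True
    have "C (pol (box N) b) p = (\<Sum>k\<in>box N. b k * mon k (comp_pt p))"
      using True comp_pt_bidisk[OF True] by (simp add: comp_op_apply pol_apply del: mem_Times_iff)
    also have "\<dots> = (\<Sum>i<N. \<Sum>j<N. \<theta> (fst p) ^ i * (\<phi> (snd p) ^ j * b (i, j)))"
      unfolding sum_box by (simp add: mon_def comp_pt_def mult_ac)
    also have "\<dots> = (\<Sum>i<N. t1 ^ i * (\<Sum>j<N. t2 ^ j * cscale (b (i, j)) (emon (0, 0)))) p"
      using True by (simp add: sum_apply fun_power_apply t1_apply t2_apply emon_def sum_distrib_left del: mem_Times_iff)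
    finally show ?thesis .
  next
    case False
    then show ?thesis
      by (simp add: comp_op_outside sum_apply emon_def del: mem_Times_iff)
  qed
qed

text \<open>The Toeplitz bounds apply twice: to the powers of \<open>\<theta>\<close>, with functions of \<open>w\<close> as coefficients,
  and to the powers of \<open>\<phi>\<close>, with constants as coefficients.\<close>

lemma comp_op_pol_bounds:
  assumes "finite K"
  shows "C (pol K a) \<in> H2"
    and "inverse (poisson_const (\<theta> 0)) * inverse (poisson_const (\<phi> 0)) * (h2_norm (pol K a))\<^sup>2 \<le> (h2_norm (C (pol K a)))\<^sup>2"
    and "(h2_norm (C (pol K a)))\<^sup>2 \<le> poisson_const (\<theta> 0) * poisson_const (\<phi> 0) * (h2_norm (pol K a))\<^sup>2"
proof -
  obtain N b where Nb: "pol K a = pol (box N) b" using pol_box[OF assms] .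
  define c where "c i j = cscale (b (i, j)) (emon (0, 0))" for i j
  define F where "F i = (\<Sum>j<N. t2 ^ j * c i j)" for i
  have cV: "c i j \<in> fixed_by (\<lambda>p. (fst p, 0))" for i j
    unfolding c_def by (intro cfun.subspace_scale[OF fixed_by_subspace] emon_0_fixed_by[OF slice_w])
  have cZ: "c i j \<in> fixed_by (\<lambda>p. (0, snd p))" for i j
    unfolding c_def by (intro cfun.subspace_scale[OF fixed_by_subspace] emon_0_fixed_by[OF slice_z])
  have FV: "F i \<in> fixed_by (\<lambda>p. (0, snd p))" for i
    unfolding F_def
  proof (intro cfun.subspace_sum[OF fixed_by_subspace])
    fix j
    show "t2 ^ j * c i j \<in> fixed_by (\<lambda>p. (0, snd p))"
      by (rule fixed_by_mult[OF slice_z isom_mult_power[OF isom_t2] _ cZ])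
        (auto simp: fun_power_apply lift_w_def)
  qed
  have nb: "(h2_norm (pol K a))\<^sup>2 = (\<Sum>i<N. \<Sum>j<N. (h2_norm (c i j))\<^sup>2)"
    unfolding Nb norm_pol[OF finite_box] sum_box by (simp add: c_def norm_cscale)
  have Ceq: "C (pol K a) = (\<Sum>i<N. t1 ^ i * F i)"
    unfolding Nb comp_op_pol F_def c_def ..
  show "C (pol K a) \<in> H2"
    unfolding Ceq by (intro H2_sum isom_mult_in_H2[OF isom_mult_power[OF isom_t1]] fixed_byD[OF FV])
  have sub: "fixed_by \<pi> \<subseteq> H2" for \<pi> by (auto simp: fixed_by_def)
  note B1 = toeplitz_bounds[OF isom_t1 sub fixed_by_subspace
      inner_mult_fixed_by[OF slice_z isom_t1, of "\<theta> 0"] norm_at_0(1), where F = F and N = N]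
  note B2 = toeplitz_bounds[OF isom_t2 sub fixed_by_subspace
      inner_mult_fixed_by[OF slice_w isom_t2, of "\<phi> 0"] norm_at_0(2), where N = N]
  have pos: "0 \<le> poisson_const (\<theta> 0)" "0 \<le> inverse (poisson_const (\<theta> 0))"
    using poisson_const_pos[OF norm_at_0(1)] by auto
  have F_lo: "inverse (poisson_const (\<phi> 0)) * (\<Sum>j<N. (h2_norm (c i j))\<^sup>2) \<le> (h2_norm (F i))\<^sup>2"
    and F_up: "(h2_norm (F i))\<^sup>2 \<le> poisson_const (\<phi> 0) * (\<Sum>j<N. (h2_norm (c i j))\<^sup>2)" for i
    using B2[where F = "c i"] cV unfolding F_def poisson_const_def[symmetric] inverse_poisson_const
    by (auto simp: lift_w_def)
  have C_lo: "inverse (poisson_const (\<theta> 0)) * (\<Sum>i<N. (h2_norm (F i))\<^sup>2) \<le> (h2_norm (C (pol K a)))\<^sup>2"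
    and C_up: "(h2_norm (C (pol K a)))\<^sup>2 \<le> poisson_const (\<theta> 0) * (\<Sum>i<N. (h2_norm (F i))\<^sup>2)"
    using B1 FV unfolding Ceq poisson_const_def[symmetric] inverse_poisson_const
    by (auto simp: lift_z_def)
  have "inverse (poisson_const (\<theta> 0)) * (inverse (poisson_const (\<phi> 0)) * (h2_norm (pol K a))\<^sup>2)
      \<le> inverse (poisson_const (\<theta> 0)) * (\<Sum>i<N. (h2_norm (F i))\<^sup>2)"
    unfolding nb
    by (subst sum_distrib_left[of "inverse (poisson_const (\<phi> 0))"]) (rule mult_left_mono[OF sum_mono[OF F_lo] pos(2)])
  then show "inverse (poisson_const (\<theta> 0)) * inverse (poisson_const (\<phi> 0)) * (h2_norm (pol K a))\<^sup>2 \<le> (h2_norm (C (pol K a)))\<^sup>2"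
    using C_lo by (simp add: mult.assoc)
  have "poisson_const (\<theta> 0) * (\<Sum>i<N. (h2_norm (F i))\<^sup>2)
      \<le> poisson_const (\<theta> 0) * (poisson_const (\<phi> 0) * (h2_norm (pol K a))\<^sup>2)"
    unfolding nb
    by (subst sum_distrib_left[of "poisson_const (\<phi> 0)"]) (rule mult_left_mono[OF sum_mono[OF F_up] pos(1)])
  then show "(h2_norm (C (pol K a)))\<^sup>2 \<le> poisson_const (\<theta> 0) * poisson_const (\<phi> 0) * (h2_norm (pol K a))\<^sup>2"
    using C_up by (simp add: mult.assoc)
qed

definition \<kappa> :: real where
  "\<kappa> = poisson_const (\<theta> 0) * poisson_const (\<phi> 0)"

lemma \<kappa>_pos: "0 < \<kappa>"
  unfolding \<kappa>_def by (intro mult_pos_pos poisson_const_pos norm_at_0)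

lemma comp_op_bounds:
  assumes "f \<in> H2"
  shows comp_op_in_H2: "C f \<in> H2"
    and comp_op_lower: "inverse \<kappa> * (h2_norm f)\<^sup>2 \<le> (h2_norm (C f))\<^sup>2"
    and comp_op_upper: "(h2_norm (C f))\<^sup>2 \<le> \<kappa> * (h2_norm f)\<^sup>2"
proof -
  have eq: "(\<lambda>p. if p \<in> bidisk then 1 * f (comp_pt p) else 0) = C f" for f
    by (auto simp: comp_op_eq fun_eq_iff)
  show "C f \<in> H2" "inverse \<kappa> * (h2_norm f)\<^sup>2 \<le> (h2_norm (C f))\<^sup>2" "(h2_norm (C f))\<^sup>2 \<le> \<kappa> * (h2_norm f)\<^sup>2"
    using weighted_composition_bounds[of comp_pt "\<lambda>_. 1" "inverse \<kappa>" \<kappa> f] comp_pt_bidisk comp_op_pol_bounds assms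
    unfolding eq \<kappa>_def by (simp_all add: inverse_mult_distrib)
qed

end

section \<open>Division by one minus a multiplier\<close>

text \<open>The sum of the geometric series \<open>\<Sum> c\<^sup>n \<tau>\<^sup>n f\<close>.\<close>

definition geo :: "fun2 \<Rightarrow> complex \<Rightarrow> fun2 \<Rightarrow> fun2" where
  "geo \<tau> c f = (\<lambda>p. f p / (1 - c * \<tau> p))"

lemma geo_0 [simp]: "geo \<tau> 0 f = f"
  by (simp add: geo_def)

lemma mult_geo: "\<sigma> * geo \<tau> c f = geo \<tau> c (\<sigma> * f)"
  by (simp add: geo_def fun_eq_iff)

lemma norm_sum_le:
  "(\<And>i. i \<in> A \<Longrightarrow> F i \<in> H2) \<Longrightarrow> h2_norm (sum F A) \<le> (\<Sum>i\<in>A. h2_norm (F i))"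
proof (induction A rule: infinite_finite_induct)
  case (infinite A)
  then show ?case unfolding sum.infinite[OF infinite.hyps] h2_norm_0 by simp
next
  case empty
  then show ?case unfolding sum.empty h2_norm_0 by simp
next
  case (insert x A)
  have "h2_norm (F x + sum F A) \<le> h2_norm (F x) + h2_norm (sum F A)"
    using insert.prems by (intro norm_triangle H2_sum) auto
  moreover have "h2_norm (sum F A) \<le> (\<Sum>i\<in>A. h2_norm (F i))"
    by (rule insert.IH) (use insert.prems in auto)
  ultimately show ?case unfolding sum.insert[OF insert.hyps(1,2)] by linarith
qed

text \<open>The geometric series converges in norm, so its sum stays in every closed subspace that contains
  its terms.\<close>

lemma geo_bounds:
  assumes \<tau>: "isom_mult \<tau>" and c: "norm c < 1" and R: "closed_subspace R"
    and f: "f \<in> H2" and in_R: "\<And>n. \<tau> ^ n * f \<in> R"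
  shows geo_in: "geo \<tau> c f \<in> R" and norm_geo_le: "h2_norm (geo \<tau> c f) \<le> h2_norm f / (1 - norm c)"
proof -
  define u where "u n = cscale (c ^ n) (\<tau> ^ n * f)" for n
  define s where "s N = (\<Sum>n<N. u n)" for N
  have uR: "u n \<in> R" for n unfolding u_def by (intro closed_subspaceD[OF R] in_R)
  have uH: "u n \<in> H2" for n by (rule closed_subspaceD(1)[OF R uR])
  have sH: "s N \<in> H2" for N unfolding s_def by (intro H2_sum uH)
  have sR: "s N \<in> R" for N
    unfolding s_def using R uR by (intro cfun.subspace_sum) (auto simp: closed_subspace_def)
  have nu: "h2_norm (u n) = norm c ^ n * h2_norm f" for n
    unfolding u_def norm_cscale[OF isom_mult_in_H2[OF isom_mult_power[OF \<tau>] f]]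
      isom_mult_norm[OF isom_mult_power[OF \<tau>] f] by (simp add: norm_power)
  have geom: "summable (\<lambda>n. norm c ^ n)" using c by (intro summable_geometric) simp
  have diff: "h2_norm (s m - s n) \<le> norm ((\<Sum>i<m. norm c ^ i * h2_norm f) - (\<Sum>i<n. norm c ^ i * h2_norm f))"
    if "n \<le> m" for m n
  proof -
    have "s m - s n = (\<Sum>i\<in>{n..<m}. u i)" unfolding s_def using that
      by (simp add: lessThan_atLeast0 sum_diff_nat_ivl)
    then have "h2_norm (s m - s n) \<le> (\<Sum>i\<in>{n..<m}. norm c ^ i * h2_norm f)"
      using norm_sum_le[of "{n..<m}" u] uH by (simp only: nu)
    also have "\<dots> = (\<Sum>i<m. norm c ^ i * h2_norm f) - (\<Sum>i<n. norm c ^ i * h2_norm f)"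
      using that by (simp add: lessThan_atLeast0 sum_diff_nat_ivl)
    finally show ?thesis by simp
  qed
  obtain g where g: "h2_lim s g"
  proof (rule H2_complete[OF sH])
    fix e :: real assume e: "e > 0"
    have "Cauchy (\<lambda>N. \<Sum>i<N. norm c ^ i * h2_norm f)"
      using summable_mult2[OF geom, of "h2_norm f"] by (simp add: summable_iff_convergent Cauchy_convergent_iff)
    then obtain N where N: "\<forall>m\<ge>N. \<forall>n\<ge>N. norm ((\<Sum>i<m. norm c ^ i * h2_norm f) - (\<Sum>i<n. norm c ^ i * h2_norm f)) < e"
      using CauchyD[OF _ e] by blast
    have "h2_norm (s m - s n) < e" if "m \<ge> N" "n \<ge> N" for m n
    proof (cases "n \<le> m")
      case True
      then show ?thesis using diff N that order_le_less_trans by blast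
    next
      case False
      then have "m \<le> n" by simp
      then have "h2_norm (s n - s m) < e" using diff N that order_le_less_trans by blast
      then show ?thesis by (simp only: h2_norm_minus_commute[OF sH sH, of m n])
    qed
    then show "\<exists>N. \<forall>m\<ge>N. \<forall>n\<ge>N. h2_norm (s m - s n) < e" by blast
  qed
  have gH: "g \<in> H2" by (rule h2_limD(2)[OF g])
  have s_apply: "s N p = (\<Sum>n<N. (c * \<tau> p) ^ n * f p)" for N p
    unfolding s_def by (induction N) (simp_all add: u_def fun_power_apply power_mult_distrib)
  have eq: "geo \<tau> c f = g"
  proof
    fix p
    show "geo \<tau> c f p = g p"
    proof (cases "p \<in> bidisk")
      case True
      have "norm (c * \<tau> p) \<le> norm c * 1"
        unfolding norm_mult by (intro mult_left_mono isom_mult_le_1[OF \<tau> True]) simp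
      then have "norm (c * \<tau> p) < 1" using c by simp
      from sums_mult2[OF geometric_sums[OF this], of "f p"]
      have "(\<lambda>N. s N p) \<longlonglongrightarrow> geo \<tau> c f p" by (simp add: sums_def s_apply geo_def)
      then show ?thesis using h2_lim_eval[OF g True] LIMSEQ_unique by blast
    next
      case False
      then show ?thesis using H2_outside[OF f False] H2_outside[OF gH False] by (simp add: geo_def)
    qed
  qed
  show "geo \<tau> c f \<in> R" unfolding eq by (rule closed_subspace_lim[OF R g sR])
  show "h2_norm (geo \<tau> c f) \<le> h2_norm f / (1 - norm c)"
    unfolding eq
  proof (rule LIMSEQ_le_const2[OF h2_lim_norm[OF g]], intro exI allI impI)
    fix N
    have "h2_norm (s N) \<le> (\<Sum>i<N. norm c ^ i * h2_norm f)"
      using norm_sum_le[of "{..<N}" u] uH unfolding s_def nu by simp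
    also have "\<dots> = (\<Sum>i<N. norm c ^ i) * h2_norm f" by (simp add: sum_distrib_right)
    also have "\<dots> \<le> (\<Sum>i. norm c ^ i) * h2_norm f"
      by (intro mult_right_mono sum_le_suminf geom) auto
    also have "\<dots> = h2_norm f / (1 - norm c)" using c by (simp add: suminf_geometric)
    finally show "h2_norm (s N) \<le> h2_norm f / (1 - norm c)" .
  qed
qed

lemma geo_in_H2: "isom_mult \<tau> \<Longrightarrow> norm c < 1 \<Longrightarrow> f \<in> H2 \<Longrightarrow> geo \<tau> c f \<in> H2"
  by (rule geo_in) (auto intro: isom_mult_in_H2 isom_mult_power)

lemma geo_norm: "isom_mult \<tau> \<Longrightarrow> norm c < 1 \<Longrightarrow> f \<in> H2 \<Longrightarrow> h2_norm (geo \<tau> c f) \<le> h2_norm f / (1 - norm c)"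
  by (rule norm_geo_le[where R = H2]) (auto intro: isom_mult_in_H2 isom_mult_power)

lemma denominator_nonzero:
  assumes "isom_mult \<tau>" "norm c < 1" "p \<in> bidisk"
  shows "1 - c * \<tau> p \<noteq> 0"
proof
  assume "1 - c * \<tau> p = 0"
  then have "norm (c * \<tau> p) = 1" by (metis eq_iff_diff_eq_0 norm_one)
  moreover have "norm (c * \<tau> p) \<le> norm c * 1"
    unfolding norm_mult by (intro mult_left_mono isom_mult_le_1 assms) simp
  ultimately show False using assms(2) by simp
qed

lemma bounded_op_geo:
  assumes "isom_mult \<tau>" "norm c < 1"
  shows "bounded_op H2 (geo \<tau> c)"
  unfolding bounded_op_def
proof (intro conjI ballI allI)
  show "\<exists>C. \<forall>f\<in>H2. h2_norm (geo \<tau> c f) \<le> C * h2_norm f"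
    using geo_norm[OF assms] by (intro exI[of _ "1 / (1 - norm c)"]) simp
  show "geo \<tau> c f \<in> H2" if "f \<in> H2" for f by (rule geo_in_H2[OF assms that])
qed (auto simp: geo_def fun_eq_iff add_divide_distrib)

lemma bounded_op_compose:
  assumes "bounded_op H2 A" "bounded_op H2 B"
  shows "bounded_op H2 (\<lambda>f. A (B f))"
proof -
  obtain a where a: "\<And>f. f \<in> H2 \<Longrightarrow> h2_norm (A f) \<le> a * h2_norm f" using assms(1) unfolding bounded_op_def by blast
  obtain b where b: "\<And>f. f \<in> H2 \<Longrightarrow> h2_norm (B f) \<le> b * h2_norm f" using assms(2) unfolding bounded_op_def by blast
  have B: "B f \<in> H2" if "f \<in> H2" for f using assms(2) that unfolding bounded_op_def by blast
  have "h2_norm (A (B f)) \<le> (\<bar>a\<bar> * b) * h2_norm f" if "f \<in> H2" for f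
  proof -
    have "h2_norm (A (B f)) \<le> \<bar>a\<bar> * h2_norm (B f)"
      using a[OF B[OF that]] mult_right_mono[OF abs_ge_self[of a] h2_norm_nonneg[of "B f"]] by linarith
    also have "\<dots> \<le> \<bar>a\<bar> * (b * h2_norm f)" by (intro mult_left_mono b that) simp
    finally show ?thesis by (simp add: mult.assoc)
  qed
  then have "\<exists>C. \<forall>f\<in>H2. h2_norm (A (B f)) \<le> C * h2_norm f" by blast
  then show ?thesis using assms unfolding bounded_op_def by simp
qed

lemma bounded_op_diff_cscale:
  assumes A: "bounded_op H2 A"
  shows "bounded_op H2 (\<lambda>f. f - cscale c (A f))"
proof -
  obtain a where a: "\<And>f. f \<in> H2 \<Longrightarrow> h2_norm (A f) \<le> a * h2_norm f" using A unfolding bounded_op_def by blast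
  have AH: "A f \<in> H2" if "f \<in> H2" for f using A that unfolding bounded_op_def by blast
  have "h2_norm (f - cscale c (A f)) \<le> (1 + norm c * a) * h2_norm f" if f: "f \<in> H2" for f
  proof -
    have "f - cscale c (A f) = f + cscale (- c) (A f)" by (simp add: fun_eq_iff)
    then have "h2_norm (f - cscale c (A f)) \<le> h2_norm f + h2_norm (cscale (- c) (A f))"
      using norm_triangle[OF f H2_cscale[OF AH[OF f], of "- c"]] by (simp only:)
    moreover have "h2_norm (cscale (- c) (A f)) = norm c * h2_norm (A f)"
      unfolding norm_cscale[OF AH[OF f]] by simp
    moreover have "norm c * h2_norm (A f) \<le> norm c * (a * h2_norm f)" by (intro mult_left_mono a f) simp
    moreover have "(1 + norm c * a) * h2_norm f = h2_norm f + norm c * (a * h2_norm f)"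
      by (simp add: distrib_right)
    ultimately show ?thesis by linarith
  qed
  then have "\<exists>C. \<forall>f\<in>H2. h2_norm (f - cscale c (A f)) \<le> C * h2_norm f" by blast
  moreover have "f - cscale c (A f) \<in> H2" if "f \<in> H2" for f by (intro H2_diff H2_cscale AH that)
  moreover have "(f + g) - cscale c (A (f + g)) = (f - cscale c (A f)) + (g - cscale c (A g))"
    if "f \<in> H2" "g \<in> H2" for f g
  proof -
    have "A (f + g) = A f + A g" using A that unfolding bounded_op_def by blast
    then show ?thesis by (simp add: fun_eq_iff algebra_simps)
  qed
  moreover have "cscale d f - cscale c (A (cscale d f)) = cscale d (f - cscale c (A f))" if "f \<in> H2" for d f
  proof -
    have "A (cscale d f) = cscale d (A f)" using A that unfolding bounded_op_def by blast
    then show ?thesis by (simp add: fun_eq_iff algebra_simps)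
  qed
  ultimately show ?thesis unfolding bounded_op_def by blast
qed

lemma bounded_op_mult: "isom_mult \<tau> \<Longrightarrow> bounded_op H2 ((*) \<tau>)"
  by (rule bounded_op_isom_mult[OF closed_subspace_H2]) (auto intro: isom_mult_in_H2)

lemma bounded_functional_op:
  assumes A: "bounded_op H2 A" and h: "h \<in> H2"
  shows "bounded_functional (\<lambda>g. h2_inner (A g) h)"
proof -
  obtain a where a: "\<And>f. f \<in> H2 \<Longrightarrow> h2_norm (A f) \<le> a * h2_norm f" using A unfolding bounded_op_def by blast
  have AH: "A f \<in> H2" if "f \<in> H2" for f using A that unfolding bounded_op_def by blast
  have "norm (h2_inner (A f) h) \<le> (a * h2_norm h) * h2_norm f" if f: "f \<in> H2" for f
  proof -
    have "norm (h2_inner (A f) h) \<le> h2_norm (A f) * h2_norm h" by (rule Cauchy_Schwarz[OF AH[OF f] h])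
    also have "\<dots> \<le> (a * h2_norm f) * h2_norm h" by (intro mult_right_mono a f) simp
    finally show ?thesis by (simp add: mult_ac)
  qed
  moreover have "h2_inner (A (f + g)) h = h2_inner (A f) h + h2_inner (A g) h" if "f \<in> H2" "g \<in> H2" for f g
  proof -
    have "A (f + g) = A f + A g" using A that unfolding bounded_op_def by blast
    then show ?thesis using inner_add_left[OF AH[OF that(1)] AH[OF that(2)] h] by (simp only:)
  qed
  moreover have "h2_inner (A (cscale c f)) h = c * h2_inner (A f) h" if "f \<in> H2" for c f
  proof -
    have "A (cscale c f) = cscale c (A f)" using A that unfolding bounded_op_def by blast
    then show ?thesis using inner_cscale_left[OF AH[OF that]] by (simp only:)
  qed
  ultimately show ?thesis unfolding bounded_functional_def by blast
qed

section \<open>Tensor products\<close>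

lemma summable_product_nonneg:
  fixes f g :: "nat \<Rightarrow> real"
  assumes "f summable_on UNIV" "g summable_on UNIV" "\<And>i. 0 \<le> f i" "\<And>j. 0 \<le> g j"
  shows "(\<lambda>k. f (fst k) * g (snd k)) summable_on (UNIV :: (nat \<times> nat) set)"
proof -
  have "(\<lambda>k. f (fst k) * g (snd k)) summable_on (Sigma UNIV (\<lambda>_. UNIV) :: (nat \<times> nat) set)"
  proof (rule summable_on_SigmaI)
    show "((\<lambda>j. f (fst (i, j)) * g (snd (i, j))) has_sum (f i * infsum g UNIV)) UNIV" for i
      using has_sum_cmult_right[OF has_sum_infsum[OF assms(2)], of "f i"] by simp
    show "(\<lambda>i. f i * infsum g UNIV) summable_on UNIV" by (rule summable_on_cmult_left[OF assms(1)])
  qed (use assms in auto)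
  then show ?thesis by simp
qed

lemma has_sum_product:
  fixes f g :: "nat \<Rightarrow> complex"
  assumes f: "(f has_sum a) UNIV" and g: "(g has_sum b) UNIV"
  shows "((\<lambda>k. f (fst k) * g (snd k)) has_sum (a * b)) (UNIV :: (nat \<times> nat) set)"
proof -
  have "(\<lambda>k. norm (f (fst k)) * norm (g (snd k))) summable_on (UNIV :: (nat \<times> nat) set)"
    using has_sum_imp_summable[OF f] has_sum_imp_summable[OF g]
    unfolding summable_on_iff_abs_summable_on_complex
    by (rule summable_product_nonneg[of "\<lambda>i. norm (f i)" "\<lambda>j. norm (g j)"]) simp_all
  then have "(\<lambda>k. norm (f (fst k) * g (snd k))) summable_on (UNIV :: (nat \<times> nat) set)"
    by (simp only: norm_mult)
  from abs_summable_summable[OF this]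
  have sm: "(\<lambda>k. f (fst k) * g (snd k)) summable_on (UNIV \<times> UNIV)"
    by simp
  have "((\<lambda>k. f (fst k) * g (snd k)) has_sum (a * b)) (Sigma UNIV (\<lambda>_. UNIV) :: (nat \<times> nat) set)"
  proof (rule has_sum_SigmaI)
    show "((\<lambda>j. f (fst (i, j)) * g (snd (i, j))) has_sum (f i * b)) UNIV" for i
      using has_sum_cmult_right[OF g, of "f i"] by simp
    show "((\<lambda>i. f i * b) has_sum (a * b)) UNIV" by (rule has_sum_cmult_left[OF f])
  qed (rule sm)
  then show ?thesis by simp
qed

lemma has_sum_axisD:
  fixes g :: "nat \<times> nat \<Rightarrow> 'a :: {comm_monoid_add, topological_space}"
  assumes "(g has_sum s) UNIV"
  shows "(\<And>k. snd k \<noteq> 0 \<Longrightarrow> g k = 0) \<Longrightarrow> ((\<lambda>i. g (i, 0)) has_sum s) UNIV"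
    and "(\<And>k. fst k \<noteq> 0 \<Longrightarrow> g k = 0) \<Longrightarrow> ((\<lambda>j. g (0, j)) has_sum s) UNIV"
proof -
  have inj: "inj (\<lambda>i. (i, 0 :: nat))" "inj (\<lambda>j. (0 :: nat, j))" by (auto simp: inj_on_def)
  { assume z: "\<And>k. snd k \<noteq> 0 \<Longrightarrow> g k = 0"
    have "g k = 0" if "k \<notin> range (\<lambda>i. (i, 0))" for k using that by (intro z) (cases k, auto)
    then have "(g has_sum s) (range (\<lambda>i. (i, 0)))"
      using assms has_sum_cong_neutral[of "range (\<lambda>i. (i, 0))" UNIV g g s] by simp
    then show "((\<lambda>i. g (i, 0)) has_sum s) UNIV" unfolding has_sum_reindex[OF inj(1)] by (simp add: o_def) }
  { assume z: "\<And>k. fst k \<noteq> 0 \<Longrightarrow> g k = 0"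
    have "g k = 0" if "k \<notin> range (\<lambda>j. (0, j))" for k using that by (intro z) (cases k, auto)
    then have "(g has_sum s) (range (\<lambda>j. (0, j)))"
      using assms has_sum_cong_neutral[of "range (\<lambda>j. (0, j))" UNIV g g s] by simp
    then show "((\<lambda>j. g (0, j)) has_sum s) UNIV" unfolding has_sum_reindex[OF inj(2)] by (simp add: o_def) }
qed

abbreviation z_functions where "z_functions \<equiv> fixed_by (\<lambda>p. (fst p, 0))"
abbreviation w_functions where "w_functions \<equiv> fixed_by (\<lambda>p. (0, snd p))"

lemma tensor_has_h2_coeffs:
  assumes F: "F \<in> z_functions" and G: "G \<in> w_functions"
  shows "has_h2_coeffs (F * G) (\<lambda>k. h2_coeffs F (fst k, 0) * h2_coeffs G (0, snd k))"
  unfolding has_h2_coeffs_iff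
proof (intro conjI ballI allI impI)
  have FH: "F \<in> H2" and GH: "G \<in> H2" using F G by (auto simp: fixed_by_def)
  have F0: "snd k \<noteq> 0 \<Longrightarrow> h2_coeffs F k = 0" and G0: "fst k \<noteq> 0 \<Longrightarrow> h2_coeffs G k = 0" for k
    using fixed_by_coeffs_eq_0[OF slice_w F] fixed_by_coeffs_eq_0[OF slice_z G] by auto
  have "(\<lambda>i. (norm (h2_coeffs F (i, 0)))\<^sup>2) summable_on UNIV"
    by (rule has_sum_imp_summable[OF has_sum_axisD(1)[OF norm_coeffs_sums[OF FH]]]) (simp add: F0)
  moreover have "(\<lambda>j. (norm (h2_coeffs G (0, j)))\<^sup>2) summable_on UNIV"
    by (rule has_sum_imp_summable[OF has_sum_axisD(2)[OF norm_coeffs_sums[OF GH]]]) (simp add: G0)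
  ultimately show "ell2 (\<lambda>k. h2_coeffs F (fst k, 0) * h2_coeffs G (0, snd k))"
    unfolding ell2_def norm_mult power_mult_distrib
    by (rule summable_product_nonneg[of "\<lambda>i. (norm (h2_coeffs F (i, 0)))\<^sup>2" "\<lambda>j. (norm (h2_coeffs G (0, j)))\<^sup>2"])
      simp_all
  fix p
  show "(F * G) p = 0" if "p \<notin> bidisk" using H2_outside[OF FH that] by simp
  assume p: "p \<in> bidisk"
  have "((\<lambda>i. h2_coeffs F (i, 0) * mon (i, 0) p) has_sum F p) UNIV"
    by (rule has_sum_axisD(1)[OF H2_has_sum[OF FH p]]) (simp add: F0)
  moreover have "((\<lambda>j. h2_coeffs G (0, j) * mon (0, j) p) has_sum G p) UNIV"
    by (rule has_sum_axisD(2)[OF H2_has_sum[OF GH p]]) (simp add: G0)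
  ultimately show "((\<lambda>k. h2_coeffs F (fst k, 0) * h2_coeffs G (0, snd k) * mon k p) has_sum (F * G) p) UNIV"
    using has_sum_product by (fastforce simp: mon_def mult_ac)
qed

lemma inner_tensor:
  assumes F: "F \<in> z_functions" "F' \<in> z_functions" and G: "G \<in> w_functions" "G' \<in> w_functions"
  shows "h2_inner (F * G) (F' * G') = h2_inner F F' * h2_inner G G'"
proof -
  have H: "F \<in> H2" "F' \<in> H2" "G \<in> H2" "G' \<in> H2" using F G by (auto simp: fixed_by_def)
  have F0: "snd k \<noteq> 0 \<Longrightarrow> h2_coeffs F k = 0" and G0: "fst k \<noteq> 0 \<Longrightarrow> h2_coeffs G k = 0" for k
    using fixed_by_coeffs_eq_0[OF slice_w F(1)] fixed_by_coeffs_eq_0[OF slice_z G(1)] by auto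
  have "((\<lambda>i. h2_coeffs F (i, 0) * cnj (h2_coeffs F' (i, 0))) has_sum h2_inner F F') UNIV"
    unfolding h2_inner_def by (rule has_sum_axisD(1)[OF has_sum_infsum[OF inner_summable[OF H(1,2)]]]) (simp add: F0)
  moreover have "((\<lambda>j. h2_coeffs G (0, j) * cnj (h2_coeffs G' (0, j))) has_sum h2_inner G G') UNIV"
    unfolding h2_inner_def by (rule has_sum_axisD(2)[OF has_sum_infsum[OF inner_summable[OF H(3,4)]]]) (simp add: G0)
  ultimately have "((\<lambda>k. (h2_coeffs F (fst k, 0) * cnj (h2_coeffs F' (fst k, 0))) * (h2_coeffs G (0, snd k) * cnj (h2_coeffs G' (0, snd k))))
      has_sum (h2_inner F F' * h2_inner G G')) UNIV"
    by (rule has_sum_product)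
  then show ?thesis
    unfolding h2_inner_def[of "F * G"] h2_coeffs_eqI[OF tensor_has_h2_coeffs[OF F(1) G(1)]]
      h2_coeffs_eqI[OF tensor_has_h2_coeffs[OF F(2) G(2)]]
    by (intro infsumI) (simp add: mult_ac)
qed

section \<open>Model space kernels\<close>

text \<open>For an isometric multiplier \<open>\<tau>\<close> this is the projection of the Szego kernel to the orthogonal
  complement of the range of multiplication by \<open>\<tau>\<close>.\<close>

definition model_kernel :: "fun2 \<Rightarrow> complex \<times> complex \<Rightarrow> fun2" where
  "model_kernel \<tau> p = szego p - cscale (cnj (\<tau> p)) (\<tau> * szego p)"

lemma model_kernel_in_H2: "isom_mult \<tau> \<Longrightarrow> p \<in> bidisk \<Longrightarrow> model_kernel \<tau> p \<in> H2"
  unfolding model_kernel_def by (intro H2_diff H2_cscale isom_mult_in_H2 szego_in_H2)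

lemma inner_model_kernel_range:
  assumes \<tau>: "isom_mult \<tau>" and p: "p \<in> bidisk" and f: "f \<in> H2"
  shows "h2_inner (\<tau> * f) (model_kernel \<tau> p) = 0"
proof -
  note S = szego_in_H2[OF p] isom_mult_in_H2[OF \<tau> szego_in_H2[OF p]] isom_mult_in_H2[OF \<tau> f]
  have "h2_inner (\<tau> * f) (model_kernel \<tau> p) = (\<tau> * f) p - \<tau> p * h2_inner f (szego p)"
    unfolding model_kernel_def inner_diff_right[OF S(1) H2_cscale[OF S(2)] S(3)] inner_cscale_right[OF S(2)]
      inner_isom_mult[OF \<tau> f S(1)] inner_szego[OF S(3) p] by simp
  then show ?thesis unfolding inner_szego[OF f p] by simp
qed

lemma inner_model_kernel:
  assumes \<tau>: "isom_mult \<tau>" and p: "p \<in> bidisk" and p': "p' \<in> bidisk"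
  shows "h2_inner (model_kernel \<tau> p') (model_kernel \<tau> p) = model_kernel \<tau> p' p"
proof -
  note S = szego_in_H2[OF p] isom_mult_in_H2[OF \<tau> szego_in_H2[OF p]] model_kernel_in_H2[OF \<tau> p']
  have "h2_inner (model_kernel \<tau> p') (\<tau> * szego p) = 0"
    using inner_model_kernel_range[OF \<tau> p' S(1)] inner_cnj[of "\<tau> * szego p" "model_kernel \<tau> p'"] by simp
  then show ?thesis
    unfolding model_kernel_def[of \<tau> p] inner_diff_right[OF S(1) H2_cscale[OF S(2)] S(3)]
      inner_cscale_right[OF S(2)] inner_szego[OF S(3) p] by simp
qed

text \<open>For \<open>n > m\<close> the isometry \<open>\<tau>\<^sup>m\<close> cancels and leaves \<open>\<tau>\<close> times a function against a vector
  orthogonal to the range of \<open>\<tau>\<close>.\<close>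

lemma inner_model_kernel_powers:
  assumes \<tau>: "isom_mult \<tau>" and p: "p \<in> bidisk" and p': "p' \<in> bidisk"
  shows "h2_inner (\<tau> ^ n * model_kernel \<tau> p') (\<tau> ^ m * model_kernel \<tau> p) = (if n = m then model_kernel \<tau> p' p else 0)"
proof -
  have off: "h2_inner (\<tau> ^ n * model_kernel \<tau> x) (\<tau> ^ m * model_kernel \<tau> y) = 0"
    if "m < n" "x \<in> bidisk" "y \<in> bidisk" for n m x y
  proof -
    obtain d where d: "n = m + Suc d" using less_imp_Suc_add[OF \<open>m < n\<close>] by auto
    have X: "\<tau> ^ d * model_kernel \<tau> x \<in> H2"
      by (intro isom_mult_in_H2[OF isom_mult_power[OF \<tau>]] model_kernel_in_H2 \<tau> that)
    have "\<tau> ^ n * model_kernel \<tau> x = \<tau> ^ m * (\<tau> * (\<tau> ^ d * model_kernel \<tau> x))"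
      by (simp add: d power_add mult_ac)
    then have "h2_inner (\<tau> ^ n * model_kernel \<tau> x) (\<tau> ^ m * model_kernel \<tau> y)
        = h2_inner (\<tau> * (\<tau> ^ d * model_kernel \<tau> x)) (model_kernel \<tau> y)"
      by (simp only: inner_isom_mult[OF isom_mult_power[OF \<tau>] isom_mult_in_H2[OF \<tau> X] model_kernel_in_H2[OF \<tau> that(3)]])
    then show ?thesis by (simp only: inner_model_kernel_range[OF \<tau> that(3) X])
  qed
  consider "n = m" | "m < n" | "n < m" by linarith
  then show ?thesis
  proof cases
    case 1
    then show ?thesis
      by (simp add: inner_isom_mult[OF isom_mult_power[OF \<tau>]] model_kernel_in_H2 inner_model_kernel assms del: mem_Times_iff)
  next
    case 2
    then show ?thesis using off[OF 2 p' p] by simp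
  next
    case 3
    then show ?thesis using off[OF 3 p p'] inner_cnj[of "\<tau> ^ m * model_kernel \<tau> p" "\<tau> ^ n * model_kernel \<tau> p'"] by simp
  qed
qed

lemma has_sum_axis:
  fixes g :: "nat \<Rightarrow> complex"
  assumes "(g has_sum s) UNIV"
  shows "((\<lambda>k. if snd k = 0 then g (fst k) else 0) has_sum s) (UNIV :: (nat \<times> nat) set)"
    and "((\<lambda>k. if fst k = 0 then g (snd k) else 0) has_sum s) (UNIV :: (nat \<times> nat) set)"
proof -
  have "((\<lambda>k. if snd k = 0 then g (fst k) else 0) has_sum s) (range (\<lambda>i. (i, 0 :: nat)))"
    using assms by (subst has_sum_reindex) (auto simp: inj_on_def o_def)
  then show "((\<lambda>k. if snd k = 0 then g (fst k) else 0) has_sum s) (UNIV :: (nat \<times> nat) set)"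
    by (rule has_sum_cong_neutral[THEN iffD1, rotated -1]) auto
  have "((\<lambda>k. if fst k = 0 then g (snd k) else 0) has_sum s) (range (\<lambda>j. (0 :: nat, j)))"
    using assms by (subst has_sum_reindex) (auto simp: inj_on_def o_def)
  then show "((\<lambda>k. if fst k = 0 then g (snd k) else 0) has_sum s) (UNIV :: (nat \<times> nat) set)"
    by (rule has_sum_cong_neutral[THEN iffD1, rotated -1]) auto
qed

lemma szego_axis_z: "p \<in> bidisk \<Longrightarrow> norm l < 1 \<Longrightarrow> szego (l, 0) p = 1 / (1 - cnj l * fst p)"
  and szego_axis_w: "p \<in> bidisk \<Longrightarrow> norm l < 1 \<Longrightarrow> szego (0, l) p = 1 / (1 - cnj l * snd p)"
proof -
  have geom: "((\<lambda>i. cnj l ^ i * x ^ i) has_sum 1 / (1 - cnj l * x)) UNIV" if "norm l < 1" "norm x < 1" for x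
  proof -
    have lt: "norm (cnj l * x) < 1" using that mult_strict_mono'[of "norm l" 1 "norm x" 1] by (simp add: norm_mult)
    have "((\<lambda>i. (cnj l * x) ^ i) has_sum 1 / (1 - cnj l * x)) UNIV"
      using lt by (intro norm_summable_imp_has_sum geometric_sums) (auto simp: norm_power intro!: summable_geometric)
    then show ?thesis by (simp add: power_mult_distrib)
  qed
  { assume p: "p \<in> bidisk" "norm l < 1"
    then have "norm (fst p) < 1" by (auto simp: mem_bidisk)
    have "((\<lambda>k. cnj (mon k (l, 0)) * mon k p) has_sum 1 / (1 - cnj l * fst p)) UNIV"
      using has_sum_axis(1)[OF geom[OF p(2) \<open>norm (fst p) < 1\<close>]]
      by (rule has_sum_cong[THEN iffD1, rotated]) (auto simp: mon_def)
    then show "szego (l, 0) p = 1 / (1 - cnj l * fst p)"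
      using p(1) by (simp add: szego_def h2fun_def infsumI del: mem_Times_iff) }
  { assume p: "p \<in> bidisk" "norm l < 1"
    then have "norm (snd p) < 1" by (auto simp: mem_bidisk)
    have "((\<lambda>k. cnj (mon k (0, l)) * mon k p) has_sum 1 / (1 - cnj l * snd p)) UNIV"
      using has_sum_axis(2)[OF geom[OF p(2) \<open>norm (snd p) < 1\<close>]]
      by (rule has_sum_cong[THEN iffD1, rotated]) (auto simp: mon_def)
    then show "szego (0, l) p = 1 / (1 - cnj l * snd p)"
      using p(1) by (simp add: szego_def h2fun_def infsumI del: mem_Times_iff) }
qed

section \<open>The submodule generated by a composition\<close>

lemma poly2_0: "poly2 0 = (\<lambda>_. 0)"
  and poly2_pCons: "poly2 (pCons c P) = (\<lambda>p. poly c (fst p)) + snd * poly2 P"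
  and poly2_1: "poly2 1 = 1"
  and poly2_mult_z: "poly2 (smult [:0, 1:] P) = fst * poly2 P"
  and poly2_mult_w: "poly2 (pCons 0 P) = snd * poly2 P"
  by (auto simp: poly2_def fun_eq_iff)

text \<open>Horner's scheme, first in \<open>w\<close> and then in \<open>z\<close>.\<close>

lemma poly2_mult_in:
  assumes V: "cfun.subspace V"
    and z: "\<And>f. f \<in> V \<Longrightarrow> fst * f \<in> V" and w: "\<And>f. f \<in> V \<Longrightarrow> snd * f \<in> V"
    and f: "f \<in> V"
  shows "poly2 P * f \<in> V"
proof (induction P)
  case 0
  have "poly2 0 * f = cscale 0 f" by (simp add: fun_eq_iff poly2_0)
  then show ?case using cfun.subspace_scale[OF V f, of 0] by (simp only:)
next
  case (pCons c P)
  note IH = pCons.IH(1)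
  have "(\<lambda>p. poly c (fst p)) * f \<in> V" for c
  proof (induction c)
    case 0
    have "(\<lambda>p. poly 0 (fst p)) * f = cscale 0 f" by (simp add: fun_eq_iff)
    then show ?case using cfun.subspace_scale[OF V f, of 0] by (simp only:)
  next
    case (pCons a c)
    have "(\<lambda>p. poly (pCons a c) (fst p)) * f = cscale a f + fst * ((\<lambda>p. poly c (fst p)) * f)"
      by (simp add: fun_eq_iff algebra_simps)
    then show ?case using cfun.subspace_add[OF V cfun.subspace_scale[OF V f] z[OF pCons.IH(1)]] by (simp only:)
  qed
  moreover have "poly2 (pCons c P) * f = (\<lambda>p. poly c (fst p)) * f + snd * (poly2 P * f)"
    unfolding poly2_pCons distrib_right mult.assoc ..
  ultimately show ?case using cfun.subspace_add[OF V _ w[OF IH]] by (simp only:)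
qed

lemma h2_closure_ex_lim:
  assumes "g \<in> h2_closure X" "X \<subseteq> H2"
  shows "\<exists>S. (\<forall>n. S n \<in> X) \<and> h2_lim S g"
proof -
  obtain S where "\<And>n. S n \<in> X" "h2_lim S g" using h2_closure_lim assms by metis
  then show ?thesis by blast
qed

lemma closed_subspace_preimage:
  assumes V: "closed_subspace V" and \<tau>: "isom_mult \<tau>"
  shows "closed_subspace {f \<in> H2. \<tau> * f \<in> V}"
  unfolding closed_subspace_def
proof (intro conjI)
  note VD = closed_subspaceD[OF V]
  show "{f \<in> H2. \<tau> * f \<in> V} \<subseteq> H2" by blast
  show "cfun.subspace {f \<in> H2. \<tau> * f \<in> V}"
  proof (rule cfun.subspaceI)
    have "\<tau> * 0 = 0" by (rule mult_zero_right)
    then show "0 \<in> {f \<in> H2. \<tau> * f \<in> V}" using VD(2) H2_0 by (simp only: mem_Collect_eq)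
  qed (simp_all add: H2_add H2_cscale distrib_left mult_cscale VD)
  show "h2_closure {f \<in> H2. \<tau> * f \<in> V} \<subseteq> {f \<in> H2. \<tau> * f \<in> V}"
  proof
    fix g assume "g \<in> h2_closure {f \<in> H2. \<tau> * f \<in> V}"
    moreover have "{f \<in> H2. \<tau> * f \<in> V} \<subseteq> H2" by blast
    ultimately have "\<exists>S. (\<forall>n. S n \<in> {f \<in> H2. \<tau> * f \<in> V}) \<and> h2_lim S g" by (rule h2_closure_ex_lim)
    then obtain S where S: "\<forall>n. S n \<in> {f \<in> H2. \<tau> * f \<in> V}" "h2_lim S g" by (elim exE conjE)
    note g = h2_limD[OF S(2)]
    have "h2_norm (\<tau> * S n - \<tau> * g) = h2_norm (S n - g)" for n
      unfolding right_diff_distrib[symmetric] by (rule isom_mult_norm[OF \<tau> H2_diff[OF g(1,2)]])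
    then have "h2_lim (\<lambda>n. \<tau> * S n) (\<tau> * g)"
      using g isom_mult_in_H2[OF \<tau>] by (simp add: h2_lim_def)
    then have "\<tau> * g \<in> V" by (rule closed_subspace_lim[OF V]) (use S(1) in blast)
    then show "g \<in> {f \<in> H2. \<tau> * f \<in> V}" using g(2) by blast
  qed
qed

lemma closed_subspace_orthogonal:
  assumes h: "h \<in> H2"
  shows "closed_subspace {f \<in> H2. h2_inner f h = 0}"
  unfolding closed_subspace_def
proof (intro conjI)
  show "{f \<in> H2. h2_inner f h = 0} \<subseteq> H2" by blast
  show "cfun.subspace {f \<in> H2. h2_inner f h = 0}"
    by (rule cfun.subspaceI) (simp_all add: H2_add H2_cscale inner_add_left inner_cscale_left h)
  show "h2_closure {f \<in> H2. h2_inner f h = 0} \<subseteq> {f \<in> H2. h2_inner f h = 0}"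
  proof
    fix g assume "g \<in> h2_closure {f \<in> H2. h2_inner f h = 0}"
    moreover have "{f \<in> H2. h2_inner f h = 0} \<subseteq> H2" by blast
    ultimately have "\<exists>S. (\<forall>n. S n \<in> {f \<in> H2. h2_inner f h = 0}) \<and> h2_lim S g" by (rule h2_closure_ex_lim)
    then obtain S where S: "\<forall>n. S n \<in> {f \<in> H2. h2_inner f h = 0}" "h2_lim S g" by (elim exE conjE)
    have "(\<lambda>n. h2_inner (S n) h) \<longlonglongrightarrow> h2_inner g h" by (rule h2_lim_inner[OF S(2) h])
    moreover have "(\<lambda>n. h2_inner (S n) h) = (\<lambda>_. 0)" using S(1) by simp
    ultimately have "h2_inner g h = 0" using LIMSEQ_unique[OF _ tendsto_const] by metis
    then show "g \<in> {f \<in> H2. h2_inner f h = 0}" using h2_limD(2)[OF S(2)] by blast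
  qed
qed

text \<open>Suppose that \<open>R\<close> contains \<open>X\<close> times every Szego kernel in the variable \<open>\<tau>\<close>. Then the same
  holds for \<open>\<tau> X\<close>: for \<open>c \<noteq> 0\<close> because \<open>\<tau> / (1 - c \<tau>)\<close> is a difference quotient of kernels, and
  for \<open>c = 0\<close> by letting \<open>c\<close> tend to 0. In this way all \<open>\<tau>\<^sup>n X\<close> are shown to belong to
  \<open>R\<close>.\<close>

lemma geo_in_step:
  assumes \<tau>: "isom_mult \<tau>" and R: "closed_subspace R" and X: "X \<in> H2"
    and all: "\<And>c. norm c < 1 \<Longrightarrow> geo \<tau> c X \<in> R" and c: "norm c < 1"
  shows "geo \<tau> c (\<tau> * X) \<in> R"
proof -
  note RD = closed_subspaceD[OF R]
  have \<tau>X: "\<tau> * X \<in> H2" by (rule isom_mult_in_H2[OF \<tau> X])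
  have nz: "geo \<tau> c (\<tau> * X) \<in> R" if c: "norm c < 1" "c \<noteq> 0" for c
  proof -
    have "geo \<tau> c (\<tau> * X) = cscale (1 / c) (geo \<tau> c X - geo \<tau> 0 X)"
    proof
      fix p
      show "geo \<tau> c (\<tau> * X) p = cscale (1 / c) (geo \<tau> c X - geo \<tau> 0 X) p"
      proof (cases "p \<in> bidisk")
        case True
        from denominator_nonzero[OF \<tau> c(1) this] show ?thesis
          using c(2) by (simp add: geo_def field_simps)
      next
        case False
        then show ?thesis using H2_outside[OF X False] by (simp add: geo_def)
      qed
    qed
    moreover have "geo \<tau> c X - geo \<tau> 0 X \<in> R" by (intro RD(4) all c(1)) simp
    ultimately show ?thesis using RD(5) by (simp only:)
  qed
  show ?thesis
  proof (cases "c = 0")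
    case False
    then show ?thesis using nz c by blast
  next
    case True
    define d where "d n = complex_of_real (1 / real (n + 2))" for n
    have norm_d: "norm (d n) = 1 / real (n + 2)" for n unfolding d_def norm_of_real by simp
    have d: "norm (d n) < 1" "d n \<noteq> 0" for n using norm_d[of n] by auto
    have gH: "geo \<tau> (d n) (\<tau> * X) \<in> H2" for n by (rule geo_in_H2[OF \<tau> d(1) \<tau>X])
    have diff: "h2_norm (geo \<tau> (d n) (\<tau> * X) - \<tau> * X) \<le> norm (d n) * (2 * h2_norm X)" for n
    proof -
      have "geo \<tau> (d n) (\<tau> * X) - \<tau> * X = cscale (d n) (\<tau> * geo \<tau> (d n) (\<tau> * X))"
      proof
        fix p
        show "(geo \<tau> (d n) (\<tau> * X) - \<tau> * X) p = cscale (d n) (\<tau> * geo \<tau> (d n) (\<tau> * X)) p"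
        proof (cases "p \<in> bidisk")
          case True
          from denominator_nonzero[OF \<tau> d(1) this] show ?thesis
            by (simp add: geo_def field_simps)
        next
          case False
          then show ?thesis using H2_outside[OF X False] by (simp add: geo_def)
        qed
      qed
      then have "h2_norm (geo \<tau> (d n) (\<tau> * X) - \<tau> * X) = norm (d n) * h2_norm (geo \<tau> (d n) (\<tau> * X))"
        by (simp only: norm_cscale[OF isom_mult_in_H2[OF \<tau> gH]] isom_mult_norm[OF \<tau> gH])
      also have "h2_norm (geo \<tau> (d n) (\<tau> * X)) \<le> h2_norm (\<tau> * X) / (1 - norm (d n))"
        by (rule geo_norm[OF \<tau> d(1) \<tau>X])
      also have "\<dots> \<le> 2 * h2_norm X"
      proof -
        have "norm (d n) \<le> 1 / 2" unfolding norm_d by simp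
        then have "h2_norm X / (1 - norm (d n)) \<le> h2_norm X / (1 / 2)"
          by (intro divide_left_mono) auto
        then show ?thesis by (simp add: isom_mult_norm[OF \<tau> X])
      qed
      finally show ?thesis by (simp add: mult_left_mono)
    qed
    have lim: "(\<lambda>n. norm (d n) * (2 * h2_norm X)) \<longlonglongrightarrow> 0"
    proof (rule tendsto_mult_left_zero)
      have "(\<lambda>n. 1 / real (n + 2)) \<longlonglongrightarrow> 0" by (intro LIMSEQ_ignore_initial_segment[OF lim_1_over_n])
      then show "(\<lambda>n. norm (d n)) \<longlonglongrightarrow> 0" by (simp only: norm_d)
    qed
    have "(\<lambda>n. h2_norm (geo \<tau> (d n) (\<tau> * X) - \<tau> * X)) \<longlonglongrightarrow> 0"
      by (rule tendsto_sandwich[OF _ _ tendsto_const lim]) (intro always_eventually allI diff h2_norm_nonneg)+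
    then have "h2_lim (\<lambda>n. geo \<tau> (d n) (\<tau> * X)) (\<tau> * X)" using gH \<tau>X by (simp add: h2_lim_def)
    then have "\<tau> * X \<in> R" by (rule closed_subspace_lim[OF R]) (rule nz[OF d])
    then show ?thesis using True by simp
  qed
qed

lemma power_mult_in:
  assumes \<tau>: "isom_mult \<tau>" and R: "closed_subspace R" and X: "X \<in> H2"
    and all: "\<And>c. norm c < 1 \<Longrightarrow> geo \<tau> c X \<in> R"
  shows "\<tau> ^ n * X \<in> R"
proof -
  have "\<tau> ^ n * X \<in> H2 \<and> (\<forall>c. norm c < 1 \<longrightarrow> geo \<tau> c (\<tau> ^ n * X) \<in> R)"
  proof (induction n)
    case 0
    then show ?case using X all by simp
  next
    case (Suc n)
    then show ?case
      using geo_in_step[OF \<tau> R, of "\<tau> ^ n * X"] isom_mult_in_H2[OF \<tau>, of "\<tau> ^ n * X"]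
      unfolding power_Suc mult.assoc by blast
  qed
  then show ?thesis by (metis geo_0 norm_zero zero_less_one)
qed

lemma submodule_generated:
  assumes X: "X \<subseteq> H2"
  shows "submodule (generated_submodule X)" "X \<subseteq> generated_submodule X"
proof -
  define Y where "Y = {poly2 P * f | P f. f \<in> X}"
  have gen: "generated_submodule X = h2_closure (cfun.span Y)" by (simp add: generated_submodule_def Y_def)
  have YH: "Y \<subseteq> H2"
    unfolding Y_def using X isom_mult_in_H2[OF isom_mult_fst] isom_mult_in_H2[OF isom_mult_snd]
    by (auto intro!: poly2_mult_in[OF H2_subspace])
  have cl: "closed_subspace (generated_submodule X)" unfolding gen by (rule closed_subspace_closure_span[OF YH])
  have Ysub: "Y \<subseteq> generated_submodule X"
    unfolding gen using h2_closure_subset[OF span_subset_H2[OF YH]] cfun.span_superset by blast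
  have inv: "\<tau> * f \<in> generated_submodule X"
    if \<tau>: "isom_mult \<tau>" and Y\<tau>: "\<And>f. f \<in> Y \<Longrightarrow> \<tau> * f \<in> Y" and f: "f \<in> generated_submodule X" for \<tau> f
  proof -
    have "h2_closure (cfun.span Y) \<subseteq> {f \<in> H2. \<tau> * f \<in> generated_submodule X}"
      by (rule closure_span_minimal[OF _ closed_subspace_preimage[OF cl \<tau>]]) (use YH Y\<tau> Ysub in blast)
    then show ?thesis using f unfolding gen by blast
  qed
  have "fst * f \<in> Y" "snd * f \<in> Y" if "f \<in> Y" for f
  proof -
    have "\<exists>P g. f = poly2 P * g \<and> g \<in> X" using that unfolding Y_def by simp
    then obtain P g where f: "f = poly2 P * g" "g \<in> X" by (elim exE conjE)
    have "fst * f = poly2 (smult [:0, 1:] P) * g" "snd * f = poly2 (pCons 0 P) * g"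
      unfolding poly2_mult_z poly2_mult_w f(1) by (simp_all add: mult.assoc)
    then show "fst * f \<in> Y" "snd * f \<in> Y" unfolding Y_def using f(2) by blast+
  qed
  then have "mult_z f \<in> generated_submodule X" "mult_w f \<in> generated_submodule X" if "f \<in> generated_submodule X" for f
    unfolding mult_z_eq mult_w_eq using inv that isom_mult_fst isom_mult_snd by blast+
  then show "submodule (generated_submodule X)"
    using cl unfolding submodule_def closed_subspace_def by blast
  have "X \<subseteq> Y"
  proof
    fix f assume "f \<in> X"
    moreover have "f = poly2 1 * f" by (simp add: poly2_1)
    ultimately show "f \<in> Y" unfolding Y_def by blast
  qed
  then show "X \<subseteq> generated_submodule X" using Ysub by blast
qed

lemma generated_submodule_minimal:
  assumes "\<And>P f. f \<in> X \<Longrightarrow> poly2 P * f \<in> V" "closed_subspace V"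
  shows "generated_submodule X \<subseteq> V"
  unfolding generated_submodule_def by (rule closure_span_minimal) (use assms in auto)

context inner_pair
begin

lemma bounded_op_comp: "bounded_op H2 C"
  unfolding bounded_op_def
proof (intro conjI ballI allI)
  show "\<exists>K. \<forall>f\<in>H2. h2_norm (C f) \<le> K * h2_norm f"
  proof (intro exI ballI)
    fix f assume f: "f \<in> H2"
    have "(h2_norm (C f))\<^sup>2 \<le> (sqrt \<kappa> * h2_norm f)\<^sup>2"
      using comp_op_upper[OF f] \<kappa>_pos by (simp add: power_mult_distrib)
    then show "h2_norm (C f) \<le> sqrt \<kappa> * h2_norm f"
      by (rule power2_le_imp_le) (use \<kappa>_pos in auto)
  qed
  show "C f \<in> H2" if "f \<in> H2" for f by (rule comp_op_in_H2[OF that])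
qed (auto simp: comp_op_eq fun_eq_iff)

lemma C_mult_z: "C (fst * f) = t1 * C f" and C_mult_w: "C (snd * f) = t2 * C f"
  by (auto simp: comp_op_eq comp_pt_def lift_z_def lift_w_def fun_eq_iff)

lemma C_mult_powers: "C (fst ^ n * (snd ^ m * f)) = t1 ^ n * (t2 ^ m * C f)"
proof -
  have "C (snd ^ m * f) = t2 ^ m * C f" for f by (induction m) (simp_all only: power_0 mult_1 power_Suc C_mult_w mult.assoc)
  moreover have "C (fst ^ n * f) = t1 ^ n * C f" for f by (induction n) (simp_all only: power_0 mult_1 power_Suc C_mult_z mult.assoc)
  ultimately show ?thesis by (simp only:)
qed

text \<open>Multiplication by the product of the two model space kernels at \<open>p\<close>.\<close>

definition model_mult :: "complex \<times> complex \<Rightarrow> fun2 \<Rightarrow> fun2" where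
  "model_mult p f = (let g = geo fst (cnj (fst p)) (geo snd (cnj (snd p)) f);
     h = g - cscale (cnj (\<theta> (fst p))) (t1 * g) in h - cscale (cnj (\<phi> (snd p))) (t2 * h))"

lemma model_mult_apply:
  "model_mult p f q = (1 - cnj (\<theta> (fst p)) * t1 q) * (1 - cnj (\<phi> (snd p)) * t2 q)
     * f q / ((1 - cnj (fst p) * fst q) * (1 - cnj (snd p) * snd q))"
proof -
  define X where "X = geo fst (cnj (fst p)) (geo snd (cnj (snd p)) f) q"
  have "model_mult p f q = (1 - cnj (\<theta> (fst p)) * t1 q) * (1 - cnj (\<phi> (snd p)) * t2 q) * X"
    by (simp add: model_mult_def Let_def X_def algebra_simps)
  also have "X = f q / ((1 - cnj (fst p) * fst q) * (1 - cnj (snd p) * snd q))"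
    by (simp add: X_def geo_def mult.commute)
  finally show ?thesis by simp
qed

lemma bounded_op_model_mult:
  assumes p: "p \<in> bidisk"
  shows "bounded_op H2 (model_mult p)"
proof -
  have p': "norm (cnj (fst p)) < 1" "norm (cnj (snd p)) < 1" using p by (auto simp: mem_bidisk)
  note 1 = bounded_op_compose[OF bounded_op_geo[OF isom_mult_fst p'(1)] bounded_op_geo[OF isom_mult_snd p'(2)]]
  note 2 = bounded_op_compose[OF bounded_op_diff_cscale[OF bounded_op_mult[OF isom_t1], of "cnj (\<theta> (fst p))"] 1]
  note 3 = bounded_op_compose[OF bounded_op_diff_cscale[OF bounded_op_mult[OF isom_t2], of "cnj (\<phi> (snd p))"] 2]
  show ?thesis using 3 by (simp only: model_mult_def[abs_def] Let_def)
qed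

lemma axis_bidisk: "p \<in> bidisk \<Longrightarrow> (fst p, 0) \<in> bidisk" "p \<in> bidisk \<Longrightarrow> (0, snd p) \<in> bidisk"
  by (auto simp: mem_bidisk)

lemma model_kernel_t1:
  assumes "p \<in> bidisk" "q \<in> bidisk"
  shows "model_kernel t1 (fst p, 0) q = (1 - cnj (\<theta> (fst p)) * t1 q) / (1 - cnj (fst p) * fst q)"
  using assms axis_bidisk[OF assms(1)] t1_apply[OF axis_bidisk(1)[OF assms(1)]]
  by (simp add: model_kernel_def szego_axis_z mem_bidisk diff_divide_distrib)

lemma model_kernel_t2:
  assumes "p \<in> bidisk" "q \<in> bidisk"
  shows "model_kernel t2 (0, snd p) q = (1 - cnj (\<phi> (snd p)) * t2 q) / (1 - cnj (snd p) * snd q)"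
  using assms axis_bidisk[OF assms(1)] t2_apply[OF axis_bidisk(2)[OF assms(1)]]
  by (simp add: model_kernel_def szego_axis_w mem_bidisk diff_divide_distrib)

lemma C_emon: "C (emon (n, m)) = t1 ^ n * (t2 ^ m * emon (0, 0))"
proof -
  have "emon (n, m) = fst ^ n * (snd ^ m * emon (0, 0))"
    by (auto simp: emon_def mon_def fun_eq_iff fun_power_apply)
  moreover have "C (emon (0, 0)) = emon (0, 0)"
  proof
    fix p show "C (emon (0, 0)) p = emon (0, 0) p"
      using comp_pt_bidisk[of p] by (cases "p \<in> bidisk") (simp_all add: comp_op_eq emon_def del: mem_Times_iff)
  qed
  ultimately show ?thesis by (simp only: C_mult_powers)
qed

lemma model_mult_C_emon:
  assumes p: "p \<in> bidisk"
  shows "model_mult p (C (emon (n, m))) = (t1 ^ n * model_kernel t1 (fst p, 0)) * (t2 ^ m * model_kernel t2 (0, snd p))"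
proof
  fix q
  show "model_mult p (C (emon (n, m))) q = ((t1 ^ n * model_kernel t1 (fst p, 0)) * (t2 ^ m * model_kernel t2 (0, snd p))) q"
  proof (cases "q \<in> bidisk")
    case True
    then have "emon (0, 0) q = 1" by (simp add: emon_def del: mem_Times_iff)
    then show ?thesis
      using model_kernel_t1[OF p True] model_kernel_t2[OF p True]
      by (simp add: model_mult_apply C_emon)
  next
    case False
    have "model_kernel t1 (fst p, 0) q = 0"
      by (rule H2_outside[OF model_kernel_in_H2[OF isom_t1 axis_bidisk(1)[OF p]] False])
    then show ?thesis using False by (simp add: model_mult_apply comp_op_outside del: mem_Times_iff)
  qed
qed

lemma t1_axis: "p \<in> bidisk \<Longrightarrow> t1 (fst p, 0) = t1 p"
  and t2_axis: "p \<in> bidisk \<Longrightarrow> t2 (0, snd p) = t2 p"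
  using t1_apply t1_apply[OF axis_bidisk(1)] t2_apply t2_apply[OF axis_bidisk(2)] by simp_all

lemma z_function_t1: "p \<in> bidisk \<Longrightarrow> t1 ^ n * model_kernel t1 (fst p, 0) \<in> z_functions"
  and w_function_t2: "p \<in> bidisk \<Longrightarrow> t2 ^ n * model_kernel t2 (0, snd p) \<in> w_functions"
proof -
  assume p: "p \<in> bidisk"
  have "model_kernel t1 (fst p, 0) \<in> z_functions"
    unfolding fixed_by_def
    using model_kernel_in_H2[OF isom_t1 axis_bidisk(1)[OF p]] model_kernel_t1[OF p] axis_bidisk
    by (simp add: t1_apply del: mem_Times_iff)
  then show "t1 ^ n * model_kernel t1 (fst p, 0) \<in> z_functions"
    by (rule fixed_by_mult[OF slice_w isom_mult_power[OF isom_t1], rotated])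
      (simp add: fun_power_apply t1_axis)
  have "model_kernel t2 (0, snd p) \<in> w_functions"
    unfolding fixed_by_def
    using model_kernel_in_H2[OF isom_t2 axis_bidisk(2)[OF p]] model_kernel_t2[OF p] axis_bidisk
    by (simp add: t2_apply del: mem_Times_iff)
  then show "t2 ^ n * model_kernel t2 (0, snd p) \<in> w_functions"
    by (rule fixed_by_mult[OF slice_z isom_mult_power[OF isom_t2], rotated])
      (simp add: fun_power_apply t2_axis)
qed

lemma bounded_functional_scaled_inner:
  assumes "h \<in> H2"
  shows "bounded_functional (\<lambda>g. c * h2_inner g h)"
  using bounded_functional_inner[OF H2_cscale[OF assms, of "cnj c"]] by (simp add: inner_cscale_right[OF assms])

text \<open>On monomials the inner product factors into one-variable ones, which vanish unless the powers
  agree; bounded functionals agreeing on monomials are equal, in one argument after the other.\<close>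

lemma inner_model_mult:
  assumes p: "p \<in> bidisk" and p': "p' \<in> bidisk" and f: "f \<in> H2" and g: "g \<in> H2"
  shows "h2_inner (model_mult p' (C f)) (model_mult p (C g))
     = model_kernel t1 (fst p', 0) (fst p, 0) * model_kernel t2 (0, snd p') (0, snd p) * h2_inner f g"
    (is "_ = ?s * _")
proof -
  have bd: "bounded_op H2 (\<lambda>f. model_mult p (C f))" if "p \<in> bidisk" for p
    by (rule bounded_op_compose[OF bounded_op_model_mult[OF that] bounded_op_comp])
  have in_H2: "model_mult p (C f) \<in> H2" if "p \<in> bidisk" "f \<in> H2" for p f
    using bd[OF that(1)] that(2) unfolding bounded_op_def by blast
  have basis: "h2_inner (model_mult p' (C (emon k))) (model_mult p (C (emon l))) = ?s * h2_inner (emon k) (emon l)" for k l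
  proof -
    obtain n m n' m' where k: "k = (n, m)" and l: "l = (n', m')" by (cases k, cases l)
    show ?thesis
      unfolding k l model_mult_C_emon[OF p] model_mult_C_emon[OF p']
        inner_tensor[OF z_function_t1[OF p'] z_function_t1[OF p] w_function_t2[OF p'] w_function_t2[OF p]]
        inner_model_kernel_powers[OF isom_t1 axis_bidisk(1)[OF p] axis_bidisk(1)[OF p']]
        inner_model_kernel_powers[OF isom_t2 axis_bidisk(2)[OF p] axis_bidisk(2)[OF p']]
        inner_emon_right h2_coeffs_emon by simp
  qed
  have left: "h2_inner (model_mult p' (C f)) (model_mult p (C (emon l))) = ?s * h2_inner f (emon l)" if f: "f \<in> H2" for f l
    by (rule bounded_functional_eqI[OF bounded_functional_op[OF bd[OF p'] in_H2[OF p emon_in_H2]]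
          bounded_functional_scaled_inner[OF emon_in_H2] basis f])
  have "h2_inner (model_mult p (C (emon l))) (model_mult p' (C f)) = cnj ?s * h2_inner (emon l) f" for l
    using arg_cong[OF left[OF f, of l], of cnj] by (simp only: inner_cnj complex_cnj_mult)
  from bounded_functional_eqI[OF bounded_functional_op[OF bd[OF p] in_H2[OF p' f]]
      bounded_functional_scaled_inner[OF f] this g]
  have "h2_inner (model_mult p (C g)) (model_mult p' (C f)) = cnj ?s * h2_inner g f" .
  from arg_cong[OF this, of cnj] show ?thesis by (simp only: inner_cnj complex_cnj_mult complex_cnj_cnj)
qed

end

section \<open>The core operator of the generated submodule\<close>

locale lifted_submodule = inner_pair \<theta> \<phi> + invariant_subspace M
  for \<theta> \<phi> :: "complex \<Rightarrow> complex" and M :: "fun2 set"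
begin

definition M' where "M' = generated_submodule (C ` M)"

lemma C_M_H2: "C ` M \<subseteq> H2"
  using comp_op_in_H2 in_H2 by blast

sublocale lift: invariant_subspace M'
  by standard (simp add: M'_def submodule_generated C_M_H2)

lemma power_mult_M:
  assumes "f \<in> M"
  shows "fst ^ n * (snd ^ m * f) \<in> M"
proof -
  have "snd ^ m * f \<in> M"
    using assms mult_w_in unfolding mult_w_eq
    by (induction m) (simp_all only: power_0 mult_1 power_Suc mult.assoc)
  then show ?thesis
    using mult_z_in unfolding mult_z_eq
    by (induction n) (simp_all only: power_0 mult_1 power_Suc mult.assoc)
qed

text \<open>The reproducing kernel of \<open>M'\<close> at \<open>p\<close>, as will turn out. This form shows that it belongs to
  \<open>M'\<close>; \<open>lift_kernel_eq_model_mult\<close> is the form that allows its inner products to be computed.\<close>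

definition lift_kernel :: "complex \<times> complex \<Rightarrow> fun2" where
  "lift_kernel p = geo fst (cnj (fst p)) (geo snd (cnj (snd p)) (C (core_fun M (comp_pt p))))"

lemma core_fun_apply:
  "core_fun M p q = (1 - cnj (fst p) * fst q) * (1 - cnj (snd p) * snd q) * rep_kernel M p q"
  by (cases p; cases q) (simp add: core_fun_def)

lemma lift_kernel_eq_model_mult:
  "lift_kernel p = model_mult p (C (rep_kernel M (comp_pt p)))"
proof
  fix q
  show "lift_kernel p q = model_mult p (C (rep_kernel M (comp_pt p))) q"
  proof (cases "q \<in> bidisk")
    case True
    then show ?thesis
      by (simp add: lift_kernel_def model_mult_apply geo_def comp_op_apply core_fun_apply t1_apply t2_apply
        comp_pt_def mult_ac del: mem_Times_iff)
  next
    case False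
    then show ?thesis by (simp add: lift_kernel_def model_mult_apply geo_def comp_op_outside del: mem_Times_iff)
  qed
qed

lemma lift_kernel_in:
  assumes p: "p \<in> bidisk"
  shows "lift_kernel p \<in> M'"
proof -
  have p': "norm (cnj (fst p)) < 1" "norm (cnj (snd p)) < 1" using p by (auto simp: mem_bidisk)
  have fst: "fst ^ n * f \<in> M'" if "f \<in> M'" for f n
    using that lift.mult_z_in unfolding mult_z_eq
    by (induction n) (simp_all only: power_0 mult_1 power_Suc mult.assoc)
  have snd: "snd ^ n * f \<in> M'" if "f \<in> M'" for f n
    using that lift.mult_w_in unfolding mult_w_eq
    by (induction n) (simp_all only: power_0 mult_1 power_Suc mult.assoc)
  have "C (core_fun M (comp_pt p)) \<in> M'"
    using submodule_generated(2)[OF C_M_H2] core_fun_in unfolding M'_def by blast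
  then have "geo snd (cnj (snd p)) (C (core_fun M (comp_pt p))) \<in> M'"
    by (intro geo_in[OF isom_mult_snd p'(2) lift.closed] lift.in_H2 snd)
  then show ?thesis
    unfolding lift_kernel_def by (intro geo_in[OF isom_mult_fst p'(1) lift.closed] lift.in_H2 fst)
qed

text \<open>The functions whose value at \<open>p\<close> is reproduced by \<open>lift_kernel p\<close>, as an orthogonal complement
  in order to have a closed subspace. It contains \<open>C g\<close>, for \<open>g \<in> M\<close>, times the model space kernels;
  summing the geometric series in \<open>\<theta>\<close> and \<open>\<phi>\<close> replaces these by Szego kernels, and those in turn
  are replaced by monomials with \<open>power_mult_in\<close>.\<close>

definition reproduced :: "complex \<times> complex \<Rightarrow> fun2 set" where
  "reproduced p = {f \<in> H2. h2_inner f (lift_kernel p - szego p) = 0}"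

lemma reproduced_iff:
  assumes "p \<in> bidisk"
  shows "f \<in> reproduced p \<longleftrightarrow> f \<in> H2 \<and> h2_inner f (lift_kernel p) = f p"
  unfolding reproduced_def
  using lift.in_H2[OF lift_kernel_in[OF assms]] szego_in_H2[OF assms]
  by (auto simp: inner_diff_right inner_szego assms simp del: mem_Times_iff)

lemma closed_reproduced: "p \<in> bidisk \<Longrightarrow> closed_subspace (reproduced p)"
  unfolding reproduced_def
  by (intro closed_subspace_orthogonal H2_diff lift.in_H2 lift_kernel_in szego_in_H2)

lemma model_mult_reproduced:
  assumes p: "p \<in> bidisk" and p': "p' \<in> bidisk" and g: "g \<in> M"
  shows "model_mult p' (C g) \<in> reproduced p"
  unfolding reproduced_iff[OF p]
proof
  show "model_mult p' (C g) \<in> H2"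
    using bounded_op_model_mult[OF p'] comp_op_in_H2[OF in_H2[OF g]] unfolding bounded_op_def by blast
  have "h2_inner (model_mult p' (C g)) (lift_kernel p)
      = model_kernel t1 (fst p', 0) (fst p, 0) * model_kernel t2 (0, snd p') (0, snd p) * g (comp_pt p)"
    unfolding lift_kernel_eq_model_mult inner_model_mult[OF p p' in_H2[OF g] in_H2[OF rep_kernel_in]]
      inner_rep_kernel[OF g] ..
  also have "\<dots> = model_mult p' (C g) p"
    unfolding model_mult_apply model_kernel_t1[OF p' axis_bidisk(1)[OF p]] model_kernel_t2[OF p' axis_bidisk(2)[OF p]]
      t1_axis[OF p] t2_axis[OF p] comp_op_apply[OF p] by simp
  finally show "h2_inner (model_mult p' (C g)) (lift_kernel p) = model_mult p' (C g) p" .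
qed

lemma model_mult_mult: "\<tau> * model_mult p f = model_mult p (\<tau> * f)"
  by (rule ext) (simp add: model_mult_apply)

lemma geo_reproduced:
  assumes p: "p \<in> bidisk" and c: "norm c < 1" and d: "norm d < 1" and g: "g \<in> M"
  shows "geo fst c (geo snd d (C g)) \<in> reproduced p"
proof -
  \<comment> \<open>\<open>S\<close> is \<open>C g\<close> times the model space kernels at \<open>p'\<close>, and dividing it by \<open>(1 - a t1) (1 - b t2)\<close>
    leaves \<open>C g\<close> times the Szego kernels at \<open>p'\<close>\<close>
  define p' where "p' = (cnj c, cnj d)"
  have p': "p' \<in> bidisk" using c d by (simp add: p'_def)
  define a where "a = cnj (\<theta> (fst p'))"
  define b where "b = cnj (\<phi> (snd p'))"
  have ab: "norm a < 1" "norm b < 1"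
    using comp_pt_bidisk[OF p'] by (auto simp: a_def b_def comp_pt_def)
  define S where "S = model_mult p' (C g)"
  have R: "t1 ^ n * (t2 ^ m * S) \<in> reproduced p" for n m
    using model_mult_reproduced[OF p p' power_mult_M[OF g]]
    unfolding S_def model_mult_mult C_mult_powers .
  have H: "f \<in> H2" if "f \<in> reproduced p" for f using that reproduced_iff[OF p] by blast
  have R1: "t1 ^ n * geo t2 b S \<in> reproduced p" for n
    unfolding mult_geo
  proof (rule geo_in[OF isom_t2 ab(2) closed_reproduced[OF p]])
    show "t2 ^ m * (t1 ^ n * S) \<in> reproduced p" for m using R[of n m] by (simp only: mult.left_commute)
    from this[of 0] show "t1 ^ n * S \<in> H2" using H by (simp only: power_0 mult_1)
  qed
  have "geo t1 a (geo t2 b S) \<in> reproduced p"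
    by (rule geo_in[OF isom_t1 ab(1) closed_reproduced[OF p] _ R1])
      (use R1[of 0] H in \<open>simp only: power_0 mult_1\<close>)
  moreover have "geo t1 a (geo t2 b S) = geo fst c (geo snd d (C g))"
  proof
    fix q
    show "geo t1 a (geo t2 b S) q = geo fst c (geo snd d (C g)) q"
    proof (cases "q \<in> bidisk")
      case True
      have "S q = (1 - a * t1 q) * (1 - b * t2 q) * C g q / ((1 - c * fst q) * (1 - d * snd q))"
        unfolding S_def model_mult_apply a_def b_def p'_def by simp
      then show ?thesis
        using denominator_nonzero[OF isom_t1 ab(1) True] denominator_nonzero[OF isom_t2 ab(2) True]
        by (simp add: geo_def mult.commute)
    next
      case False
      then show ?thesis by (simp add: S_def geo_def model_mult_apply comp_op_outside del: mem_Times_iff)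
    qed
  qed
  ultimately show ?thesis by (simp only:)
qed

lemma power_mult_reproduced:
  assumes p: "p \<in> bidisk" and g: "g \<in> M"
  shows "snd ^ j * (fst ^ i * C g) \<in> reproduced p"
proof (rule power_mult_in[OF isom_mult_snd closed_reproduced[OF p]])
  have Cg: "C g \<in> H2" by (rule comp_op_in_H2[OF in_H2[OF g]])
  show "fst ^ i * C g \<in> H2" by (rule isom_mult_in_H2[OF isom_mult_power[OF isom_mult_fst] Cg])
  fix d :: complex assume d: "norm d < 1"
  have "fst ^ i * geo snd d (C g) \<in> reproduced p"
    by (rule power_mult_in[OF isom_mult_fst closed_reproduced[OF p] geo_in_H2[OF isom_mult_snd d Cg]])
      (rule geo_reproduced[OF p _ d g])
  then show "geo snd d (fst ^ i * C g) \<in> reproduced p" by (simp only: mult_geo)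
qed

lemma M'_reproduced:
  assumes p: "p \<in> bidisk"
  shows "M' \<subseteq> reproduced p"
  unfolding M'_def
proof (rule generated_submodule_minimal[OF _ closed_reproduced[OF p]])
  fix P f assume "f \<in> C ` M"
  then obtain g where g: "g \<in> M" "f = C g" by blast
  define V where "V = {f \<in> H2. \<forall>i j. snd ^ j * (fst ^ i * f) \<in> reproduced p}"
  note RD = closed_subspaceD[OF closed_reproduced[OF p]]
  have V: "cfun.subspace V"
  proof (rule cfun.subspaceI)
    have "snd ^ j * (fst ^ i * 0) = (0 :: fun2)" for i j by (simp only: mult_zero_right)
    then show "0 \<in> V" unfolding V_def using RD(2) H2_0 by (simp only: mem_Collect_eq simp_thms)
    show "f + h \<in> V" if "f \<in> V" "h \<in> V" for f h
      using that RD(3) H2_add unfolding V_def mem_Collect_eq distrib_left by blast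
    show "cscale c f \<in> V" if "f \<in> V" for c f
      using that RD(5) H2_cscale unfolding V_def mem_Collect_eq mult_cscale by blast
  qed
  have z: "fst * f \<in> V" if f: "f \<in> V" for f
  proof -
    have eq: "snd ^ j * (fst ^ i * (fst * f)) = snd ^ j * (fst ^ Suc i * f)" for i j
      by (simp only: power_Suc2 mult.assoc)
    show ?thesis using f isom_mult_in_H2[OF isom_mult_fst] unfolding V_def mem_Collect_eq eq by blast
  qed
  have w: "snd * f \<in> V" if f: "f \<in> V" for f
  proof -
    have eq: "snd ^ j * (fst ^ i * (snd * f)) = snd ^ Suc j * (fst ^ i * f)" for i j
      by (simp only: power_Suc2 mult.assoc mult.left_commute)
    show ?thesis using f isom_mult_in_H2[OF isom_mult_snd] unfolding V_def mem_Collect_eq eq by blast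
  qed
  have "f \<in> V" unfolding V_def g(2)
    using power_mult_reproduced[OF p g(1)] comp_op_in_H2[OF in_H2[OF g(1)]] by blast
  from poly2_mult_in[OF V z w this] have "poly2 P * f \<in> V" .
  then have "snd ^ 0 * (fst ^ 0 * (poly2 P * f)) \<in> reproduced p" unfolding V_def by blast
  then show "poly2 P * f \<in> reproduced p" by (simp only: power_0 mult_1)
qed

lemma rep_kernel_lift:
  assumes "p \<in> bidisk"
  shows "rep_kernel M' p = lift_kernel p"
  using lift.rep_kernel_eqI[OF lift_kernel_in[OF assms]] M'_reproduced[OF assms] reproduced_iff[OF assms] by blast

text \<open>The denominators of \<open>lift_kernel\<close> cancel against the factors in the definition of the core
  function.\<close>

lemma core_fun_lift:
  assumes p: "p \<in> bidisk"
  shows "core_fun M' p = C (core_fun M (comp_pt p))"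
proof
  fix q
  have eq: "core_fun M' p q = (1 - cnj (fst p) * fst q) * (1 - cnj (snd p) * snd q) * lift_kernel p q"
    unfolding rep_kernel_lift[OF p, symmetric] by (cases p; cases q) (simp add: core_fun_def)
  show "core_fun M' p q = C (core_fun M (comp_pt p)) q"
  proof (cases "q \<in> bidisk")
    case True
    have p': "norm (cnj (fst p)) < 1" "norm (cnj (snd p)) < 1" using p by (auto simp: mem_bidisk)
    show ?thesis
      unfolding eq
      using denominator_nonzero[OF isom_mult_fst p'(1) True] denominator_nonzero[OF isom_mult_snd p'(2) True]
      by (simp add: lift_kernel_def geo_def)
  next
    case False
    then show ?thesis unfolding eq by (simp add: lift_kernel_def geo_def comp_op_outside del: mem_Times_iff)
  qed
qed

lemma core_op_lift:
  assumes f: "f \<in> H2"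
  shows "core_op M' f = C (core_op M (adj H2 C f))"
proof
  fix p
  note A = adj_in[OF closed_subspace_H2 bounded_op_comp f]
  show "core_op M' f p = C (core_op M (adj H2 C f)) p"
  proof (cases "p \<in> bidisk")
    case True
    have "core_op M' f p = h2_inner f (C (core_fun M (comp_pt p)))"
      using lift.core_op_eq[OF f, of p] core_fun_lift[OF True] True by metis
    also have "\<dots> = h2_inner (adj H2 C f) (core_fun M (comp_pt p))"
      by (rule inner_adj_left[OF closed_subspace_H2 bounded_op_comp f in_H2[OF core_fun_in], symmetric])
    also have "\<dots> = C (core_op M (adj H2 C f)) p"
      using core_op_eq[OF A, of "comp_pt p"] comp_pt_bidisk[OF True] comp_op_apply[OF True] by metis
    finally show ?thesis .
  next
    case False
    then show ?thesis using lift.core_op_eq[OF f, of p] comp_op_outside by metis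
  qed
qed

text \<open>Each of the two factors \<open>C\<close> and \<open>C\<^sup>*\<close> of the core operator of \<open>M'\<close> changes the squared
  Hilbert-Schmidt norm by at most a factor \<open>\<kappa>\<close>; \<open>C\<^sup>*\<close>, which stands on the right, is first turned
  into a factor \<open>C\<close> on the left by taking adjoints.\<close>

lemma hs_norm_sq_lift:
  shows "hs_norm_sq H2 (core_op M') \<le> ennreal (\<kappa>\<^sup>2) * hs_norm_sq H2 (core_op M)"
    and "hs_norm_sq H2 (core_op M) \<le> ennreal (\<kappa>\<^sup>2) * hs_norm_sq H2 (core_op M')"
proof -
  let ?A = "adj H2 C"
  note A = adj_in[OF closed_subspace_H2 bounded_op_comp]
  have core_H2: "core_op M f \<in> H2" if "f \<in> H2" for f by (rule in_H2[OF core_op_in[OF that]])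
  have \<kappa>: "0 \<le> \<kappa>" using \<kappa>_pos by simp
  have ee: "ennreal \<kappa> * (ennreal \<kappa> * x) = ennreal (\<kappa>\<^sup>2) * x" for x
    using \<kappa> by (simp add: power2_eq_square ennreal_mult mult.assoc)
  have lift: "hs_norm_sq H2 (core_op M') = hs_norm_sq H2 (\<lambda>f. C (core_op M (?A f)))"
    by (rule hs_norm_sq_cong[OF closed_subspace_H2]) (simp only: core_op_lift)
  have swap: "hs_norm_sq H2 (\<lambda>f. core_op M (?A f)) = hs_norm_sq H2 (\<lambda>f. C (core_op M f))"
  proof (rule hs_norm_sq_adjoint[OF closed_subspace_H2 closed_subspace_H2])
    fix e f assume e: "e \<in> H2" and f: "f \<in> H2"
    show "h2_inner (core_op M (?A e)) f = h2_inner e (C (core_op M f))"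
      unfolding core_op_selfadjoint[OF A[OF e] f]
      by (rule inner_adj_left[OF closed_subspace_H2 bounded_op_comp e core_H2[OF f]])
  qed (intro core_H2 A comp_op_in_H2; assumption)+
  have up: "hs_norm_sq H2 (\<lambda>f. C (T f)) \<le> ennreal \<kappa> * hs_norm_sq H2 T" if "\<And>f. f \<in> H2 \<Longrightarrow> T f \<in> H2" for T
    by (rule hs_norm_sq_mono[OF closed_subspace_H2 \<kappa>]) (rule comp_op_upper[OF that])
  have lo: "hs_norm_sq H2 T \<le> ennreal \<kappa> * hs_norm_sq H2 (\<lambda>f. C (T f))" if T: "\<And>f. f \<in> H2 \<Longrightarrow> T f \<in> H2" for T
  proof (rule hs_norm_sq_mono[OF closed_subspace_H2 \<kappa>])
    fix e assume "e \<in> H2"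
    then show "(h2_norm (T e))\<^sup>2 \<le> \<kappa> * (h2_norm (C (T e)))\<^sup>2"
      using comp_op_lower[OF T] \<kappa>_pos by (simp add: field_simps)
  qed
  have "hs_norm_sq H2 (core_op M') \<le> ennreal \<kappa> * hs_norm_sq H2 (\<lambda>f. core_op M (?A f))"
    unfolding lift by (rule up[OF core_H2[OF A]])
  also have "\<dots> \<le> ennreal \<kappa> * (ennreal \<kappa> * hs_norm_sq H2 (core_op M))"
    unfolding swap by (intro mult_left_mono up[OF core_H2]) auto
  finally show "hs_norm_sq H2 (core_op M') \<le> ennreal (\<kappa>\<^sup>2) * hs_norm_sq H2 (core_op M)" by (simp only: ee)
  have "hs_norm_sq H2 (core_op M) \<le> ennreal \<kappa> * hs_norm_sq H2 (\<lambda>f. core_op M (?A f))"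
    unfolding swap by (rule lo[OF core_H2])
  also have "\<dots> \<le> ennreal \<kappa> * (ennreal \<kappa> * hs_norm_sq H2 (core_op M'))"
    unfolding lift by (intro mult_left_mono lo[OF core_H2[OF A]]) auto
  finally show "hs_norm_sq H2 (core_op M) \<le> ennreal (\<kappa>\<^sup>2) * hs_norm_sq H2 (core_op M')" by (simp only: ee)
qed

end

lemma hs_norm_le:
  assumes le: "hs_norm_sq V T \<le> ennreal (c\<^sup>2) * hs_norm_sq V T'" and c: "0 < c"
  shows "hs_norm V T \<le> ennreal c * hs_norm V T'"
proof (cases "hs_norm_sq V T'")
  case top
  then have "hs_norm V T' = \<infinity>" by (simp add: hs_norm_def)
  then show ?thesis using c by (simp add: ennreal_mult_top)
next
  case (real y)
  have "hs_norm_sq V T \<le> ennreal (c\<^sup>2 * y)" using le real by (simp add: ennreal_mult)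
  then obtain x where x: "0 \<le> x" "hs_norm_sq V T = ennreal x"
    by (cases "hs_norm_sq V T") (auto simp: top_unique)
  have "x \<le> c\<^sup>2 * y" using \<open>hs_norm_sq V T \<le> ennreal (c\<^sup>2 * y)\<close> x real by (simp add: ennreal_le_iff)
  then have "sqrt x \<le> sqrt (c\<^sup>2 * y)" by (rule real_sqrt_le_mono)
  then have "sqrt x \<le> c * sqrt y" using c by (simp add: real_sqrt_mult)
  then have "ennreal (sqrt x) \<le> ennreal c * ennreal (sqrt y)"
    using c real(1) by (simp add: ennreal_leI flip: ennreal_mult)
  then show ?thesis using x real by (simp add: hs_norm_def)
qed

theorem theorem3p2:
  fixes \<theta> \<phi> :: "complex \<Rightarrow> complex" and M M' :: "fun2 set"
  assumes "inner_function \<theta>" and "\<not> \<theta> constant_on disk"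
    and "inner_function \<phi>" and "\<not> \<phi> constant_on disk"
    and "submodule M"
    and "M' = generated_submodule (comp_op \<theta> \<phi> ` M)"
  shows "(hilbert_schmidt M \<longleftrightarrow> hilbert_schmidt M') \<and>
    ennreal ((1 - norm (\<theta> 0)) / (1 + norm (\<theta> 0)) * ((1 - norm (\<phi> 0)) / (1 + norm (\<phi> 0))))
        * hs_norm H2 (core_op M) \<le> hs_norm H2 (core_op M') \<and>
    hs_norm H2 (core_op M') \<le>
      ennreal ((1 + norm (\<theta> 0)) / (1 - norm (\<theta> 0)) * ((1 + norm (\<phi> 0)) / (1 - norm (\<phi> 0))))
        * hs_norm H2 (core_op M)"
proof -
  interpret L: lifted_submodule \<theta> \<phi> M
    by standard (fact assms)+
  have M': "M' = L.M'" unfolding assms(6) L.M'_def ..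
  note le = L.hs_norm_sq_lift[folded M']
  have lt: "ennreal (L.\<kappa>\<^sup>2) < \<infinity>" by simp
  have "hilbert_schmidt M \<longleftrightarrow> hilbert_schmidt M'"
    unfolding L.hilbert_schmidt_iff L.lift.hilbert_schmidt_iff[folded M']
    using le lt by (metis ennreal_mult_less_top infinity_ennreal_def order_le_less_trans)
  moreover have "ennreal (inverse L.\<kappa>) * hs_norm H2 (core_op M) \<le> hs_norm H2 (core_op M')"
  proof -
    have "ennreal (inverse L.\<kappa>) * hs_norm H2 (core_op M)
        \<le> ennreal (inverse L.\<kappa>) * (ennreal L.\<kappa> * hs_norm H2 (core_op M'))"
      by (intro mult_left_mono hs_norm_le[OF le(2) L.\<kappa>_pos]) simp
    also have "\<dots> = ennreal (inverse L.\<kappa> * L.\<kappa>) * hs_norm H2 (core_op M')"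
      using L.\<kappa>_pos by (subst ennreal_mult) (simp_all add: mult.assoc)
    finally show ?thesis using L.\<kappa>_pos by simp
  qed
  moreover have "hs_norm H2 (core_op M') \<le> ennreal L.\<kappa> * hs_norm H2 (core_op M)"
    by (rule hs_norm_le[OF le(1) L.\<kappa>_pos])
  ultimately show ?thesis
    unfolding L.\<kappa>_def inverse_mult_distrib poisson_const_def inverse_divide by blast
qed

end
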